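(* Let $E\to(M,I)$ be a real vector bundle of rank $2n$ over a complex manifold, equipped with a connection $\nabla$ with $(1,1)$ curvature and a section $J$ of $\mathcal{C}(E)$ with $\nabla J=0$. Let $\mathcal{C}^{\#}(J)$ be any of $\mathcal{C}^{(m_1,* )}(J)$, $\mathcal{C}^{( *,m_{-1})}(J)$, $\mathcal{C}^{(m_1,m_{-1})}(J)$. Then for every $K\in\mathcal{C}^{\#}(J)$, $$T_{K}\mathcal{C}^{\#}(J)= V_{K}\mathcal{C}^{\#}(J) \oplus H_{K}^{\nabla}\mathcal{C}.$$
   Context: $\mathcal{C}=\mathcal{C}(E)=\{j\in \operatorname{End}E \mid j^2=-1\}$ with projection $\pi:\mathcal{C}\to M$. $(1,1)$ curvature means $R^{\nabla}(Iu,Iv)=R^{\nabla}(u,v)$ for all $u,v$. The connection $\nabla$ splits $T\mathcal{C}=V\mathcal{C}\oplus H^\nabla\mathcal{C}$, where $V_K\mathcal{C}=T_K\mathcal{C}(E_{\pi(K)})=\{A\in\operatorname{End}(E_{\pi(K)})\mid AK+KA=0\}$ is the vertical space and $H^\nabla_K\mathcal{C}$ is the set of all $\frac{dK(t)}{dt}|_{t=0}$ where $K(t)$ is the $\nabla$-parallel translate of $K=K(0)$ along a curve in $M$. For $K\in\mathcal{C}(E)$ write $J$ for $J_{\pi(K)}$. Define $\mathcal{C}^{(m_1,* )}(J)=\{K\mid \dim\operatorname{Ker}(J+K)=2m_1\}$, $\mathcal{C}^{( *,m_{-1})}(J)=\{K\mid \dim\operatorname{Ker}(J-K)=2m_{-1}\}$,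 and $\mathcal{C}^{(m_1,m_{-1})}(J)=\mathcal{C}^{(m_1,* )}(J)\cap\mathcal{C}^{( *,m_{-1})}(J)$; these are submanifolds of $\mathcal{C}$. $V_K\mathcal{C}^{\#}(J)$ denotes the tangent space at $K$ of the fibre $\mathcal{C}^{\#}(J)\cap\mathcal{C}(E_{\pi(K)})$. *)

theory Defs
  imports "HOL-Analysis.Analysis" "HOL-Library.Function_Algebras"
begin

section \<open>Functions with values in a real vector space\<close>

instantiation "fun" :: (type, real_vector) real_vector
begin

definition scaleR_fun :: "real \<Rightarrow> ('a \<Rightarrow> 'b) \<Rightarrow> 'a \<Rightarrow> 'b"
  where "scaleR_fun r f = (\<lambda>x. r *\<^sub>R f x)"

instance
  by standard (simp_all add: scaleR_fun_def fun_eq_iff scaleR_add_right scaleR_add_left)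

end

definition is_direct_sum :: "'a::real_vector set \<Rightarrow> 'a set \<Rightarrow> 'a set \<Rightarrow> bool" where
  "is_direct_sum T V H \<longleftrightarrow>
     subspace V \<and> subspace H \<and> V \<inter> H = {0} \<and> T = {v + h |v h. v \<in> V \<and> h \<in> H}"


section \<open>Smooth maps\<close>

text \<open>Only used on open sets of finite-dimensional spaces; there it says that all iterated
  directional derivatives exist and are continuous.\<close>

primrec ck_on :: "nat \<Rightarrow> 'a::real_normed_vector set \<Rightarrow> ('a \<Rightarrow> 'b::real_normed_vector) \<Rightarrow> bool" where
  "ck_on 0 S f \<longleftrightarrow> continuous_on S f"
| "ck_on (Suc k) S f \<longleftrightarrow>
     (\<forall>x\<in>S. f differentiable (at x)) \<and> (\<forall>v. ck_on k S (\<lambda>x. frechet_derivative f (at x) v))"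

definition smooth_on :: "'a::real_normed_vector set \<Rightarrow> ('a \<Rightarrow> 'b::real_normed_vector) \<Rightarrow> bool" where
  "smooth_on S f \<longleftrightarrow> (\<forall>k. ck_on k S f)"


section \<open>Charts, smooth maps between manifolds, tangent vectors\<close>

text \<open>A chart is a pair of its domain and its coordinate map. An atlas is a set of charts.\<close>

type_synonym ('p, 'v) chart = "'p set \<times> ('p \<Rightarrow> 'v)"

abbreviation chart_inv :: "('p, 'v) chart \<Rightarrow> 'v \<Rightarrow> 'p" where
  "chart_inv \<kappa> \<equiv> inv_into (fst \<kappa>) (snd \<kappa>)"

definition transition :: "('p, 'v) chart \<Rightarrow> ('p, 'v) chart \<Rightarrow> 'v \<Rightarrow> 'v" where
  "transition \<kappa> \<mu> = snd \<mu> \<circ> chart_inv \<kappa>"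

definition std_atlas :: "('v, 'v) chart set" where
  "std_atlas = {(UNIV, \<lambda>x. x)}"

text \<open>Smoothness of a map on an open subset \<open>S\<close> of a manifold.\<close>

definition smooth_map_on ::
    "('p, 'v::real_normed_vector) chart set \<Rightarrow> ('q, 'w::real_normed_vector) chart set \<Rightarrow>
     'p set \<Rightarrow> ('p \<Rightarrow> 'q) \<Rightarrow> bool" where
  "smooth_map_on A B S f \<longleftrightarrow>
     (\<forall>p\<in>S. \<exists>\<kappa>\<in>A. \<exists>\<mu>\<in>B. \<exists>W. p \<in> fst \<kappa> \<and> open W \<and> snd \<kappa> p \<in> W \<and> W \<subseteq> snd \<kappa> ` fst \<kappa> \<and>
        chart_inv \<kappa> ` W \<subseteq> S \<and> f ` chart_inv \<kappa> ` W \<subseteq> fst \<mu> \<and>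
        smooth_on W (snd \<mu> \<circ> f \<circ> chart_inv \<kappa>))"

text \<open>A tangent vector at \<open>p\<close> is a family of coordinate vectors, one for each chart around \<open>p\<close>,
  that transforms with the Jacobians of the chart changes. It is put to \<open>0\<close> on everything that is
  not a chart around \<open>p\<close>, so that the tangent space is a linear subspace of the space of all
  such families.\<close>

type_synonym ('p, 'v) tvec = "('p, 'v) chart \<Rightarrow> 'v"

definition tangent_space ::
    "('p, 'v::real_normed_vector) chart set \<Rightarrow> 'p \<Rightarrow> ('p, 'v) tvec set" where
  "tangent_space A p = {v.
     (\<forall>\<kappa>. \<not> (\<kappa> \<in> A \<and> p \<in> fst \<kappa>) \<longrightarrow> v \<kappa> = 0) \<and>
     (\<forall>\<kappa>\<in>A. \<forall>\<mu>\<in>A. p \<in> fst \<kappa> \<and> p \<in> fst \<mu> \<longrightarrow>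
        v \<mu> = frechet_derivative (transition \<kappa> \<mu>) (at (snd \<kappa> p)) (v \<kappa>))}"

definition velocity ::
    "('p, 'v::real_normed_vector) chart set \<Rightarrow> (real \<Rightarrow> 'p) \<Rightarrow> real \<Rightarrow> ('p, 'v) tvec" where
  "velocity A c t = (\<lambda>\<kappa>. if \<kappa> \<in> A \<and> c t \<in> fst \<kappa>
      then vector_derivative (snd \<kappa> \<circ> c) (at t) else 0)"

text \<open>The tangent space at \<open>p\<close> of a submanifold \<open>S\<close>, as a subset of the tangent space of the
  ambient manifold.\<close>

definition tangent_to ::
    "('p, 'v::real_normed_vector) chart set \<Rightarrow> 'p set \<Rightarrow> 'p \<Rightarrow> ('p, 'v) tvec set" where
  "tangent_to A S p = {velocity A c 0 |c. \<exists>\<epsilon>>0.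
      smooth_map_on std_atlas A {-\<epsilon><..<\<epsilon>} c \<and> c 0 = p \<and> c ` {-\<epsilon><..<\<epsilon>} \<subseteq> S}"

definition smooth_vector_field ::
    "('p, 'v::real_normed_vector) chart set \<Rightarrow> 'p set \<Rightarrow> ('p \<Rightarrow> ('p, 'v) tvec) \<Rightarrow> bool" where
  "smooth_vector_field A S X \<longleftrightarrow>
     (\<forall>p\<in>S. X p \<in> tangent_space A p) \<and>
     (\<forall>\<kappa>\<in>A. smooth_on (snd \<kappa> ` (fst \<kappa> \<inter> S)) (\<lambda>z. X (chart_inv \<kappa> z) \<kappa>))"

text \<open>The derivative \<open>v(f)\<close> of a function along a tangent vector, computed in the chart \<open>\<kappa>\<close>.\<close>

definition dir_deriv ::
    "('p, 'v::real_normed_vector) chart \<Rightarrow> 'p \<Rightarrow> ('p, 'v) tvec \<Rightarrow>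
     ('p \<Rightarrow> 'b::real_normed_vector) \<Rightarrow> 'b" where
  "dir_deriv \<kappa> p v f = frechet_derivative (f \<circ> chart_inv \<kappa>) (at (snd \<kappa> p)) (v \<kappa>)"

definition lie_bracket ::
    "('p, 'v::real_normed_vector) chart set \<Rightarrow> ('p \<Rightarrow> ('p, 'v) tvec) \<Rightarrow> ('p \<Rightarrow> ('p, 'v) tvec) \<Rightarrow>
     'p \<Rightarrow> ('p, 'v) tvec" where
  "lie_bracket A X Y p = (\<lambda>\<kappa>. if \<kappa> \<in> A \<and> p \<in> fst \<kappa>
      then dir_deriv \<kappa> p (X p) (\<lambda>q. Y q \<kappa>) - dir_deriv \<kappa> p (Y p) (\<lambda>q. X q \<kappa>) else 0)"


section \<open>Complex manifolds\<close>

text \<open>Chart changes are holomorphic maps between open subsets of complex coordinate space,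
  that is, smooth maps with complex linear differential.\<close>

definition complex_manifold ::
    "('m::{t2_space, second_countable_topology}, complex^'d) chart set \<Rightarrow> bool" where
  "complex_manifold A \<longleftrightarrow>
     (\<Union>\<kappa>\<in>A. fst \<kappa>) = UNIV \<and>
     (\<forall>\<kappa>\<in>A. open (fst \<kappa>) \<and> open (snd \<kappa> ` fst \<kappa>) \<and>
        homeomorphism (fst \<kappa>) (snd \<kappa> ` fst \<kappa>) (snd \<kappa>) (chart_inv \<kappa>)) \<and>
     (\<forall>\<kappa>\<in>A. \<forall>\<mu>\<in>A.
        smooth_on (snd \<kappa> ` (fst \<kappa> \<inter> fst \<mu>)) (transition \<kappa> \<mu>) \<and>
        (\<forall>z\<in>snd \<kappa> ` (fst \<kappa> \<inter> fst \<mu>). \<forall>v.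
           frechet_derivative (transition \<kappa> \<mu>) (at z) (\<i> *s v) =
           \<i> *s frechet_derivative (transition \<kappa> \<mu>) (at z) v))"

definition cstruct :: "('m, complex^'d) tvec \<Rightarrow> ('m, complex^'d) tvec" where
  "cstruct v = (\<lambda>\<kappa>. \<i> *s v \<kappa>)"


section \<open>Real vector bundles and their endomorphism bundles\<close>

text \<open>The type \<open>'e\<close> is the total space. The maps \<open>vadd\<close> and \<open>vscale\<close> are the linear structure of
  the fibres. A local trivialisation \<open>(U, \<Phi>)\<close> consists of its domain \<open>U\<close> in the base
  and the fibre coordinate \<open>\<Phi>\<close>.\<close>

record ('m, 'e, 'k::finite) vbundle =
  proj :: "'e \<Rightarrow> 'm"
  vadd :: "'e \<Rightarrow> 'e \<Rightarrow> 'e"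
  vscale :: "real \<Rightarrow> 'e \<Rightarrow> 'e"
  trivs :: "('m set \<times> ('e \<Rightarrow> real^'k)) set"

definition fibre :: "('m, 'e, 'k::finite) vbundle \<Rightarrow> 'm \<Rightarrow> 'e set" where
  "fibre E x = {e. proj E e = x}"

definition vsub :: "('m, 'e, 'k::finite) vbundle \<Rightarrow> 'e \<Rightarrow> 'e \<Rightarrow> 'e" where
  "vsub E a b = vadd E a (vscale E (-1) b)"

definition triv_inv :: "('m, 'e, 'k::finite) vbundle \<Rightarrow> ('e \<Rightarrow> real^'k) \<Rightarrow> 'm \<Rightarrow> real^'k \<Rightarrow> 'e" where
  "triv_inv E \<Phi> x = inv_into (fibre E x) \<Phi>"

definition vector_bundle ::
    "('m::topological_space, complex^'d) chart set \<Rightarrow> ('m, 'e, 'k::finite) vbundle \<Rightarrow> bool" where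
  "vector_bundle A E \<longleftrightarrow>
     (\<Union>(U, \<Phi>)\<in>trivs E. U) = UNIV \<and>
     (\<forall>(U, \<Phi>)\<in>trivs E. open U \<and>
        (\<forall>x\<in>U. bij_betw \<Phi> (fibre E x) UNIV \<and>
           (\<forall>a\<in>fibre E x. \<forall>b\<in>fibre E x.
              vadd E a b \<in> fibre E x \<and> \<Phi> (vadd E a b) = \<Phi> a + \<Phi> b) \<and>
           (\<forall>r. \<forall>a\<in>fibre E x.
              vscale E r a \<in> fibre E x \<and> \<Phi> (vscale E r a) = r *\<^sub>R \<Phi> a))) \<and>
     (\<forall>(U, \<Phi>)\<in>trivs E. \<forall>(W, \<Psi>)\<in>trivs E. \<forall>w.
        smooth_map_on A std_atlas (U \<inter> W) (\<lambda>x. \<Psi> (triv_inv E \<Phi> x w)))"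

definition total_atlas ::
    "('m, complex^'d) chart set \<Rightarrow> ('m, 'e, 'k::finite) vbundle \<Rightarrow>
     ('e, (complex^'d) \<times> (real^'k)) chart set" where
  "total_atlas A E =
     {({e. proj E e \<in> U \<inter> W}, \<lambda>e. (\<phi> (proj E e), \<Phi> e)) |U \<phi> W \<Phi>. (U, \<phi>) \<in> A \<and> (W, \<Phi>) \<in> trivs E}"

definition smooth_section ::
    "('m, complex^'d) chart set \<Rightarrow> ('m, 'e, 'k::finite) vbundle \<Rightarrow> 'm set \<Rightarrow> ('m \<Rightarrow> 'e) \<Rightarrow> bool" where
  "smooth_section A E S s \<longleftrightarrow>
     (\<forall>x\<in>S. s x \<in> fibre E x) \<and> smooth_map_on A (total_atlas A E) S s"

text \<open>\<open>End_fibre E x\<close> is the space of linear endomorphisms of the fibre over \<open>x\<close>, as functions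
  that are \<open>undefined\<close> outside the fibre. Points of the total space of \<open>End E\<close> are pairs
  \<open>(x, B)\<close> with \<open>B \<in> End_fibre E x\<close>; its bundle charts take the matrix of \<open>B\<close> in a
  trivialisation.\<close>

definition End_fibre :: "('m, 'e, 'k::finite) vbundle \<Rightarrow> 'm \<Rightarrow> ('e \<Rightarrow> 'e) set" where
  "End_fibre E x = {B. B \<in> extensional (fibre E x) \<and>
     (\<forall>a\<in>fibre E x. B a \<in> fibre E x) \<and>
     (\<forall>a\<in>fibre E x. \<forall>b\<in>fibre E x. B (vadd E a b) = vadd E (B a) (B b)) \<and>
     (\<forall>r. \<forall>a\<in>fibre E x. B (vscale E r a) = vscale E r (B a))}"

definition End_atlas ::
    "('m, complex^'d) chart set \<Rightarrow> ('m, 'e, 'k::finite) vbundle \<Rightarrow>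
     ('m \<times> ('e \<Rightarrow> 'e), (complex^'d) \<times> (real^'k^'k)) chart set" where
  "End_atlas A E =
     {({(x, B). x \<in> U \<inter> W \<and> B \<in> End_fibre E x},
       \<lambda>(x, B). (\<phi> x, matrix (\<lambda>w. \<Phi> (B (triv_inv E \<Phi> x w))))) |U \<phi> W \<Phi>.
       (U, \<phi>) \<in> A \<and> (W, \<Phi>) \<in> trivs E}"

text \<open>The dimension of a subspace of a fibre does not depend on the trivialisation in which
  it is read off.\<close>

definition has_fibre_dim :: "('m, 'e, 'k::finite) vbundle \<Rightarrow> 'm \<Rightarrow> 'e set \<Rightarrow> nat \<Rightarrow> bool" where
  "has_fibre_dim E x N d \<longleftrightarrow> (\<forall>(U, \<Phi>)\<in>trivs E. x \<in> U \<longrightarrow> dim (\<Phi> ` N) = d)"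


section \<open>Connections\<close>

text \<open>\<open>nab x v s\<close> is the covariant derivative at \<open>x\<close>, along the tangent vector \<open>v\<close> at \<open>x\<close>, of a
  section \<open>s\<close> that is smooth on some open neighbourhood of \<open>x\<close>.\<close>

type_synonym ('m, 'd, 'e) conn = "'m \<Rightarrow> ('m, complex^'d) tvec \<Rightarrow> ('m \<Rightarrow> 'e) \<Rightarrow> 'e"

definition connection ::
    "('m::topological_space, complex^'d) chart set \<Rightarrow> ('m, 'e, 'k::finite) vbundle \<Rightarrow>
     ('m, 'd, 'e) conn \<Rightarrow> bool" where
  "connection A E nab \<longleftrightarrow>
     (\<forall>U s x. open U \<and> x \<in> U \<and> smooth_section A E U s \<longrightarrow>
        \<comment> \<open>values, and linearity in the direction\<close>
        (\<forall>v\<in>tangent_space A x. nab x v s \<in> fibre E x) \<and>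
        (\<forall>v\<in>tangent_space A x. \<forall>w\<in>tangent_space A x.
           nab x (v + w) s = vadd E (nab x v s) (nab x w s)) \<and>
        (\<forall>r. \<forall>v\<in>tangent_space A x. nab x (r *\<^sub>R v) s = vscale E r (nab x v s)) \<and>
        \<comment> \<open>dependence on the germ of the section only, and additivity\<close>
        (\<forall>s'. smooth_section A E U s' \<longrightarrow> (\<forall>v\<in>tangent_space A x.
           ((\<forall>y\<in>U. s y = s' y) \<longrightarrow> nab x v s = nab x v s') \<and>
           nab x v (\<lambda>y. vadd E (s y) (s' y)) = vadd E (nab x v s) (nab x v s'))) \<and>
        \<comment> \<open>Leibniz rule\<close>
        (\<forall>f::'m \<Rightarrow> real. smooth_map_on A std_atlas U f \<longrightarrow>
           (\<forall>v\<in>tangent_space A x. \<forall>\<kappa>\<in>A. x \<in> fst \<kappa> \<longrightarrow>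
              nab x v (\<lambda>y. vscale E (f y) (s y)) =
              vadd E (vscale E (dir_deriv \<kappa> x v f) (s x)) (vscale E (f x) (nab x v s))))) \<and>
     (\<forall>U s X. open U \<and> smooth_section A E U s \<and> smooth_vector_field A U X \<longrightarrow>
        smooth_section A E U (\<lambda>x. nab x (X x) s))"

definition curvature ::
    "('m, complex^'d) chart set \<Rightarrow> ('m, 'e, 'k::finite) vbundle \<Rightarrow> ('m, 'd, 'e) conn \<Rightarrow>
     ('m \<Rightarrow> ('m, complex^'d) tvec) \<Rightarrow> ('m \<Rightarrow> ('m, complex^'d) tvec) \<Rightarrow> ('m \<Rightarrow> 'e) \<Rightarrow> 'm \<Rightarrow> 'e" where
  "curvature A E nab X Y s x =
     vsub E (vsub E (nab x (X x) (\<lambda>y. nab y (Y y) s)) (nab x (Y x) (\<lambda>y. nab y (X y) s)))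
            (nab x (lie_bracket A X Y x) s)"

text \<open>The condition \<open>R(Iu, Iv) = R(u, v)\<close>, stated for local vector fields and sections;
  every tangent vector extends to a local vector field, and the curvature is tensorial.\<close>

definition curvature_1_1 ::
    "('m::topological_space, complex^'d) chart set \<Rightarrow> ('m, 'e, 'k::finite) vbundle \<Rightarrow>
     ('m, 'd, 'e) conn \<Rightarrow> bool" where
  "curvature_1_1 A E nab \<longleftrightarrow>
     (\<forall>U X Y s. open U \<and> smooth_vector_field A U X \<and> smooth_vector_field A U Y \<and>
        smooth_section A E U s \<longrightarrow>
        (\<forall>x\<in>U. curvature A E nab (\<lambda>y. cstruct (X y)) (\<lambda>y. cstruct (Y y)) s x =
               curvature A E nab X Y s x))"

text \<open>The covariant derivative along a curve \<open>c\<close> in the base of a section \<open>s\<close> along \<open>c\<close>: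
  if \<open>s = \<Sum>b. s\<^sub>b e\<^sub>b\<close> in the local frame \<open>e\<^sub>b\<close> of the trivialisation \<open>\<Phi>\<close>, then it is
  \<open>\<Sum>b. s\<^sub>b' e\<^sub>b + s\<^sub>b \<nabla>\<^sub>c\<^sub>' e\<^sub>b\<close>. It does not depend on the trivialisation.\<close>

definition cov_along ::
    "('m, complex^'d) chart set \<Rightarrow> ('m, 'e, 'k::finite) vbundle \<Rightarrow> ('m, 'd, 'e) conn \<Rightarrow>
     ('e \<Rightarrow> real^'k) \<Rightarrow> (real \<Rightarrow> 'm) \<Rightarrow> (real \<Rightarrow> 'e) \<Rightarrow> real \<Rightarrow> 'e" where
  "cov_along A E nab \<Phi> c s t = triv_inv E \<Phi> (c t)
     (vector_derivative (\<lambda>r. \<Phi> (s r)) (at t) +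
      (\<Sum>b\<in>UNIV. (\<Phi> (s t) $ b) *\<^sub>R
         \<Phi> (nab (c t) (velocity A c t) (\<lambda>y. triv_inv E \<Phi> y (axis b 1)))))"

text \<open>\<open>B\<close> is a section of \<open>End E\<close> along \<open>c\<close> that is parallel for the connection induced on \<open>End E\<close>,
  \<open>(\<nabla>B)s = \<nabla>(Bs) - B(\<nabla>s)\<close>.\<close>

definition parallel_along ::
    "('m, complex^'d) chart set \<Rightarrow> ('m, 'e, 'k::finite) vbundle \<Rightarrow> ('m, 'd, 'e) conn \<Rightarrow>
     real set \<Rightarrow> (real \<Rightarrow> 'm) \<Rightarrow> (real \<Rightarrow> 'e \<Rightarrow> 'e) \<Rightarrow> bool" where
  "parallel_along A E nab T c B \<longleftrightarrow>
     smooth_map_on std_atlas (End_atlas A E) T (\<lambda>t. (c t, B t)) \<and>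
     (\<forall>s. smooth_map_on std_atlas (total_atlas A E) T s \<and> (\<forall>t\<in>T. s t \<in> fibre E (c t)) \<longrightarrow>
        (\<forall>t\<in>T. \<forall>(W, \<Phi>)\<in>trivs E. c t \<in> W \<longrightarrow>
           cov_along A E nab \<Phi> c (\<lambda>r. B r (s r)) t = B t (cov_along A E nab \<Phi> c s t)))"

text \<open>\<open>\<nabla>J = 0\<close>, where \<open>(\<nabla>J)s = \<nabla>(Js) - J(\<nabla>s)\<close>.\<close>

definition parallel_section ::
    "('m::topological_space, complex^'d) chart set \<Rightarrow> ('m, 'e, 'k::finite) vbundle \<Rightarrow>
     ('m, 'd, 'e) conn \<Rightarrow> ('m \<Rightarrow> 'e \<Rightarrow> 'e) \<Rightarrow> bool" where
  "parallel_section A E nab J \<longleftrightarrow>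
     (\<forall>U s. open U \<and> smooth_section A E U s \<longrightarrow>
        (\<forall>x\<in>U. \<forall>v\<in>tangent_space A x. nab x v (\<lambda>y. J y (s y)) = J x (nab x v s)))"


section \<open>Twistor spaces\<close>

definition twistor_space :: "('m, 'e, 'k::finite) vbundle \<Rightarrow> ('m \<times> ('e \<Rightarrow> 'e)) set" where
  "twistor_space E =
     {(x, K). K \<in> End_fibre E x \<and> (\<forall>a\<in>fibre E x. K (K a) = vscale E (-1) a)}"

definition smooth_twistor_section ::
    "('m, complex^'d) chart set \<Rightarrow> ('m, 'e, 'k::finite) vbundle \<Rightarrow> ('m \<Rightarrow> 'e \<Rightarrow> 'e) \<Rightarrow> bool" where
  "smooth_twistor_section A E J \<longleftrightarrow>
     (\<forall>x. (x, J x) \<in> twistor_space E) \<and>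
     smooth_map_on A (End_atlas A E) UNIV (\<lambda>x. (x, J x))"

text \<open>The kernels of \<open>P + Q\<close> and \<open>P - Q\<close> on the fibre over \<open>x\<close>. The zero of the fibre is written
  \<open>vscale E 0 a\<close> for an arbitrary \<open>a\<close> in it.\<close>

definition Ker_plus ::
    "('m, 'e, 'k::finite) vbundle \<Rightarrow> 'm \<Rightarrow> ('e \<Rightarrow> 'e) \<Rightarrow> ('e \<Rightarrow> 'e) \<Rightarrow> 'e set" where
  "Ker_plus E x P Q = {a \<in> fibre E x. vadd E (P a) (Q a) = vscale E 0 a}"

definition Ker_minus ::
    "('m, 'e, 'k::finite) vbundle \<Rightarrow> 'm \<Rightarrow> ('e \<Rightarrow> 'e) \<Rightarrow> ('e \<Rightarrow> 'e) \<Rightarrow> 'e set" where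
  "Ker_minus E x P Q = {a \<in> fibre E x. vsub E (P a) (Q a) = vscale E 0 a}"

text \<open>The strata are fixed by the dimensions of the \<open>\<plusminus>1\<close>-eigenspaces of \<open>JK\<close>: \<open>Ker (J + K)\<close> is the
  one for \<open>1\<close>, \<open>Ker (J - K)\<close> the one for \<open>-1\<close>. The index \<open>m2\<close> stands for \<open>m\<^sub>-\<^sub>1\<close>.\<close>

definition C_plus ::
    "('m, 'e, 'k::finite) vbundle \<Rightarrow> ('m \<Rightarrow> 'e \<Rightarrow> 'e) \<Rightarrow> nat \<Rightarrow> ('m \<times> ('e \<Rightarrow> 'e)) set" where
  "C_plus E J m1 =
     {(x, K) \<in> twistor_space E. has_fibre_dim E x (Ker_plus E x (J x) K) (2 * m1)}"

definition C_minus ::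
    "('m, 'e, 'k::finite) vbundle \<Rightarrow> ('m \<Rightarrow> 'e \<Rightarrow> 'e) \<Rightarrow> nat \<Rightarrow> ('m \<times> ('e \<Rightarrow> 'e)) set" where
  "C_minus E J m2 =
     {(x, K) \<in> twistor_space E. has_fibre_dim E x (Ker_minus E x (J x) K) (2 * m2)}"

definition C_both ::
    "('m, 'e, 'k::finite) vbundle \<Rightarrow> ('m \<Rightarrow> 'e \<Rightarrow> 'e) \<Rightarrow> nat \<Rightarrow> nat \<Rightarrow> ('m \<times> ('e \<Rightarrow> 'e)) set" where
  "C_both E J m1 m2 = C_plus E J m1 \<inter> C_minus E J m2"

definition vertical_space ::
    "('m, complex^'d) chart set \<Rightarrow> ('m, 'e, 'k::finite) vbundle \<Rightarrow> ('m \<times> ('e \<Rightarrow> 'e)) set \<Rightarrow>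
     'm \<times> ('e \<Rightarrow> 'e) \<Rightarrow> ('m \<times> ('e \<Rightarrow> 'e), (complex^'d) \<times> (real^'k^'k)) tvec set" where
  "vertical_space A E S p = tangent_to (End_atlas A E) {q \<in> S. fst q = fst p} p"

definition horizontal_space ::
    "('m, complex^'d) chart set \<Rightarrow> ('m, 'e, 'k::finite) vbundle \<Rightarrow> ('m, 'd, 'e) conn \<Rightarrow>
     'm \<times> ('e \<Rightarrow> 'e) \<Rightarrow> ('m \<times> ('e \<Rightarrow> 'e), (complex^'d) \<times> (real^'k^'k)) tvec set" where
  "horizontal_space A E nab p =
     {velocity (End_atlas A E) (\<lambda>t. (c t, B t)) 0 |c B. \<exists>\<epsilon>>0.
        smooth_map_on std_atlas A {-\<epsilon><..<\<epsilon>} c \<and> (c 0, B 0) = p \<and>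
        parallel_along A E nab {-\<epsilon><..<\<epsilon>} c B}"

end

theory Submission
  imports Defs
begin

text \<open>
  Let \<open>x = \<pi>(K)\<close>. Fix a chart \<open>\<kappa>\<close> of the base and a trivialisation \<open>\<Phi>\<close> of \<open>E\<close> around \<open>x\<close>. In the
  bundle chart that they define, a point of \<open>End E\<close> is a pair \<open>(z, b)\<close> of coordinates and a matrix, the
  section \<open>J\<close> is a matrix-valued function \<open>j\<close>, and \<open>\<nabla>\<close> is the derivative plus a matrix \<open>\<omega>(v)\<close> that
  depends linearly on the direction \<open>v\<close> (lemma \<open>nab_local\<close>). Let \<open>b\<^sub>0\<close> and \<open>j\<^sub>0\<close> be the matrices of \<open>K\<close> and
  \<open>J\<close> at \<open>x\<close>, let \<open>P = j\<^sub>0 + b\<^sub>0\<close> and \<open>Q = j\<^sub>0 - b\<^sub>0\<close>. A tangent vector of \<open>End E\<close> at \<open>K\<close> is determined by its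
  coordinates in this one chart, through the linear map \<open>End_lift\<close>, so all three spaces can be
  computed there.

  The horizontal space is a graph. A curve is parallel iff \<open>b' = b \<omega> - \<omega> b\<close>, and this linear
  differential equation can be solved along a curve with any given initial velocity; hence the
  horizontal vectors are the pairs \<open>(v, b\<^sub>0 \<omega>(v) - \<omega>(v) b\<^sub>0)\<close> (lemmas \<open>parallel_along_deriv\<close> and
  \<open>parallel_along_exists\<close>).

  The vertical space is \<open>0 \<times> V\<^sub>0\<close> for a linear space \<open>V\<^sub>0\<close> of matrices, \<open>stratum_tangent\<close>. The derivative of a curve of
  matrices of constant rank maps the kernel into the range (lemma \<open>deriv_maps_ker_into_range\<close>).
  So the velocity \<open>X\<close> of a curve of complex structures \<open>b\<close> with \<open>dim Ker (j\<^sub>0 + b)\<close> constant satisfies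
  \<open>X b\<^sub>0 + b\<^sub>0 X = 0\<close> and maps \<open>Ker P\<close> into \<open>Im P\<close>, and likewise for \<open>Q\<close> if \<open>dim Ker (j\<^sub>0 - b)\<close> is constant.
  Linear algebra turns these conditions into the existence of a matrix \<open>Z\<close> with \<open>X = Z b\<^sub>0 - b\<^sub>0 Z\<close>, with
  \<open>j\<^sub>0 Z + Z b\<^sub>0 = 0\<close> on \<open>Ker P\<close> and with \<open>j\<^sub>0 Z - Z b\<^sub>0 = 0\<close> on \<open>Ker Q\<close> (lemma \<open>stratum_tangentI\<close>). These
  conditions are linear in \<open>Z\<close>, and they are just what is needed to go back: with \<open>g = 1 + t Z\<close> and
  \<open>b(t) = g b\<^sub>0 g\<^sup>-\<^sup>1\<close>,
  \<open>(j\<^sub>0 + b(t)) g = P + t (j\<^sub>0 Z + Z b\<^sub>0)\<close>, so \<open>g\<close> maps \<open>Ker P\<close> into \<open>Ker (j\<^sub>0 + b(t))\<close>; as kernels cannot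
  become larger near \<open>t = 0\<close>, the dimension is constant.

  The hypothesis \<open>\<nabla>J = 0\<close> says \<open>dj(v) = j \<omega>(v) - \<omega>(v) j\<close> (lemma \<open>parallel_section_deriv\<close>). With it the
  same two arguments work over a moving base point. Constancy of the rank of \<open>j \<plusminus> b\<close> along a curve in the stratum
  with velocity \<open>(v, Y)\<close> gives \<open>Y + \<omega>(v) b\<^sub>0 - b\<^sub>0 \<omega>(v) \<in> V\<^sub>0\<close> (lemma \<open>stratum_curve_velocity\<close>). Conversely
  there is a curve of matrices \<open>g\<close> with \<open>g(0) = 1\<close>, \<open>g'(0) = - \<omega>(v)\<close> and \<open>j g = g j\<^sub>0\<close>, and conjugation by
  \<open>g (1 + t Z)\<close> gives a curve in the stratum with velocity \<open>(v, X + b\<^sub>0 \<omega>(v) - \<omega>(v) b\<^sub>0)\<close> (lemma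
  \<open>stratum_curve_exists\<close>). So the tangent space of the stratum consists of the sums of \<open>(0, X)\<close>
  with \<open>X \<in> V\<^sub>0\<close> and \<open>(v, b\<^sub>0 \<omega>(v) - \<omega>(v) b\<^sub>0)\<close>. The sum is direct, because a horizontal vector with \<open>v = 0\<close> is \<open>0\<close>.
\<close>

section \<open>Smooth maps between normed spaces\<close>

lemma ck_on_cong:
  assumes "open S" "\<And>x. x \<in> S \<Longrightarrow> f x = g x" "ck_on k S f"
  shows "ck_on k S g"
  using assms(2,3)
proof (induction k arbitrary: f g)
  case 0
  then show ?case by (simp cong: continuous_on_cong)
next
  case (Suc k)
  have d: "f differentiable (at x)" if "x \<in> S" for x
    using Suc.prems that by simp
  have g: "(g has_derivative frechet_derivative f (at x)) (at x)" if "x \<in> S" for x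
    using has_derivative_transform_within_open[OF _ \<open>open S\<close> that, of f "frechet_derivative f (at x)" UNIV g]
      d[OF that] Suc.prems(1) by (simp add: frechet_derivative_works)
  have eq: "frechet_derivative f (at x) v = frechet_derivative g (at x) v" if "x \<in> S" for x v
    using frechet_derivative_at[OF g[OF that]] by simp
  have "ck_on k S (\<lambda>x. frechet_derivative g (at x) v)" for v
    using Suc.IH[of "\<lambda>x. frechet_derivative f (at x) v"] eq Suc.prems(2) by simp
  with g show ?case by (auto simp: differentiable_def)
qed

lemma ck_on_SucD: "ck_on (Suc k) S f \<Longrightarrow> ck_on k S f"
proof (induction k arbitrary: f)
  case 0
  then show ?case
    by (auto intro!: continuous_at_imp_continuous_on differentiable_imp_continuous_within)
next
  case (Suc k)
  then show ?case by (metis ck_on.simps(2))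
qed

lemma ck_on_subset: "ck_on k S f \<Longrightarrow> T \<subseteq> S \<Longrightarrow> ck_on k T f"
  by (induction k arbitrary: f) (auto intro: continuous_on_subset)

lemma ck_on_local:
  assumes "\<And>x. x \<in> S \<Longrightarrow> \<exists>W. open W \<and> x \<in> W \<and> ck_on k W f"
  shows "ck_on k S f"
  using assms
proof (induction k arbitrary: f)
  case 0
  have "isCont f x" if "x \<in> S" for x
    using 0[OF that] continuous_on_eq_continuous_at by fastforce
  then show ?case by (simp add: continuous_at_imp_continuous_on)
next
  case (Suc k)
  have "f differentiable (at x)" if "x \<in> S" for x
    using Suc.prems[OF that] by auto
  moreover have "ck_on k S (\<lambda>x. frechet_derivative f (at x) v)" for v
  proof (rule Suc.IH)
    fix x assume "x \<in> S"
    from Suc.prems[OF this] show "\<exists>W. open W \<and> x \<in> W \<and> ck_on k W (\<lambda>x. frechet_derivative f (at x) v)"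
      by (metis ck_on.simps(2))
  qed
  ultimately show ?case by simp
qed

text \<open>For use with derivatives that are given by a formula.\<close>

lemma ck_on_SucI:
  assumes "\<And>x. x \<in> S \<Longrightarrow> (f has_derivative f' x) (at x)" "open S"
    and "\<And>v. ck_on k S (\<lambda>x. f' x v)"
  shows "ck_on (Suc k) S f"
proof -
  have "frechet_derivative f (at x) = f' x" if "x \<in> S" for x
    using frechet_derivative_at[OF assms(1)[OF that]] by simp
  then have "ck_on k S (\<lambda>x. frechet_derivative f (at x) v)" for v
    by (intro ck_on_cong[OF assms(2) _ assms(3)]) simp
  with assms(1) show ?thesis by (auto simp: differentiable_def)
qed

lemma ck_on_SucD_deriv: "ck_on (Suc k) S f \<Longrightarrow> x \<in> S \<Longrightarrow> (f has_derivative frechet_derivative f (at x)) (at x)"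
  by (simp add: frechet_derivative_works)

lemma ck_on_const: "open S \<Longrightarrow> ck_on k S (\<lambda>x. c)"
proof (induction k arbitrary: c)
  case (Suc k)
  show ?case
    by (rule ck_on_SucI[where f' = "\<lambda>x v. 0"]) (use Suc in \<open>auto\<close>)
qed simp

lemma ck_on_bounded_linear: "open S \<Longrightarrow> bounded_linear f \<Longrightarrow> ck_on k S f"
proof (cases k)
  case 0
  then show "bounded_linear f \<Longrightarrow> ?thesis" by (simp add: linear_continuous_on)
next
  case (Suc l)
  then show "open S \<Longrightarrow> bounded_linear f \<Longrightarrow> ?thesis"
    by (simp only: Suc) (rule ck_on_SucI[where f' = "\<lambda>x. f"],
      auto simp: bounded_linear_imp_has_derivative intro: ck_on_const)
qed

lemma ck_on_linear_comp:
  assumes "open S" "bounded_linear L" "ck_on k S f"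
  shows "ck_on k S (\<lambda>x. L (f x))"
  using assms(3)
proof (induction k arbitrary: f)
  case 0
  then show ?case using assms(2) by (simp add: bounded_linear.continuous_on)
next
  case (Suc k)
  show ?case
  proof (rule ck_on_SucI[where f' = "\<lambda>x v. L (frechet_derivative f (at x) v)"])
    fix x assume "x \<in> S"
    then show "((\<lambda>x. L (f x)) has_derivative (\<lambda>v. L (frechet_derivative f (at x) v))) (at x)"
      by (rule bounded_linear.has_derivative[OF assms(2) ck_on_SucD_deriv[OF Suc.prems]])
  qed (use assms Suc in auto)
qed

lemma ck_on_add:
  assumes "open S" "ck_on k S f" "ck_on k S g"
  shows "ck_on k S (\<lambda>x. f x + g x)"
  using assms(2,3)
proof (induction k arbitrary: f g)
  case 0
  then show ?case by (simp add: continuous_on_add)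
next
  case (Suc k)
  show ?case
  proof (rule ck_on_SucI[where f' = "\<lambda>x v. frechet_derivative f (at x) v + frechet_derivative g (at x) v"])
    fix x assume "x \<in> S"
    then show "((\<lambda>x. f x + g x) has_derivative (\<lambda>v. frechet_derivative f (at x) v + frechet_derivative g (at x) v)) (at x)"
      by (intro has_derivative_add ck_on_SucD_deriv[OF Suc.prems(1)] ck_on_SucD_deriv[OF Suc.prems(2)])
  qed (use assms Suc in auto)
qed

lemma ck_on_sum:
  assumes "open S" "\<And>i. i \<in> I \<Longrightarrow> ck_on k S (f i)"
  shows "ck_on k S (\<lambda>x. \<Sum>i\<in>I. f i x)"
  using assms(2)
proof (induction I rule: infinite_finite_induct)
  case (insert i I)
  then show ?case by (simp add: ck_on_add[OF assms(1)])
qed (auto simp: ck_on_const[OF assms(1)])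

lemma ck_on_bilinear:
  assumes "open S" "bounded_bilinear b" "ck_on k S f" "ck_on k S g"
  shows "ck_on k S (\<lambda>x. b (f x) (g x))"
  using assms(3,4)
proof (induction k arbitrary: f g)
  case 0
  then show ?case using assms(2) by (simp add: bounded_bilinear.continuous_on)
next
  case (Suc k)
  show ?case
  proof (rule ck_on_SucI[where f' = "\<lambda>x v. b (f x) (frechet_derivative g (at x) v) + b (frechet_derivative f (at x) v) (g x)"])
    fix x assume "x \<in> S"
    then show "((\<lambda>x. b (f x) (g x)) has_derivative (\<lambda>v. b (f x) (frechet_derivative g (at x) v) + b (frechet_derivative f (at x) v) (g x))) (at x)"
      by (intro bounded_bilinear.FDERIV[OF assms(2)] ck_on_SucD_deriv[OF Suc.prems(1)] ck_on_SucD_deriv[OF Suc.prems(2)])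
  next
    fix v
    have "ck_on k S f" "ck_on k S g" using Suc.prems ck_on_SucD by blast+
    then show "ck_on k S (\<lambda>x. b (f x) (frechet_derivative g (at x) v) + b (frechet_derivative f (at x) v) (g x))"
      using Suc.prems by (intro ck_on_add[OF assms(1)] Suc.IH) auto
  qed fact
qed

text \<open>The derivative \<open>D(f \<circ> g)(x) v\<close> is the sum of \<open>(Dg(x) v \<bullet> b) *\<^sub>R Df(g x) b\<close> over a basis, so
  the induction hypothesis applies to the directional derivatives of \<open>f\<close> one by one. This is why the domain of \<open>f\<close> is Euclidean.\<close>

lemma ck_on_compose:
  fixes g :: "'a::real_normed_vector \<Rightarrow> 'b::euclidean_space" and f :: "'b \<Rightarrow> 'c::real_normed_vector"
  assumes "open S" "open T" "g ` S \<subseteq> T" "ck_on k T f" "ck_on k S g"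
  shows "ck_on k S (\<lambda>x. f (g x))"
  using assms(4,5)
proof (induction k arbitrary: f)
  case 0
  then show ?case using assms(3) by (auto intro: continuous_on_compose2)
next
  case (Suc k)
  let ?Df = "\<lambda>x. frechet_derivative f (at x)" and ?Dg = "\<lambda>x. frechet_derivative g (at x)"
  show ?case
  proof (rule ck_on_SucI[where f' = "\<lambda>x v. ?Df (g x) (?Dg x v)"])
    fix x assume "x \<in> S"
    then show "((\<lambda>x. f (g x)) has_derivative (\<lambda>v. ?Df (g x) (?Dg x v))) (at x)"
      using assms(3) by (intro has_derivative_compose[of g "?Dg x" x UNIV f "?Df (g x)"]
          ck_on_SucD_deriv[OF Suc.prems(2)] ck_on_SucD_deriv[OF Suc.prems(1)]) auto
  next
    fix v
    have gk: "ck_on k S g" using Suc.prems(2) ck_on_SucD by blast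
    have "ck_on k S (\<lambda>x. \<Sum>b\<in>Basis. (?Dg x v \<bullet> b) *\<^sub>R ?Df (g x) b)"
    proof (rule ck_on_sum[OF assms(1)])
      fix b :: 'b
      have "ck_on k T (\<lambda>y. ?Df y b)" using Suc.prems(1) by simp
      then have "ck_on k S (\<lambda>x. ?Df (g x) b)" using Suc.IH gk by blast
      moreover have "ck_on k S (\<lambda>x. ?Dg x v \<bullet> b)"
        using Suc.prems(2) by (intro ck_on_linear_comp[OF assms(1) bounded_linear_inner_left]) auto
      ultimately show "ck_on k S (\<lambda>x. (?Dg x v \<bullet> b) *\<^sub>R ?Df (g x) b)"
        by (intro ck_on_bilinear[OF assms(1) bounded_bilinear_scaleR])
    qed
    moreover have "(\<Sum>b\<in>Basis. (?Dg x v \<bullet> b) *\<^sub>R ?Df (g x) b) = ?Df (g x) (?Dg x v)" if "x \<in> S" for x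
    proof -
      have "linear (?Df (g x))"
        using ck_on_SucD_deriv[OF Suc.prems(1), of "g x"] that assms(3) has_derivative_linear by blast
      note l = this
      have "?Df (g x) (\<Sum>b\<in>Basis. (?Dg x v \<bullet> b) *\<^sub>R b) = (\<Sum>b\<in>Basis. (?Dg x v \<bullet> b) *\<^sub>R ?Df (g x) b)"
        unfolding linear_sum[OF l] linear_cmul[OF l] ..
      then show ?thesis by (simp add: euclidean_representation)
    qed
    ultimately show "ck_on k S (\<lambda>x. ?Df (g x) (?Dg x v))"
      using ck_on_cong[OF assms(1), of "\<lambda>x. \<Sum>b\<in>Basis. (?Dg x v \<bullet> b) *\<^sub>R ?Df (g x) b"
          "\<lambda>x. ?Df (g x) (?Dg x v)" k] by simp
  qed fact
qed

lemma ck_on_componentwise: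
  fixes f :: "'a::real_normed_vector \<Rightarrow> 'b::euclidean_space"
  assumes "open S" "\<And>b. b \<in> Basis \<Longrightarrow> ck_on k S (\<lambda>x. f x \<bullet> b)"
  shows "ck_on k S f"
proof -
  have "ck_on k S (\<lambda>x. \<Sum>b\<in>Basis. (f x \<bullet> b) *\<^sub>R b)"
    by (intro ck_on_sum[OF assms(1)] ck_on_linear_comp[OF assms(1) bounded_linear_scaleR_left] assms(2))
  then show ?thesis by (simp add: euclidean_representation)
qed

lemma ck_on_inverse:
  fixes f :: "'a::real_normed_vector \<Rightarrow> real"
  assumes "open S" "\<And>x. x \<in> S \<Longrightarrow> f x \<noteq> 0" "ck_on k S f"
  shows "ck_on k S (\<lambda>x. inverse (f x))"
  using assms(3)
proof (induction k)
  case 0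
  then show ?case using assms(2) by (simp add: continuous_on_inverse)
next
  case (Suc k)
  show ?case
  proof (rule ck_on_SucI[where f' = "\<lambda>x v. - (inverse (f x) * frechet_derivative f (at x) v * inverse (f x))"])
    fix x assume "x \<in> S"
    then show "((\<lambda>x. inverse (f x)) has_derivative (\<lambda>v. - (inverse (f x) * frechet_derivative f (at x) v * inverse (f x)))) (at x)"
      by (intro Deriv.has_derivative_inverse assms(2) ck_on_SucD_deriv[OF Suc.prems])
  next
    fix v
    have "ck_on k S (\<lambda>x. inverse (f x))" using Suc ck_on_SucD by blast
    then show "ck_on k S (\<lambda>x. - (inverse (f x) * frechet_derivative f (at x) v * inverse (f x)))"
      using Suc.prems
      by (intro ck_on_linear_comp[OF assms(1) bounded_linear_minus[OF bounded_linear_ident]]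
          ck_on_bilinear[OF assms(1) bounded_bilinear_mult]) auto
  qed fact
qed

lemma ck_on_prod:
  fixes f :: "'i \<Rightarrow> 'a::real_normed_vector \<Rightarrow> real"
  assumes "open S" "\<And>i. i \<in> I \<Longrightarrow> ck_on k S (f i)"
  shows "ck_on k S (\<lambda>x. \<Prod>i\<in>I. f i x)"
  using assms(2)
proof (induction I rule: infinite_finite_induct)
  case (insert i I)
  then show ?case by (simp add: ck_on_bilinear[OF assms(1) bounded_bilinear_mult])
qed (auto simp: ck_on_const[OF assms(1)])

lemma smooth_on_cong: "smooth_on S f \<Longrightarrow> open S \<Longrightarrow> (\<And>x. x \<in> S \<Longrightarrow> f x = g x) \<Longrightarrow> smooth_on S g"
  unfolding smooth_on_def using ck_on_cong by blast

lemma smooth_on_subset: "smooth_on S f \<Longrightarrow> T \<subseteq> S \<Longrightarrow> smooth_on T f"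
  unfolding smooth_on_def using ck_on_subset by blast

lemma smooth_on_local:
  "(\<And>x. x \<in> S \<Longrightarrow> \<exists>W. open W \<and> x \<in> W \<and> smooth_on W f) \<Longrightarrow> smooth_on S f"
  unfolding smooth_on_def using ck_on_local by meson

lemma smooth_on_has_derivative:
  "smooth_on S f \<Longrightarrow> x \<in> S \<Longrightarrow> (f has_derivative frechet_derivative f (at x)) (at x)"
  unfolding smooth_on_def using ck_on_SucD_deriv by blast

lemma smooth_on_differentiable: "smooth_on S f \<Longrightarrow> x \<in> S \<Longrightarrow> f differentiable (at x)"
  using smooth_on_has_derivative differentiable_def by blast

lemma smooth_on_continuous_on: "smooth_on S f \<Longrightarrow> continuous_on S f"
  unfolding smooth_on_def by (metis ck_on.simps(1))

lemma smooth_on_frechet: "smooth_on S f \<Longrightarrow> smooth_on S (\<lambda>x. frechet_derivative f (at x) v)"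
  unfolding smooth_on_def by (metis ck_on.simps(2))

lemma smooth_on_const: "open S \<Longrightarrow> smooth_on S (\<lambda>x. c)"
  unfolding smooth_on_def using ck_on_const by blast

lemma smooth_on_bounded_linear: "open S \<Longrightarrow> bounded_linear f \<Longrightarrow> smooth_on S f"
  unfolding smooth_on_def using ck_on_bounded_linear by blast

lemma smooth_on_linear_comp:
  "open S \<Longrightarrow> bounded_linear L \<Longrightarrow> smooth_on S f \<Longrightarrow> smooth_on S (\<lambda>x. L (f x))"
  unfolding smooth_on_def using ck_on_linear_comp by blast

lemma smooth_on_add: "open S \<Longrightarrow> smooth_on S f \<Longrightarrow> smooth_on S g \<Longrightarrow> smooth_on S (\<lambda>x. f x + g x)"
  unfolding smooth_on_def using ck_on_add by blast

lemma smooth_on_sum: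
  "open S \<Longrightarrow> (\<And>i. i \<in> I \<Longrightarrow> smooth_on S (f i)) \<Longrightarrow> smooth_on S (\<lambda>x. \<Sum>i\<in>I. f i x)"
  unfolding smooth_on_def by (intro allI ck_on_sum) auto

lemma smooth_on_bilinear:
  "open S \<Longrightarrow> bounded_bilinear b \<Longrightarrow> smooth_on S f \<Longrightarrow> smooth_on S g \<Longrightarrow> smooth_on S (\<lambda>x. b (f x) (g x))"
  unfolding smooth_on_def using ck_on_bilinear by blast

lemma smooth_on_minus:
  assumes "open S" "smooth_on S f"
  shows "smooth_on S (\<lambda>x. - f x)"
  by (rule smooth_on_linear_comp[OF assms(1) bounded_linear_minus[OF bounded_linear_ident] assms(2)])

lemma smooth_on_diff:
  assumes "open S" "smooth_on S f" "smooth_on S g"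
  shows "smooth_on S (\<lambda>x. f x - g x)"
  using smooth_on_add[OF assms(1,2) smooth_on_minus[OF assms(1,3)]] by simp

lemma smooth_on_compose:
  fixes g :: "'a::real_normed_vector \<Rightarrow> 'b::euclidean_space" and f :: "'b \<Rightarrow> 'c::real_normed_vector"
  shows "open S \<Longrightarrow> open T \<Longrightarrow> g ` S \<subseteq> T \<Longrightarrow> smooth_on T f \<Longrightarrow> smooth_on S g \<Longrightarrow> smooth_on S (\<lambda>x. f (g x))"
  unfolding smooth_on_def using ck_on_compose by blast

lemma smooth_on_componentwise:
  fixes f :: "'a::real_normed_vector \<Rightarrow> 'b::euclidean_space"
  shows "open S \<Longrightarrow> (\<And>b. b \<in> Basis \<Longrightarrow> smooth_on S (\<lambda>x. f x \<bullet> b)) \<Longrightarrow> smooth_on S f"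
  unfolding smooth_on_def using ck_on_componentwise by blast

lemma smooth_on_vec:
  fixes f :: "'a::real_normed_vector \<Rightarrow> 'b::euclidean_space^'n"
  assumes "open S" "\<And>i. smooth_on S (\<lambda>x. f x $ i)"
  shows "smooth_on S f"
  by (rule smooth_on_componentwise[OF assms(1)])
    (auto simp: Basis_vec_def inner_axis intro: smooth_on_linear_comp[OF assms(1) bounded_linear_inner_left assms(2)])

lemma smooth_on_vec_nth:
  "open S \<Longrightarrow> smooth_on S f \<Longrightarrow> smooth_on S (\<lambda>x. f x $ i)"
  by (rule smooth_on_linear_comp[OF _ bounded_linear_vec_nth])

lemma smooth_on_Pair:
  assumes "open S" "smooth_on S f" "smooth_on S g"
  shows "smooth_on S (\<lambda>x. (f x, g x))"
proof -
  have "smooth_on S (\<lambda>x. (f x, 0) + (0, g x))"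
    using assms by (intro smooth_on_add smooth_on_linear_comp[OF _ _ assms(2)] smooth_on_linear_comp[OF _ _ assms(3)])
      (auto intro: bounded_linear_Pair bounded_linear_ident bounded_linear_zero)
  then show ?thesis by simp
qed

lemma bounded_bilinear_matrix_mult:
  "bounded_bilinear (\<lambda>(a::real^'n^'m) (b::real^'p^'n). a ** b)"
proof -
  have "(a + b) ** c = a ** c + b ** c" for a b :: "real^'n^'m" and c :: "real^'p^'n"
    by (simp add: matrix_matrix_mult_def vec_eq_iff sum.distrib ring_distribs)
  then have "bilinear (\<lambda>(a::real^'n^'m) (b::real^'p^'n). a ** b)"
    by (simp add: bilinear_def linear_iff matrix_add_ldistrib matrix_scalar_ac scalar_matrix_assoc)
  then show ?thesis by (simp add: bilinear_conv_bounded_bilinear)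
qed

lemma bounded_bilinear_matrix_vector:
  "bounded_bilinear (\<lambda>(a::real^'n^'m) (b::real^'n). a *v b)"
proof -
  have "bilinear (\<lambda>(a::real^'n^'m) (b::real^'n). a *v b)"
    by (simp add: bilinear_def linear_iff matrix_vector_right_distrib matrix_vector_mult_add_rdistrib
        matrix_vector_mult_scaleR scaleR_matrix_vector_assoc)
  then show ?thesis by (simp add: bilinear_conv_bounded_bilinear)
qed

lemma smooth_on_det:
  fixes M :: "'a::real_normed_vector \<Rightarrow> real^'n^'n"
  assumes "open S" "smooth_on S M"
  shows "smooth_on S (\<lambda>x. det (M x))"
proof -
  have "smooth_on S (\<lambda>x. M x $ i $ j)" for i j
    by (rule smooth_on_vec_nth[OF assms(1) smooth_on_vec_nth[OF assms]])
  then have "smooth_on S (\<lambda>x. \<Prod>i\<in>UNIV. M x $ i $ p i)" for p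
    unfolding smooth_on_def by (intro allI ck_on_prod[OF assms(1)]) auto
  then have "smooth_on S (\<lambda>x. \<Sum>p | p permutes UNIV. of_int (sign p) * (\<Prod>i\<in>UNIV. M x $ i $ p i))"
    by (intro smooth_on_sum[OF assms(1)] smooth_on_linear_comp[OF assms(1) bounded_linear_mult_right])
  then show ?thesis
    unfolding det_def .
qed

lemma matrix_inv_inverse:
  fixes M :: "real^'n^'n"
  assumes "invertible M"
  shows "M ** matrix_inv M = mat 1" "matrix_inv M ** M = mat 1"
proof -
  have "M ** matrix_inv M = mat 1 \<and> matrix_inv M ** M = mat 1"
    unfolding matrix_inv_def by (rule someI_ex) (use assms in \<open>simp add: invertible_def\<close>)
  then show "M ** matrix_inv M = mat 1" "matrix_inv M ** M = mat 1" by auto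
qed

text \<open>By Cramer's rule the entries of the inverse are rational functions of the matrix entries.\<close>

lemma smooth_on_matrix_inv:
  fixes M :: "'a::real_normed_vector \<Rightarrow> real^'n^'n"
  assumes "open S" "smooth_on S M" "\<And>x. x \<in> S \<Longrightarrow> invertible (M x)"
  shows "smooth_on S (\<lambda>x. matrix_inv (M x))"
proof -
  define c where "c x i k = det (\<chi> a b. if b = k then axis i 1 $ a else M x $ a $ b)" for x i k
  have d: "det (M x) \<noteq> 0" if "x \<in> S" for x
    using assms(3)[OF that] by (simp add: invertible_det_nz)
  have inv: "matrix_inv (M x) $ k $ i = inverse (det (M x)) * c x i k" if "x \<in> S" for x i k
  proof -
    have "M x *v (matrix_inv (M x) *v axis i 1) = axis i 1"
      using assms(3)[OF that] by (simp add: matrix_vector_mul_assoc matrix_inv_inverse)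
    then have "matrix_inv (M x) *v axis i 1 = (\<chi> k. c x i k / det (M x))"
      by (simp add: cramer[OF d[OF that]] c_def)
    then show ?thesis
      by (simp add: matrix_vector_mult_basis column_def vec_eq_iff divide_inverse mult.commute)
  qed
  have c_smooth: "smooth_on S (\<lambda>x. c x i k)" for i k
    unfolding c_def
  proof (intro smooth_on_det[OF assms(1)] smooth_on_vec[OF assms(1)])
    show "smooth_on S (\<lambda>x. (\<chi> a b. if b = k then axis i 1 $ a else M x $ a $ b) $ a' $ b')" for a' b'
      using smooth_on_vec_nth[OF assms(1) smooth_on_vec_nth[OF assms(1,2)]] smooth_on_const[OF assms(1)]
      by (cases "b' = k") simp_all
  qed
  have "smooth_on S (\<lambda>x. inverse (det (M x)))"
    using smooth_on_det[OF assms(1,2)] d unfolding smooth_on_def by (intro allI ck_on_inverse[OF assms(1)]) auto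
  then have *: "smooth_on S (\<lambda>x. inverse (det (M x)) * c x i k)" for i k
    by (intro smooth_on_bilinear[OF assms(1) bounded_bilinear_mult] c_smooth)
  have "smooth_on S (\<lambda>x. matrix_inv (M x) $ k $ i)" for i k
    by (rule smooth_on_cong[OF *[of i k] assms(1)]) (simp add: inv)
  then show ?thesis by (intro smooth_on_vec[OF assms(1)])
qed

section \<open>A bump function\<close>

text \<open>The functions \<open>x\<^sup>-\<^sup>n e\<^sup>-\<^sup>1\<^sup>/\<^sup>x\<close>, continued by \<open>0\<close>. Differentiation maps the family into its
  linear span, hence all its members are smooth.\<close>

definition flat_exp :: "nat \<Rightarrow> real \<Rightarrow> real" where
  "flat_exp n x = (if x > 0 then inverse x ^ n * exp (- inverse x) else 0)"

lemma flat_exp_deriv_0: "(flat_exp n has_real_derivative 0) (at 0)"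
proof -
  have "((\<lambda>x::real. x ^ Suc n / exp x) \<longlongrightarrow> 0) at_top"
    by (rule tendsto_power_div_exp_0)
  then have "((\<lambda>h::real. inverse h ^ Suc n / exp (inverse h)) \<longlongrightarrow> 0) (at_right 0)"
    by (rule filterlim_compose[OF _ filterlim_inverse_at_top_right])
  then have "((\<lambda>h. flat_exp n h / h) \<longlongrightarrow> 0) (at_right 0)"
    by (rule Lim_transform_eventually)
      (auto simp: flat_exp_def eventually_at_right_less field_simps exp_minus intro!: eventually_at_rightI[of 0 1])
  moreover have "((\<lambda>h. flat_exp n h / h) \<longlongrightarrow> 0) (at_left 0)"
    by (rule Lim_transform_eventually[OF tendsto_const])
      (auto simp: flat_exp_def intro!: eventually_at_leftI[of "-1" 0])
  ultimately have "((\<lambda>h. flat_exp n h / h) \<longlongrightarrow> 0) (at 0)"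
    by (simp add: filterlim_split_at)
  then show ?thesis by (simp add: DERIV_def flat_exp_def[of n 0])
qed

lemma flat_exp_deriv:
  "(flat_exp n has_real_derivative (flat_exp (n + 2) x - real n * flat_exp (n + 1) x)) (at x)"
proof -
  consider "x > 0" | "x = 0" | "x < 0" by linarith
  then show ?thesis
  proof cases
    case 1
    have "((\<lambda>x. inverse x ^ n * exp (- inverse x)) has_real_derivative
        (flat_exp (n + 2) x - real n * flat_exp (n + 1) x)) (at x)"
    proof -
      have *: "m = 0 \<or> inverse x ^ m = inverse x * inverse x ^ (m - Suc 0)" for m
        by (cases m) auto
      show ?thesis
        using 1 *[of "n - 1"] by (cases n) (auto intro!: derivative_eq_intros simp: flat_exp_def algebra_simps power2_eq_square)
    qed
    then show ?thesis
      by (rule has_field_derivative_transform_within_open[of _ _ _ "{0<..}"]) (use 1 in \<open>auto simp: flat_exp_def\<close>)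
  next
    case 2
    then show ?thesis using flat_exp_deriv_0[of n] by (simp add: flat_exp_def)
  next
    case 3
    have "((\<lambda>x. 0) has_real_derivative (flat_exp (n + 2) x - real n * flat_exp (n + 1) x)) (at x)"
      using 3 by (auto simp: flat_exp_def)
    then show ?thesis
      by (rule has_field_derivative_transform_within_open[of _ _ _ "{..<0}"]) (use 3 in \<open>auto simp: flat_exp_def\<close>)
  qed
qed

lemma smooth_on_flat_exp: "smooth_on UNIV (flat_exp n)"
proof -
  have "ck_on k UNIV (flat_exp n)" for k
  proof (induction k arbitrary: n)
    case 0
    show ?case
      using DERIV_isCont[OF flat_exp_deriv] by (simp add: continuous_at_imp_continuous_on)
  next
    case (Suc k)
    have 1: "ck_on k UNIV (\<lambda>x. - (real n * flat_exp (n + 1) x))"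
      using ck_on_linear_comp[OF open_UNIV bounded_linear_minus[OF bounded_linear_mult_right] Suc.IH] .
    have "ck_on k UNIV (\<lambda>x. (flat_exp (n + 2) x + - (real n * flat_exp (n + 1) x)) * v)" for v
      by (rule ck_on_linear_comp[OF open_UNIV bounded_linear_mult_left ck_on_add[OF open_UNIV Suc.IH 1]])
    then show ?case
      by (intro ck_on_SucI[where f' = "\<lambda>x v. (flat_exp (n + 2) x - real n * flat_exp (n + 1) x) * v"])
        (use flat_exp_deriv[unfolded has_field_derivative_def] in \<open>auto\<close>)
  qed
  then show ?thesis by (simp add: smooth_on_def)
qed

text \<open>The product of two flat functions that vanish on the two sides of the interval, normalised at \<open>0\<close>.
  Sections that are only given near a point of a curve are extended to the whole curve with it.\<close>

lemma smooth_bump: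
  fixes r :: real
  assumes "r > 0"
  obtains \<beta> :: "real \<Rightarrow> real" where "smooth_on UNIV \<beta>" "\<beta> 0 = 1" "\<And>x. \<bar>x\<bar> \<ge> r \<Longrightarrow> \<beta> x = 0"
proof -
  define q where "q x = flat_exp 0 (r - x) * flat_exp 0 (r + x)" for x
  have "smooth_on UNIV (\<lambda>x::real. r - x)" "smooth_on UNIV (\<lambda>x::real. r + x)"
    by (intro smooth_on_diff smooth_on_add smooth_on_const smooth_on_bounded_linear bounded_linear_ident open_UNIV)+
  then have q: "smooth_on UNIV q" unfolding q_def
    by (intro smooth_on_bilinear[OF open_UNIV bounded_bilinear_mult] smooth_on_compose[OF open_UNIV open_UNIV _ smooth_on_flat_exp]) auto
  show ?thesis
  proof
    show "smooth_on UNIV (\<lambda>x. inverse (q 0) * q x)"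
      by (rule smooth_on_linear_comp[OF open_UNIV bounded_linear_mult_right q])
    have "q 0 \<noteq> 0" using assms by (simp add: q_def flat_exp_def)
    then show "inverse (q 0) * q 0 = 1" by simp
    show "inverse (q 0) * q x = 0" if "\<bar>x\<bar> \<ge> r" for x
      using that by (auto simp: q_def flat_exp_def)
  qed
qed

section \<open>Local solutions of differential equations\<close>

text \<open>Picard iteration. The fixed point is taken in the complete space of bounded continuous
  functions on the whole line; for this the upper end of the integral is clamped to \<open>[-\<delta>, \<delta>]\<close>.\<close>

lemma lipschitz_ode_exists:
  fixes F :: "real \<Rightarrow> 'a::euclidean_space \<Rightarrow> 'a"
  assumes "r > 0"
    and cont: "\<And>b. continuous_on {-r..r} b \<Longrightarrow> continuous_on {-r..r} (\<lambda>t. F t (b t))"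
    and lip: "\<And>t x y. t \<in> {-r..r} \<Longrightarrow> norm (F t x - F t y) \<le> C * norm (x - y)"
  obtains \<delta> b where "\<delta> > 0" "\<delta> \<le> r" "b 0 = y0"
    "\<And>t. t \<in> {-\<delta><..<\<delta>} \<Longrightarrow> (b has_vector_derivative F t (b t)) (at t)"
proof -
  define D where "D = \<bar>C\<bar> + 1"
  have D: "D > 0" "C \<le> D" by (auto simp: D_def)
  \<comment> \<open>Two integrals over intervals of length at most \<open>2 \<delta>\<close> enter, so this choice gives the contraction factor \<open>1/2\<close>.\<close>
  define \<delta> where "\<delta> = min r (inverse (8 * D))"
  have \<delta>: "\<delta> > 0" "\<delta> \<le> r" "\<delta> * D \<le> 1 / 8"
  proof -
    have "\<delta> * D \<le> inverse (8 * D) * D" using D by (intro mult_right_mono) (auto simp: \<delta>_def)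
    then show "\<delta> * D \<le> 1 / 8" using D by (simp add: field_simps)
  qed (use assms(1) D in \<open>auto simp: \<delta>_def\<close>)
  have lip: "norm (F t x - F t y) \<le> D * norm (x - y)" if "t \<in> {-\<delta>..\<delta>}" for t x y
    using lip[of t x y] that \<delta> D mult_right_mono[OF D(2), of "norm (x - y)"] by auto
  define p where "p t = max (- \<delta>) (min \<delta> t)" for t
  have p: "p t \<in> {-\<delta>..\<delta>}" for t using \<delta> by (auto simp: p_def)
  have p_cont: "continuous_on UNIV p" unfolding p_def by (intro continuous_intros)
  define I where "I b u = integral {-\<delta>..u} (\<lambda>s. F s (b s))" for b :: "real \<Rightarrow> 'a" and u
  define G where "G b t = y0 + I b (p t) - I b 0" for b t
  have cF: "continuous_on {-\<delta>..\<delta>} (\<lambda>s. F s (apply_bcontfun b s))" for b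
    by (rule continuous_on_subset[OF cont]) (use \<delta> in auto)
  have iF: "(\<lambda>s. F s (apply_bcontfun b s)) integrable_on {-\<delta>..u}" if "u \<in> {-\<delta>..\<delta>}" for b u
    by (rule integrable_continuous_real[OF continuous_on_subset[OF cF]]) (use that in auto)
  have cI: "continuous_on {-\<delta>..\<delta>} (I b)" if "b = apply_bcontfun b'" for b b'
    unfolding I_def that by (intro indefinite_integral_continuous_1 iF) (use \<delta> in auto)
  have Gb: "G b \<in> bcontfun" if "b = apply_bcontfun b'" for b b'
  proof -
    have "compact (I b ` {-\<delta>..\<delta>})"
      by (intro compact_continuous_image cI[OF that]) auto
    then obtain B where B: "\<And>u. u \<in> {-\<delta>..\<delta>} \<Longrightarrow> norm (I b u) \<le> B"
      using compact_imp_bounded bounded_pos by (metis image_eqI)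
    have c: "continuous_on UNIV (\<lambda>t. I b (p t))"
      by (rule continuous_on_compose2[OF cI[OF that] p_cont]) (use p in auto)
    show ?thesis
    proof (rule bcontfun_normI)
      show "continuous_on UNIV (G b)" unfolding G_def by (intro continuous_intros c)
      show "norm (G b t) \<le> norm y0 + B + B" for t
        unfolding G_def using B[OF p[of t]] B[of 0] \<delta>
        by (intro order_trans[OF norm_triangle_ineq4] add_mono order_trans[OF norm_triangle_ineq]) auto
    qed
  qed
  define T where "T b = Bcontfun (G (apply_bcontfun b))" for b
  have T: "apply_bcontfun (T b) = G (apply_bcontfun b)" for b
    unfolding T_def using Gb[OF refl] by (rule Bcontfun_inverse)
  have Idiff: "norm (I (apply_bcontfun b) u - I (apply_bcontfun b') u) \<le> 1 / 4 * dist b b'" if "u \<in> {-\<delta>..\<delta>}" for b b' u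
  proof -
    have "norm (integral {-\<delta>..u} (\<lambda>s. F s (apply_bcontfun b s) - F s (apply_bcontfun b' s)))
        \<le> (D * dist b b') * (u - (-\<delta>))"
    proof (rule integral_bound)
      show "continuous_on {-\<delta>..u} (\<lambda>s. F s (apply_bcontfun b s) - F s (apply_bcontfun b' s))"
        by (rule continuous_on_subset[OF continuous_on_diff[OF cF cF]]) (use that in auto)
      fix s assume "s \<in> {-\<delta>..u}"
      then have "norm (F s (apply_bcontfun b s) - F s (apply_bcontfun b' s)) \<le> D * dist (apply_bcontfun b s) (apply_bcontfun b' s)"
        using lip[of s] that by (simp add: dist_norm)
      also have "\<dots> \<le> D * dist b b'"
        using D dist_bounded[of b s b'] by (intro mult_left_mono) auto
      finally show "norm (F s (apply_bcontfun b s) - F s (apply_bcontfun b' s)) \<le> D * dist b b'" .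
    qed (use that in auto)
    also have "\<dots> \<le> (D * dist b b') * (2 * \<delta>)"
      using that D by (intro mult_left_mono) auto
    also have "\<dots> = 2 * (\<delta> * D) * dist b b'" by simp
    also have "\<dots> \<le> 1 / 4 * dist b b'" using \<delta> by (intro mult_right_mono) auto
    finally show ?thesis unfolding I_def using iF[OF that] by (simp add: integral_diff)
  qed
  have "dist (T b) (T b') \<le> 1 / 2 * dist b b'" for b b'
  proof (rule dist_bound)
    fix t
    have "dist (apply_bcontfun (T b) t) (apply_bcontfun (T b') t)
        = norm ((I (apply_bcontfun b) (p t) - I (apply_bcontfun b') (p t)) - (I (apply_bcontfun b) 0 - I (apply_bcontfun b') 0))"
      by (simp add: T G_def dist_norm algebra_simps)
    also have "\<dots> \<le> 1 / 4 * dist b b' + 1 / 4 * dist b b'"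
      using Idiff[OF p[of t], of b b'] Idiff[of 0 b b'] \<delta>
      by (intro order_trans[OF norm_triangle_ineq4 add_mono]) auto
    finally show "dist (apply_bcontfun (T b) t) (apply_bcontfun (T b') t) \<le> 1 / 2 * dist b b'" by simp
  qed
  then obtain b where "T b = b"
    using banach_fix_type[of "1/2" T] by auto
  then have b: "apply_bcontfun b t = G (apply_bcontfun b) t" for t using T[of b] by simp
  show ?thesis
  proof (rule that[of \<delta> "apply_bcontfun b"])
    show "apply_bcontfun b 0 = y0" unfolding b[of 0] using \<delta> by (simp add: G_def p_def)
    fix t assume t: "t \<in> {-\<delta><..<\<delta>}"
    have "(I (apply_bcontfun b) has_vector_derivative F t (apply_bcontfun b t)) (at t within {-\<delta>..\<delta>})"
      unfolding I_def by (rule integral_has_vector_derivative[OF cF]) (use t in auto)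
    then have "(I (apply_bcontfun b) has_vector_derivative F t (apply_bcontfun b t)) (at t)"
      using t by (simp add: at_within_Icc_at)
    then have "((\<lambda>u. (y0 - I (apply_bcontfun b) 0) + I (apply_bcontfun b) u) has_vector_derivative F t (apply_bcontfun b t)) (at t)"
      by (auto intro: derivative_eq_intros)
    then show "(apply_bcontfun b has_vector_derivative F t (apply_bcontfun b t)) (at t)"
      by (rule has_vector_derivative_transform_within_open[of _ _ _ "{-\<delta><..<\<delta>}"])
        (use t in \<open>auto simp: b G_def p_def min_def max_def\<close>)
  qed (use \<delta> in auto)
qed

section \<open>Complex structures in fixed position to a given one\<close>

text \<open>\<open>M0\<close> is bounded below on the orthogonal complement \<open>W\<close> of its kernel. So matrices close to \<open>M0\<close> are
  injective on \<open>W\<close>, and their kernels, meeting \<open>W\<close> only in \<open>0\<close>, have at most the complementary dimension.\<close>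

lemma dim_ker_le_eventually:
  fixes M :: "'t \<Rightarrow> real^'n^'n"
  assumes "(M \<longlongrightarrow> M0) F"
  shows "\<forall>\<^sub>F t in F. dim {w. M t *v w = 0} \<le> dim {w. M0 *v w = 0}"
proof -
  let ?ker = "\<lambda>M::real^'n^'n. {w. M *v w = 0}"
  define W where "W = {y. \<forall>x\<in>?ker M0. orthogonal x y}"
  have sk: "subspace (?ker M)" for M by (simp add: linear_subspace_kernel)
  have sW: "subspace W"
    unfolding W_def using subspace_orthogonal_to_vectors[of "?ker M0"] by (simp add: orthogonal_commute)
  have dimW: "dim W + dim (?ker M0) = CARD('n)"
    using dim_subspace_orthogonal_to_vectors[OF sk subspace_UNIV subset_UNIV, of M0]
    by (simp add: W_def)
  have "\<forall>x\<in>W. M0 *v x = 0 \<longrightarrow> x = 0"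
    by (auto simp: W_def orthogonal_def)
  then obtain e where e: "e > 0" "\<And>y. y \<in> W \<Longrightarrow> e * norm y \<le> norm (M0 *v y)"
    using injective_imp_isometric[of W "(*v) M0"] sW closed_subspace[OF sW] by auto
  obtain C where C: "C > 0" "\<And>(a::real^'n^'n) (y::real^'n). norm (a *v y) \<le> norm a * norm y * C"
  proof -
    have "\<exists>C>0. \<forall>(a::real^'n^'n) (y::real^'n). norm (a *v y) \<le> norm a * norm y * C"
      by (rule bounded_bilinear.pos_bounded[OF bounded_bilinear_matrix_vector])
    then show ?thesis using that by blast
  qed
  have "\<forall>\<^sub>F t in F. dist (M t) M0 < e / C"
    using assms e C by (intro tendstoD) auto
  then show ?thesis
  proof eventually_elim
    case (elim t)
    have "y = 0" if "y \<in> W" "M t *v y = 0" for y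
    proof (rule ccontr)
      assume "y \<noteq> 0"
      have "e * norm y \<le> norm ((M0 - M t) *v y)"
        using e(2)[OF that(1)] that(2) by (simp add: matrix_vector_mult_diff_rdistrib)
      also have "\<dots> \<le> norm (M0 - M t) * norm y * C" by (rule C(2))
      also have "\<dots> < (e / C) * norm y * C"
        using elim C(1) \<open>y \<noteq> 0\<close> by (intro mult_strict_right_mono) (auto simp: dist_norm norm_minus_commute)
      finally show False using C(1) by simp
    qed
    then have "W \<inter> ?ker (M t) = {0}" using subspace_0[OF sW] by auto
    then have "dim {x + y |x y. x \<in> W \<and> y \<in> ?ker (M t)} = dim W + dim (?ker (M t))"
      using dim_sums_Int[OF sW sk, of "M t"] by simp
    then have "dim W + dim (?ker (M t)) \<le> CARD('n)"
      using dim_subset_UNIV[of "{x + y |x y. x \<in> W \<and> y \<in> ?ker (M t)}"] by simp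
    with dimW show ?case by simp
  qed
qed

text \<open>For \<open>t > 0\<close> the matrix \<open>N t = M t (1 + u u\<^sup>T / t)\<close> has as large a kernel as \<open>M t\<close>, because the
  second factor is invertible. As \<open>M 0 u = 0\<close>, it converges to \<open>M 0 + M' u u\<^sup>T\<close>. If \<open>M' u\<close> were not
  in the range of \<open>M 0\<close>, the kernel of this limit would be the part of \<open>Ker (M 0)\<close> orthogonal to \<open>u\<close>,
  which is smaller than \<open>Ker (M 0)\<close>; but kernels cannot become larger away from the limit.\<close>

lemma deriv_maps_ker_into_range:
  fixes M :: "real \<Rightarrow> real^'n^'n"
  assumes deriv: "(M has_vector_derivative M') (at 0)"
    and const: "\<forall>\<^sub>F t in at 0. dim {w. M t *v w = 0} = dim {w. M 0 *v w = 0}"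
    and u: "M 0 *v u = 0"
  shows "\<exists>y. M' *v u = M 0 *v y"
proof (rule ccontr)
  assume not: "\<not> ?thesis"
  let ?ker = "\<lambda>M::real^'n^'n. {w. M *v w = 0}"
  have sk: "subspace (?ker M)" for M by (simp add: linear_subspace_kernel)
  have u0: "u \<noteq> 0" using not by (metis matrix_vector_mult_0_right)
  \<comment> \<open>\<open>R = u u\<^sup>T\<close>\<close>
  define R where "R = (\<chi> i j. u $ i * u $ j)"
  have R: "R *v y = (u \<bullet> y) *\<^sub>R u" for y
    by (simp add: R_def matrix_vector_mult_def inner_vec_def vec_eq_iff sum_distrib_left mult_ac)
  have M0R: "M 0 ** R = 0"
    by (simp add: matrix_eq matrix_vector_mul_assoc[symmetric] R u matrix_vector_mult_scaleR)
  define N where "N t = M t + (inverse t *\<^sub>R (M t - M 0)) ** R" for t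
  have M0: "(M \<longlongrightarrow> M 0) (at 0)"
    using has_vector_derivative_continuous[OF deriv] by (simp add: continuous_within)
  have "((\<lambda>t. inverse t *\<^sub>R (M t - M 0)) \<longlongrightarrow> M') (at 0)"
  proof -
    have "((\<lambda>y. norm ((M y - M 0) - (y - 0) *\<^sub>R M') / norm (y - 0)) \<longlongrightarrow> 0) (at 0)"
      using deriv unfolding has_vector_derivative_def has_derivative_iff_norm by blast
    then have "((\<lambda>t. norm (inverse t *\<^sub>R (M t - M 0) - M')) \<longlongrightarrow> 0) (at 0)"
    proof (rule Lim_transform_eventually)
      have "norm ((M t - M 0) - (t - 0) *\<^sub>R M') / norm (t - 0) = norm (inverse t *\<^sub>R (M t - M 0) - M')" if "t \<noteq> 0" for t
      proof -
        have "inverse t *\<^sub>R (M t - M 0) - M' = inverse t *\<^sub>R ((M t - M 0) - t *\<^sub>R M')"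
          using that by (simp add: scaleR_diff_right)
        then show ?thesis by (simp add: divide_inverse mult.commute)
      qed
      then show "\<forall>\<^sub>F t in at 0. norm ((M t - M 0) - (t - 0) *\<^sub>R M') / norm (t - 0) = norm (inverse t *\<^sub>R (M t - M 0) - M')"
        by (auto simp: eventually_at_filter)
    qed
    then show ?thesis by (rule Lim_null[THEN iffD2, OF tendsto_norm_zero_cancel])
  qed
  then have N: "(N \<longlongrightarrow> M 0 + M' ** R) (at 0)"
    unfolding N_def by (intro tendsto_add M0 bounded_bilinear.tendsto[OF bounded_bilinear_matrix_mult] tendsto_const)
  have "M 0 *v y = 0 \<and> u \<bullet> y = 0" if "(M 0 + M' ** R) *v y = 0" for y
  proof -
    have *: "M 0 *v y + (u \<bullet> y) *\<^sub>R (M' *v u) = 0"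
      using that by (simp add: matrix_vector_mult_add_rdistrib matrix_vector_mul_assoc[symmetric] R matrix_vector_mult_scaleR)
    have "u \<bullet> y = 0"
    proof (rule ccontr)
      assume c: "u \<bullet> y \<noteq> 0"
      have "M' *v u = M 0 *v (- inverse (u \<bullet> y) *\<^sub>R y)"
        using arg_cong[OF *, of "\<lambda>z. inverse (u \<bullet> y) *\<^sub>R z"] c
        by (simp only: matrix_vector_mult_scaleR) (simp add: algebra_simps eq_neg_iff_add_eq_0)
      with not show False by blast
    qed
    with * show ?thesis by simp
  qed
  then have "?ker (M 0 + M' ** R) \<subset> ?ker (M 0)"
    using u u0 by (auto simp: psubset_eq set_eq_iff) (metis inner_eq_zero_iff)
  then have less: "dim (?ker (M 0 + M' ** R)) < dim (?ker (M 0))"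
    by (intro dim_psubset) (simp add: span_eq_iff[THEN iffD2, OF sk])
  have "\<forall>\<^sub>F t in at_right 0. dim (?ker (N t)) \<le> dim (?ker (M 0 + M' ** R))"
    using dim_ker_le_eventually[OF N] by (simp add: eventually_at_split)
  moreover have "\<forall>\<^sub>F t in at_right 0. dim (?ker (M t)) = dim (?ker (M 0))"
    using const by (simp add: eventually_at_split)
  moreover have "\<forall>\<^sub>F t in at_right (0::real). t > 0" by (simp add: eventually_at_right_less)
  ultimately have "\<forall>\<^sub>F t in at_right (0::real). False"
  proof eventually_elim
    case (elim t)
    define A where "A y = y + (inverse t * (u \<bullet> y)) *\<^sub>R u" for y
    have linA: "linear A"
      by (intro linearI) (auto simp: A_def inner_add_right algebra_simps)
    have N_A: "N t *v y = M t *v (A y)" for y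
    proof -
      have "N t = M t + inverse t *\<^sub>R (M t ** R)"
        using M0R by (simp add: N_def scalar_matrix_assoc[symmetric] bounded_bilinear.diff_left[OF bounded_bilinear_matrix_mult])
      then show ?thesis
        by (simp add: A_def matrix_vector_mult_add_rdistrib scaleR_matrix_vector_assoc[symmetric]
            matrix_vector_mul_assoc[symmetric] R matrix_vector_right_distrib matrix_vector_mult_scaleR)
    qed
    have "?ker (M t) \<subseteq> A ` ?ker (N t)"
    proof
      fix z assume z: "z \<in> ?ker (M t)"
      \<comment> \<open>By the formula of Sherman and Morrison, \<open>1 - u u\<^sup>T / s\<close> inverts \<open>A\<close>.\<close>
      define s where "s = t + u \<bullet> u"
      have s: "s > 0" using elim by (simp add: s_def add_pos_nonneg)
      define y where "y = z - ((u \<bullet> z) / s) *\<^sub>R u"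
      have "inverse t * (u \<bullet> y) = (u \<bullet> z) / s"
        using elim s by (simp add: y_def inner_diff_right s_def field_simps)
      then have "A y = z" by (simp add: A_def y_def)
      moreover have "N t *v y = 0" using z by (simp add: N_A \<open>A y = z\<close>)
      ultimately show "z \<in> A ` ?ker (N t)" by auto
    qed
    then have "dim (?ker (M t)) \<le> dim (A ` ?ker (N t))" by (rule dim_subset)
    also have "\<dots> \<le> dim (?ker (N t))" by (rule dim_image_le[OF linA])
    finally show ?case using elim less by linarith
  qed
  then show False by simp
qed

text \<open>The fibre of a stratum in matrices: \<open>j\<close> and \<open>b\<close> stand for \<open>J\<close> and \<open>K\<close>, and \<open>pl\<close> and \<open>mi\<close> say whether the dimension of
  \<open>Ker (J + K)\<close> and of \<open>Ker (J - K)\<close> is prescribed. With these flags the three kinds of strata are treated at once.\<close>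

definition stratum :: "real^'n^'n \<Rightarrow> bool \<Rightarrow> bool \<Rightarrow> nat \<Rightarrow> nat \<Rightarrow> (real^'n^'n) set" where
  "stratum j pl mi d1 d2 = {b. b ** b = - mat 1 \<and>
     (pl \<longrightarrow> dim {w. (j + b) *v w = 0} = d1) \<and> (mi \<longrightarrow> dim {w. (j - b) *v w = 0} = d2)}"

text \<open>The velocities at \<open>t = 0\<close> of the curves \<open>b(t) = (1 + t Z) b (1 + t Z)\<^sup>-\<^sup>1\<close>. The conditions on \<open>Z\<close> say that \<open>1 + t Z\<close> maps
  \<open>Ker (j + b)\<close> into \<open>Ker (j + b(t))\<close> and \<open>Ker (j - b)\<close> into \<open>Ker (j - b(t))\<close>.\<close>

definition stratum_tangent :: "real^'n^'n \<Rightarrow> real^'n^'n \<Rightarrow> bool \<Rightarrow> bool \<Rightarrow> (real^'n^'n) set" where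
  "stratum_tangent j b pl mi = {Z ** b - b ** Z |Z.
     (pl \<longrightarrow> (\<forall>u. (j + b) *v u = 0 \<longrightarrow> (j ** Z + Z ** b) *v u = 0)) \<and>
     (mi \<longrightarrow> (\<forall>u. (j - b) *v u = 0 \<longrightarrow> (j ** Z - Z ** b) *v u = 0))}"

text \<open>Identities between products of matrices are checked on vectors, where a relation such as
  \<open>b\<^sup>2 = - 1\<close> becomes the rewrite rule \<open>b *v (b *v u) = - u\<close>.\<close>

lemmas mat_to_vec = matrix_vector_mul_assoc[symmetric] matrix_vector_right_distrib
  matrix_vector_mult_diff_distrib matrix_vector_mult_add_rdistrib matrix_vector_mult_diff_rdistrib
  matrix_vector_mult_scaleR scaleR_matrix_vector_assoc[symmetric]

lemma matrix_vector_neg: "- (A::real^'n^'m) *v x = - (A *v x)" "(A::real^'n^'m) *v (- x) = - (A *v x)"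
  using matrix_vector_mult_diff_rdistrib[of 0 A x] matrix_vector_mult_diff_distrib[of A 0 x] by simp_all

lemma subspace_stratum_tangent: "subspace (stratum_tangent j b pl mi)"
proof (rule subspaceI)
  show "0 \<in> stratum_tangent j b pl mi"
    by (auto simp: stratum_tangent_def intro!: exI[of _ 0])
next
  fix x y assume "x \<in> stratum_tangent j b pl mi" "y \<in> stratum_tangent j b pl mi"
  then obtain Z Y where Z: "x = Z ** b - b ** Z" "y = Y ** b - b ** Y"
    "pl \<Longrightarrow> \<forall>u. (j + b) *v u = 0 \<longrightarrow> (j ** Z + Z ** b) *v u = 0 \<and> (j ** Y + Y ** b) *v u = 0"
    "mi \<Longrightarrow> \<forall>u. (j - b) *v u = 0 \<longrightarrow> (j ** Z - Z ** b) *v u = 0 \<and> (j ** Y - Y ** b) *v u = 0"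
    by (auto simp: stratum_tangent_def)
  have "x + y = (Z + Y) ** b - b ** (Z + Y)" by (simp add: Z matrix_eq mat_to_vec)
  moreover have "(j ** (Z + Y) + (Z + Y) ** b) *v u = (j ** Z + Z ** b) *v u + (j ** Y + Y ** b) *v u"
    "(j ** (Z + Y) - (Z + Y) ** b) *v u = (j ** Z - Z ** b) *v u + (j ** Y - Y ** b) *v u" for u
    by (simp_all add: mat_to_vec)
  ultimately show "x + y \<in> stratum_tangent j b pl mi"
    using Z(3,4) unfolding stratum_tangent_def by (auto intro!: exI[of _ "Z + Y"])
next
  fix c x assume "x \<in> stratum_tangent j b pl mi"
  then obtain Z where Z: "x = Z ** b - b ** Z"
    "pl \<Longrightarrow> \<forall>u. (j + b) *v u = 0 \<longrightarrow> (j ** Z + Z ** b) *v u = 0"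
    "mi \<Longrightarrow> \<forall>u. (j - b) *v u = 0 \<longrightarrow> (j ** Z - Z ** b) *v u = 0"
    by (auto simp: stratum_tangent_def)
  have "c *\<^sub>R x = (c *\<^sub>R Z) ** b - b ** (c *\<^sub>R Z)" by (simp add: Z matrix_eq mat_to_vec scaleR_diff_right)
  moreover have "(j ** (c *\<^sub>R Z) + (c *\<^sub>R Z) ** b) *v u = c *\<^sub>R ((j ** Z + Z ** b) *v u)"
    "(j ** (c *\<^sub>R Z) - (c *\<^sub>R Z) ** b) *v u = c *\<^sub>R ((j ** Z - Z ** b) *v u)" for u
    by (simp_all add: mat_to_vec scaleR_add_right scaleR_diff_right)
  ultimately show "c *\<^sub>R x \<in> stratum_tangent j b pl mi"
    using Z(2,3) unfolding stratum_tangent_def by (auto intro!: exI[of _ "c *\<^sub>R Z"])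
qed

lemma linear_solution_on_kernel:
  fixes P X :: "real^'n^'n"
  assumes "\<And>u. P *v u = 0 \<Longrightarrow> \<exists>y. X *v u = P *v y"
  obtains F where "\<And>u. P *v u = 0 \<Longrightarrow> P *v (F *v u) = X *v u"
proof -
  let ?K = "{u. P *v u = 0}"
  obtain B where B: "B \<subseteq> ?K" "independent B" "?K \<subseteq> span B" "card B = dim ?K"
    by (rule basis_exists)
  define y where "y u = (SOME y. X *v u = P *v y)" for u
  have y: "X *v u = P *v y u" if "P *v u = 0" for u
    unfolding y_def using someI_ex[OF assms[OF that]] .
  obtain g where g: "linear g" "\<And>x. x \<in> B \<Longrightarrow> g x = y x"
    using linear_independent_extend[OF B(2), of y] by blast
  have "P *v g u = X *v u" if "u \<in> span B" for u
  proof (rule linear_eq_on[OF _ _ that])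
    show "linear (\<lambda>u. P *v g u)" using linear_compose[OF g(1) matrix_vector_mul_linear, of P] by (simp add: o_def)
    show "linear ((*v) X)" by simp
    show "P *v g x = X *v x" if "x \<in> B" for x using that g(2) y B(1) by auto
  qed
  then show ?thesis
    using that[of "matrix g"] B(3) g(1) by (auto simp: matrix_works subset_iff)
qed

text \<open>On \<open>Ker (j + b)\<close>, which is invariant under \<open>b\<close>, the hypothesis on \<open>Y\<close> expresses \<open>j Y\<close> by \<open>b Y\<close> and \<open>X\<close>.
  After this substitution all terms cancel. The other kernel is the case of \<open>- b\<close> and \<open>- X\<close>.\<close>

lemma intertwines_on_kernel:
  fixes b j X Y Z :: "real^'n^'n"
  assumes b: "\<And>u. b *v (b *v u) = - u" and j: "\<And>u. j *v (j *v u) = - u"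
    and Xb: "\<And>u. X *v (b *v u) = - (b *v (X *v u))"
    and Y: "\<And>u. (j + b) *v u = 0 \<Longrightarrow> (j + b) *v (Y *v u) = - (X *v u)"
    and Z: "Z = (1/2) *\<^sub>R (Y - b ** Y ** b - X ** b)" and u: "(j + b) *v u = 0"
  shows "(j ** Z + Z ** b) *v u = 0"
proof -
  have Zu: "2 *\<^sub>R (Z *v u) = Y *v u - b *v (Y *v (b *v u)) + b *v (X *v u)" for u
    by (simp add: Z mat_to_vec Xb matrix_vector_neg)
  have ju: "j *v u = - (b *v u)" using u by (simp add: mat_to_vec eq_neg_iff_add_eq_0)
  have jbu: "j *v (b *v u) = u" using j[of u] by (simp add: ju matrix_vector_neg)
  have bu: "(j + b) *v (b *v u) = 0" by (simp add: mat_to_vec jbu b)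
  have jY: "j *v (Y *v u) = - (X *v u) - b *v (Y *v u)"
    "j *v (Y *v (b *v u)) = b *v (X *v u) - b *v (Y *v (b *v u))"
    using Y[OF u] Y[OF bu] by (simp_all add: mat_to_vec Xb eq_diff_eq)
  have bY: "b *v (Y *v (b *v u)) = b *v (X *v u) - j *v (Y *v (b *v u))" using jY(2) by simp
  have jbY: "j *v (b *v (Y *v (b *v u))) = j *v (b *v (X *v u)) + Y *v (b *v u)"
    unfolding bY by (simp add: matrix_vector_mult_diff_distrib j)
  have "2 *\<^sub>R ((j ** Z + Z ** b) *v u) = j *v (2 *\<^sub>R (Z *v u)) + 2 *\<^sub>R (Z *v (b *v u))"
    by (simp add: mat_to_vec scaleR_add_right)
  also have "\<dots> = 0"
    unfolding Zu by (simp add: mat_to_vec jY(1) jbY b Xb matrix_vector_neg)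
  finally show ?thesis by simp
qed

lemma square_on_kernel:
  fixes b j :: "real^'n^'n"
  assumes b: "\<And>u. b *v (b *v u) = - u" and j: "\<And>u. j *v (j *v u) = - u" and u: "(j + b) *v u = 0"
  shows "(j - b) *v ((j - b) *v u) = - (4 *\<^sub>R u)"
proof -
  have ju: "j *v u = - (b *v u)" using u by (simp add: mat_to_vec eq_neg_iff_add_eq_0)
  have jbu: "j *v (b *v u) = u" using j[of u] by (simp add: ju matrix_vector_neg)
  show ?thesis
    by (simp only: mat_to_vec ju jbu b matrix_vector_neg minus_minus) (simp add: vec_eq_iff)
qed

text \<open>The equation \<open>Z b - b Z = X\<close> has the solution \<open>- X b / 2\<close>, which may be changed by any matrix that
  commutes with \<open>b\<close>. Modulo this equation, the conditions on \<open>Z\<close> become \<open>(j + b) Z = - X\<close> on \<open>Ker (j + b)\<close> and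
  \<open>(j - b) Z = X\<close> on \<open>Ker (j - b)\<close>. By the hypotheses they can be solved on each kernel,
  and, as the kernels are independent, on both together. Taking the part of the solution that commutes with \<open>b\<close> restores the first
  equation and keeps the other two.\<close>

lemma stratum_tangentI:
  fixes b j X :: "real^'n^'n"
  assumes bb: "b ** b = - mat 1" and jj: "j ** j = - mat 1"
    and X: "X ** b + b ** X = 0"
    and pl: "pl \<Longrightarrow> (\<And>u. (j + b) *v u = 0 \<Longrightarrow> \<exists>y. X *v u = (j + b) *v y)"
    and mi: "mi \<Longrightarrow> (\<And>u. (j - b) *v u = 0 \<Longrightarrow> \<exists>y. X *v u = (j - b) *v y)"
  shows "X \<in> stratum_tangent j b pl mi"
proof -
  obtain F where F: "\<And>u. pl \<Longrightarrow> (j + b) *v u = 0 \<Longrightarrow> (j + b) *v (F *v u) = X *v u"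
  proof (cases pl)
    case True
    show thesis
    proof (rule linear_solution_on_kernel[OF pl[OF True]])
      fix F assume "\<And>u. (j + b) *v u = 0 \<Longrightarrow> (j + b) *v (F *v u) = X *v u"
      then show thesis by (rule that)
    qed
  qed (use that in simp)
  obtain G where G: "\<And>u. mi \<Longrightarrow> (j - b) *v u = 0 \<Longrightarrow> (j - b) *v (G *v u) = X *v u"
  proof (cases mi)
    case True
    show thesis
    proof (rule linear_solution_on_kernel[OF mi[OF True]])
      fix G assume "\<And>u. (j - b) *v u = 0 \<Longrightarrow> (j - b) *v (G *v u) = X *v u"
      then show thesis by (rule that)
    qed
  qed (use that in simp)
  have b: "b *v (b *v u) = - u" and j: "j *v (j *v u) = - u" for u
    using bb jj by (simp_all add: matrix_vector_mul_assoc matrix_vector_neg)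
  have Xb: "X *v (b *v u) = - (b *v (X *v u))" for u
    using arg_cong[OF X, of "\<lambda>A. A *v u"] by (simp add: mat_to_vec eq_neg_iff_add_eq_0)
  have nb: "- b *v (- b *v u) = - u" and nXb: "- X *v (- b *v u) = - (- b *v (- X *v u))" for u
    by (simp_all add: b Xb matrix_vector_neg)
  \<comment> \<open>\<open>(j - b)\<^sup>2\<close> is \<open>- 4\<close> on the first kernel and \<open>0\<close> on the second, and the other way round for
    \<open>(j + b)\<^sup>2\<close>, so \<open>Y\<close> is \<open>- F\<close> on the first kernel and \<open>G\<close> on the second.\<close>
  define Y where "Y = (1/4) *\<^sub>R (F ** (j - b) ** (j - b)) - (1/4) *\<^sub>R (G ** (j + b) ** (j + b))"
  \<comment> \<open>The part of \<open>Y\<close> that commutes with \<open>b\<close>, plus the solution \<open>- X b / 2\<close> of \<open>Z b - b Z = X\<close>.\<close>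
  define Z where "Z = (1/2) *\<^sub>R (Y - b ** Y ** b - X ** b)"
  have XZ: "X = Z ** b - b ** Z"
    by (simp add: matrix_eq Z_def mat_to_vec b Xb matrix_vector_neg) (simp add: vec_eq_iff field_simps)
  have "(j ** Z + Z ** b) *v u = 0" if pl "(j + b) *v u = 0" for u
  proof (rule intertwines_on_kernel[OF b j Xb _ Z_def that(2)])
    fix w assume w: "(j + b) *v w = 0"
    have "Y *v w = - (F *v w)"
      using square_on_kernel[OF b j w] w
      by (simp add: Y_def matrix_vector_mult_diff_rdistrib scaleR_matrix_vector_assoc[symmetric]
            matrix_vector_mul_assoc[symmetric] matrix_vector_neg matrix_vector_mult_scaleR)
    then show "(j + b) *v (Y *v w) = - (X *v w)" using F[OF \<open>pl\<close> w] by (simp add: matrix_vector_neg)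
  qed
  moreover have "(j ** Z - Z ** b) *v u = 0" if mi "(j - b) *v u = 0" for u
  proof -
    \<comment> \<open>The same statement for the complex structure \<open>- b\<close> and its tangent vector \<open>- X\<close>.\<close>
    have "(j ** Z + Z ** (- b)) *v u = 0"
    proof (rule intertwines_on_kernel[OF nb j nXb])
      show "Z = (1/2) *\<^sub>R (Y - (- b) ** Y ** (- b) - (- X) ** (- b))"
        by (simp add: Z_def matrix_eq mat_to_vec matrix_vector_neg)
      show "(j + - b) *v u = 0" using that(2) by simp
      fix w assume w: "(j + - b) *v w = 0"
      have "Y *v w = G *v w"
        using square_on_kernel[OF nb j w] w
        by (simp add: Y_def matrix_vector_mult_diff_rdistrib scaleR_matrix_vector_assoc[symmetric]
              matrix_vector_mul_assoc[symmetric] matrix_vector_neg matrix_vector_mult_scaleR)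
      then show "(j + - b) *v (Y *v w) = - (- X *v w)" using G[OF \<open>mi\<close>, of w] w by (simp add: matrix_vector_neg)
    qed
    then show ?thesis by (simp add: mat_to_vec matrix_vector_neg)
  qed
  ultimately show ?thesis unfolding stratum_tangent_def using XZ by blast
qed

text \<open>The constant rank argument applied to \<open>j + b\<close>. On the kernel \<open>j = - b\<close>, so the terms with \<open>w\<close> differ only by
  \<open>(j + b) w u\<close>, which is in the range.\<close>

lemma kernel_derivative_in_range:
  fixes b j :: "real \<Rightarrow> real^'n^'n"
  assumes db: "(b has_vector_derivative b') (at 0)"
    and dj: "(j has_vector_derivative (j 0 ** w - w ** j 0)) (at 0)"
    and const: "\<forall>\<^sub>F t in at 0. dim {w. (j t + b t) *v w = 0} = dim {w. (j 0 + b 0) *v w = 0}"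
    and u: "(j 0 + b 0) *v u = 0"
  shows "\<exists>y. (b' + w ** b 0 - b 0 ** w) *v u = (j 0 + b 0) *v y"
proof -
  have ju: "j 0 *v u = - (b 0 *v u)" using u by (simp add: mat_to_vec eq_neg_iff_add_eq_0)
  have "\<exists>y. (j 0 ** w - w ** j 0 + b') *v u = (j 0 + b 0) *v y"
    by (rule deriv_maps_ker_into_range[of "\<lambda>t. j t + b t"])
      (use const u has_vector_derivative_add[OF dj db] in simp_all)
  then obtain y where y: "(j 0 ** w - w ** j 0 + b') *v u = (j 0 + b 0) *v y" by blast
  have "(b' + w ** b 0 - b 0 ** w) *v u = (j 0 ** w - w ** j 0 + b') *v u - (j 0 + b 0) *v (w *v u)"
    by (simp add: mat_to_vec ju matrix_vector_neg)
  also have "\<dots> = (j 0 + b 0) *v (y - w *v u)" by (simp only: y matrix_vector_mult_diff_distrib)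
  finally show ?thesis by blast
qed

text \<open>To first order \<open>j\<close> moves by \<open>j' = j w - w j\<close>. If it moved by conjugation with a curve of velocity \<open>- w\<close>, undoing
  this conjugation would give a curve in a fixed stratum, with the velocity \<open>b' + w b - b w\<close>.\<close>

lemma stratum_curve_velocity:
  fixes b j :: "real \<Rightarrow> real^'n^'n"
  assumes db: "(b has_vector_derivative b') (at 0)"
    and dj: "(j has_vector_derivative (j 0 ** w - w ** j 0)) (at 0)"
    and jj: "j 0 ** j 0 = - mat 1"
    and str: "b 0 \<in> stratum (j 0) pl mi d1 d2" "\<forall>\<^sub>F t in at 0. b t \<in> stratum (j t) pl mi d1 d2"
  shows "b' + w ** b 0 - b 0 ** w \<in> stratum_tangent (j 0) (b 0) pl mi"
proof (rule stratum_tangentI[OF _ jj])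
  let ?X = "b' + w ** b 0 - b 0 ** w"
  show bb: "b 0 ** b 0 = - mat 1" using str(1) by (simp add: stratum_def)
  then have bbv: "b 0 *v (b 0 *v u) = - u" for u
    by (simp add: matrix_vector_mul_assoc matrix_vector_neg)
  have "((\<lambda>t. b t ** b t) has_vector_derivative (b 0 ** b' + b' ** b 0)) (at 0)"
    by (rule bounded_bilinear.has_vector_derivative[OF bounded_bilinear_matrix_mult db db])
  moreover have "((\<lambda>t. b t ** b t) has_vector_derivative 0) (at 0)"
  proof -
    have "\<forall>\<^sub>F t in at 0. b t ** b t = - mat 1"
      using str(2) by eventually_elim (simp add: stratum_def)
    then have "\<forall>\<^sub>F t in at 0. - mat 1 = b t ** b t" by eventually_elim simp
    moreover have "((\<lambda>t. - mat 1 :: real^'n^'n) has_vector_derivative 0) (at 0)" by simp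
    ultimately show ?thesis
      unfolding has_vector_derivative_def using bb
      by (elim has_derivative_transform_eventually) simp_all
  qed
  ultimately have "b 0 ** b' + b' ** b 0 = 0" using vector_derivative_unique_at by blast
  from arg_cong[OF this, of "\<lambda>A. A *v u" for u] show "?X ** b 0 + b 0 ** ?X = 0"
    by (simp add: matrix_eq mat_to_vec bbv matrix_vector_neg algebra_simps)
next
  fix u assume pl and u: "(j 0 + b 0) *v u = 0"
  have "\<forall>\<^sub>F t in at 0. dim {w. (j t + b t) *v w = 0} = dim {w. (j 0 + b 0) *v w = 0}"
    using str(2) by eventually_elim (use str(1) \<open>pl\<close> in \<open>simp add: stratum_def\<close>)
  then show "\<exists>y. (b' + w ** b 0 - b 0 ** w) *v u = (j 0 + b 0) *v y"
    by (rule kernel_derivative_in_range[OF db dj _ u])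
next
  fix u assume mi and u: "(j 0 - b 0) *v u = 0"
  have "\<forall>\<^sub>F t in at 0. dim {w. (j t + - b t) *v w = 0} = dim {w. (j 0 + - b 0) *v w = 0}"
    using str(2) by eventually_elim (use str(1) \<open>mi\<close> in \<open>simp add: stratum_def\<close>)
  then obtain y where y: "(- b' + w ** (- b 0) - (- b 0) ** w) *v u = (j 0 + - b 0) *v y"
    using kernel_derivative_in_range[OF has_vector_derivative_minus[OF db] dj, of u] u by auto
  have "(b' + w ** b 0 - b 0 ** w) *v u = - ((- b' + w ** (- b 0) - (- b 0) ** w) *v u)"
    by (simp add: mat_to_vec matrix_vector_neg)
  also have "\<dots> = (j 0 - b 0) *v (- y)" unfolding y by (simp add: matrix_vector_neg)
  finally show "\<exists>y. (b' + w ** b 0 - b 0 ** w) *v u = (j 0 - b 0) *v y" by blast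
qed

text \<open>The converse of the previous lemma. The factor \<open>g\<close> of the conjugating matrix \<open>G = g (1 + t Z)\<close> is
  obtained by projecting \<open>1 - t w\<close> onto the solutions of \<open>j g = g j(0)\<close>; that this does not change its
  velocity \<open>- w\<close> is due to \<open>j' = j w - w j\<close>. Then \<open>G\<close> maps \<open>Ker (j(0) \<plusminus> b(0))\<close> into \<open>Ker (j \<plusminus> b)\<close>,
  and the dimensions agree near \<open>0\<close> by semicontinuity.\<close>

lemma stratum_curve_exists:
  fixes j :: "real \<Rightarrow> real^'n^'n"
  assumes r: "r > 0" and sj: "smooth_on {-r<..<r} j"
    and jj: "\<And>t. t \<in> {-r<..<r} \<Longrightarrow> j t ** j t = - mat 1"
    and dj: "(j has_vector_derivative (j 0 ** w - w ** j 0)) (at 0)"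
    and b0: "b0 \<in> stratum (j 0) pl mi d1 d2" and X: "X \<in> stratum_tangent (j 0) b0 pl mi"
  obtains \<delta> b where "\<delta> > 0" "\<delta> \<le> r" "smooth_on {-\<delta><..<\<delta>} b" "b 0 = b0"
    "\<And>t. t \<in> {-\<delta><..<\<delta>} \<Longrightarrow> b t \<in> stratum (j t) pl mi d1 d2"
    "(b has_vector_derivative (X + b0 ** w - w ** b0)) (at 0)"
proof -
  have "\<exists>Z. X = Z ** b0 - b0 ** Z \<and>
      (pl \<longrightarrow> (\<forall>u. (j 0 + b0) *v u = 0 \<longrightarrow> (j 0 ** Z + Z ** b0) *v u = 0)) \<and>
      (mi \<longrightarrow> (\<forall>u. (j 0 - b0) *v u = 0 \<longrightarrow> (j 0 ** Z - Z ** b0) *v u = 0))"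
    using X unfolding stratum_tangent_def by blast
  then obtain Z where Z: "X = Z ** b0 - b0 ** Z"
    "pl \<longrightarrow> (\<forall>u. (j 0 + b0) *v u = 0 \<longrightarrow> (j 0 ** Z + Z ** b0) *v u = 0)"
    "mi \<longrightarrow> (\<forall>u. (j 0 - b0) *v u = 0 \<longrightarrow> (j 0 ** Z - Z ** b0) *v u = 0)" by blast
  have bb: "b0 ** b0 = - mat 1" using b0 by (simp add: stratum_def)
  define h where "h t = mat 1 - t *\<^sub>R w" for t
  define g where "g t = (1/2) *\<^sub>R (h t - j t ** h t ** j 0)" for t
  define G where "G t = g t ** (mat 1 + t *\<^sub>R Z)" for t
  have jv: "j t *v (j t *v u) = - u" if "t \<in> {-r<..<r}" for t u
    using jj[OF that] by (simp add: matrix_vector_mul_assoc matrix_vector_neg)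
  have j0v: "j 0 *v (j 0 *v u) = - u" for u using jv r by simp
  have jg: "j t ** g t = g t ** j 0" if "t \<in> {-r<..<r}" for t
    by (simp add: matrix_eq g_def mat_to_vec jv[OF that] j0v matrix_vector_neg)
  have g0: "g 0 = mat 1" by (simp add: matrix_eq g_def h_def mat_to_vec j0v)
  have op: "open {-r<..<r}" by simp
  have sid: "smooth_on {-r<..<r} (\<lambda>t. t *\<^sub>R c)" for c :: "real^'n^'n"
    by (rule smooth_on_bounded_linear[OF op bounded_linear_scaleR_left])
  note bmm = bounded_bilinear_matrix_mult
  have sh: "smooth_on {-r<..<r} h" unfolding h_def
    by (intro smooth_on_diff smooth_on_const sid op)
  have sg: "smooth_on {-r<..<r} g" unfolding g_def
    by (intro smooth_on_linear_comp[OF op bounded_linear_scaleR_right] smooth_on_diff[OF op sh]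
        smooth_on_bilinear[OF op bmm] sj sh smooth_on_const[OF op])
  have sG: "smooth_on {-r<..<r} G" unfolding G_def
    by (intro smooth_on_bilinear[OF op bmm sg] smooth_on_add smooth_on_const sid op)
  have dh: "(h has_vector_derivative - w) (at 0)"
    unfolding h_def by (auto intro!: derivative_eq_intros)
  have "(g has_vector_derivative (1/2) *\<^sub>R (- w - ((j 0 ** h 0) ** 0 + (j 0 ** - w + (j 0 ** w - w ** j 0) ** h 0) ** j 0))) (at 0)"
    unfolding g_def
    by (intro bounded_linear.has_vector_derivative[OF bounded_linear_scaleR_right] has_vector_derivative_diff dh
        bounded_bilinear.has_vector_derivative[OF bmm] dj has_vector_derivative_const)
  moreover have "(1/2) *\<^sub>R (- w - ((j 0 ** h 0) ** 0 + (j 0 ** - w + (j 0 ** w - w ** j 0) ** h 0) ** j 0)) = - w"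
    by (simp add: matrix_eq h_def mat_to_vec j0v matrix_vector_neg)
  ultimately have dg: "(g has_vector_derivative - w) (at 0)" by simp
  have "(G has_vector_derivative g 0 ** Z + - w ** (mat 1 + 0 *\<^sub>R Z)) (at 0)"
    unfolding G_def by (intro bounded_bilinear.has_vector_derivative[OF bmm] dg) (auto intro!: derivative_eq_intros)
  then have dG: "(G has_vector_derivative Z - w) (at 0)" by (simp add: g0)
  have G0: "G 0 = mat 1" by (simp add: G_def g0)
  define b where "b t = G t ** b0 ** matrix_inv (G t)" for t
  have "continuous_on {-r<..<r} (\<lambda>t. det (G t))"
    by (rule smooth_on_continuous_on[OF smooth_on_det[OF op sG]])
  then have "((\<lambda>t. det (G t)) \<longlongrightarrow> det (G 0)) (at 0)"
    using r by (auto simp: continuous_on_eq_continuous_at isCont_def)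
  then have "\<forall>\<^sub>F t in at 0. det (G t) \<noteq> 0"
    by (rule tendsto_imp_eventually_ne) (simp add: G0)
  then have "\<forall>\<^sub>F t in nhds 0. det (G t) \<noteq> 0"
    by (simp add: eventually_nhds_conv_at G0)
  moreover have "\<forall>\<^sub>F t in nhds 0. t \<in> {-r<..<r}"
    using r by (intro eventually_nhds_in_open) auto
  ultimately have "\<forall>\<^sub>F t in nhds 0. t \<in> {-r<..<r} \<and> invertible (G t)"
    by eventually_elim (simp add: invertible_det_nz)
  then obtain r1 where r1: "r1 > 0" "\<And>t. \<bar>t\<bar> < r1 \<Longrightarrow> t \<in> {-r<..<r} \<and> invertible (G t)"
    unfolding eventually_nhds_metric by (auto simp: dist_real_def)
  have r1r: "{-r1<..<r1} \<subseteq> {-r<..<r}" using r1(2) by (auto simp: abs_less_iff)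
  have sb: "smooth_on {-r1<..<r1} b" unfolding b_def
    by (intro smooth_on_bilinear[OF _ bmm] smooth_on_matrix_inv smooth_on_const smooth_on_subset[OF sG r1r])
      (use r1(2) in \<open>auto simp: abs_less_iff\<close>)
  have bG: "b t ** G t = G t ** b0" if "\<bar>t\<bar> < r1" for t
    using r1(2)[OF that] by (simp add: b_def matrix_mul_assoc[symmetric] matrix_inv_inverse)
  have b00: "b 0 = b0"
    using bG[of 0] r1(1) by (simp add: G0)
  have b_bb: "b t ** b t = - mat 1" if "\<bar>t\<bar> < r1" for t
  proof -
    have "b t ** b t = G t ** (b0 ** (matrix_inv (G t) ** G t) ** b0) ** matrix_inv (G t)"
      by (simp add: b_def matrix_mul_assoc)
    also have "\<dots> = - (G t ** matrix_inv (G t))"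
    proof -
      have "b0 ** (matrix_inv (G t) ** G t) ** b0 = - mat 1"
        using r1(2)[OF that] bb by (simp add: matrix_inv_inverse)
      then show ?thesis by (simp add: matrix_eq mat_to_vec matrix_vector_neg)
    qed
    finally show ?thesis using r1(2)[OF that] by (simp add: matrix_inv_inverse)
  qed
  obtain b' where db: "(b has_vector_derivative b') (at 0)"
    using smooth_on_differentiable[OF sb, of 0] r1(1) by (auto simp: differentiable_iff_scaleR has_vector_derivative_def)
  have "b' = X + b0 ** w - w ** b0"
  proof -
    have 1: "((\<lambda>t. b t ** G t) has_vector_derivative b0 ** (Z - w) + b') (at 0)"
      using bounded_bilinear.has_vector_derivative[OF bmm db dG] by (simp add: b00 G0)
    have 2: "((\<lambda>t. G t ** b0) has_vector_derivative (Z - w) ** b0) (at 0)"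
      using bounded_bilinear.has_vector_derivative[OF bmm dG has_vector_derivative_const[of b0]] by simp
    have "((\<lambda>t. b t ** G t) has_vector_derivative (Z - w) ** b0) (at 0)"
      by (rule has_vector_derivative_transform_within_open[OF 2, of "{-r1<..<r1}"])
        (use r1(1) bG in \<open>auto simp: abs_less_iff\<close>)
    with 1 have "b0 ** (Z - w) + b' = (Z - w) ** b0" using vector_derivative_unique_at by blast
    then have "b' = (Z - w) ** b0 - b0 ** (Z - w)" by (simp add: algebra_simps)
    then show ?thesis by (simp add: Z(1) matrix_eq mat_to_vec)
  qed
  with db have db: "(b has_vector_derivative (X + b0 ** w - w ** b0)) (at 0)" by simp
  have tj: "(j \<longlongrightarrow> j 0) (at 0)"
    using has_vector_derivative_continuous[OF dj] by (simp add: continuous_within)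
  have tb: "(b \<longlongrightarrow> b0) (at 0)"
    using has_vector_derivative_continuous[OF db] by (simp add: continuous_within b00)
  \<comment> \<open>The two kernels are the cases \<open>s = 1\<close> and \<open>s = -1\<close>.\<close>
  have le: "dim {u. (j 0 + s *\<^sub>R b0) *v u = 0} \<le> dim {u. (j t + s *\<^sub>R b t) *v u = 0}"
    if t: "\<bar>t\<bar> < r1" and s: "\<And>u. (j 0 + s *\<^sub>R b0) *v u = 0 \<Longrightarrow> (j 0 ** Z + s *\<^sub>R (Z ** b0)) *v u = 0" for t s
  proof -
    have tr: "t \<in> {-r<..<r}" using r1 t by blast
    have "(j t + s *\<^sub>R b t) *v (G t *v u) = 0" if u: "(j 0 + s *\<^sub>R b0) *v u = 0" for u
    proof -
      have "(j t + s *\<^sub>R b t) *v (G t *v u) = ((j t ** g t) ** (mat 1 + t *\<^sub>R Z) + s *\<^sub>R (b t ** G t)) *v u"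
        by (simp add: G_def mat_to_vec scaleR_add_right scaleR_left_commute)
      also have "\<dots> = (g t ** j 0 ** (mat 1 + t *\<^sub>R Z) + s *\<^sub>R (G t ** b0)) *v u"
        by (simp only: jg[OF tr] bG[OF t])
      also have "\<dots> = g t *v ((j 0 + s *\<^sub>R b0) *v u + t *\<^sub>R ((j 0 ** Z + s *\<^sub>R (Z ** b0)) *v u))"
        by (simp add: G_def mat_to_vec scaleR_add_right mult.commute)
      also have "\<dots> = 0" by (simp add: u s[OF u])
      finally show ?thesis .
    qed
    then have "(*v) (G t) ` {u. (j 0 + s *\<^sub>R b0) *v u = 0} \<subseteq> {u. (j t + s *\<^sub>R b t) *v u = 0}" by auto
    then have "dim ((*v) (G t) ` {u. (j 0 + s *\<^sub>R b0) *v u = 0}) \<le> dim {u. (j t + s *\<^sub>R b t) *v u = 0}"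
      by (rule dim_subset)
    moreover have "dim ((*v) (G t) ` {u. (j 0 + s *\<^sub>R b0) *v u = 0}) = dim {u. (j 0 + s *\<^sub>R b0) *v u = 0}"
      using r1(2)[OF t] by (intro dim_image_eq inj_on_subset[OF inj_matrix_vector_mult]) auto
    ultimately show ?thesis by simp
  qed
  have ge: "\<forall>\<^sub>F t in nhds 0. dim {u. (j t + s *\<^sub>R b t) *v u = 0} \<le> dim {u. (j 0 + s *\<^sub>R b0) *v u = 0}" for s
  proof -
    have "((\<lambda>t. j t + s *\<^sub>R b t) \<longlongrightarrow> j 0 + s *\<^sub>R b0) (at 0)" by (intro tendsto_intros tj tb)
    from dim_ker_le_eventually[OF this] show ?thesis by (simp add: eventually_nhds_conv_at b00)
  qed
  have "\<forall>\<^sub>F t in nhds 0. \<bar>t\<bar> < r1 \<and> b t \<in> stratum (j t) pl mi d1 d2"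
  proof -
    have "\<forall>\<^sub>F t in nhds (0::real). t \<in> {-r1<..<r1}" using r1(1) by (intro eventually_nhds_in_open) auto
    with ge[of 1] ge[of "-1"] show ?thesis
    proof eventually_elim
      case (elim t)
      then have t: "\<bar>t\<bar> < r1" by auto
      have "dim {w. (j t + b t) *v w = 0} = d1" if pl
        using le[OF t, of 1] Z(2) elim(1) b0 that by (simp add: stratum_def)
      moreover have "dim {w. (j t - b t) *v w = 0} = d2" if mi
        using le[OF t, of "-1"] Z(3) elim(2) b0 that by (simp add: stratum_def)
      ultimately show ?case using b_bb[OF t] t by (simp add: stratum_def)
    qed
  qed
  then obtain \<delta> where \<delta>: "\<delta> > 0" "\<And>t. \<bar>t\<bar> < \<delta> \<Longrightarrow> \<bar>t\<bar> < r1 \<and> b t \<in> stratum (j t) pl mi d1 d2"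
    unfolding eventually_nhds_metric by (auto simp: dist_real_def)
  have sub: "{-\<delta><..<\<delta>} \<subseteq> {-r1<..<r1}"
  proof
    fix x assume "x \<in> {-\<delta><..<\<delta>}"
    then have "\<bar>x\<bar> < \<delta>" by auto
    from \<delta>(2)[OF this] show "x \<in> {-r1<..<r1}" by auto
  qed
  show ?thesis
  proof (rule that[OF \<delta>(1) _ smooth_on_subset[OF sb sub] b00 _ db])
    show "\<delta> \<le> r"
    proof (rule ccontr)
      assume "\<not> \<delta> \<le> r"
      then have "r \<in> {-\<delta><..<\<delta>}" using r by auto
      then show False using sub r1r by force
    qed
    show "b t \<in> stratum (j t) pl mi d1 d2" if "t \<in> {-\<delta><..<\<delta>}" for t
      using \<delta>(2)[of t] that by (auto simp: abs_less_iff)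
  qed
qed

section \<open>Functions, curves and tangent vectors on a complex manifold\<close>

locale complex_atlas =
  fixes A :: "('m::{t2_space, second_countable_topology}, complex^'d) chart set"
  assumes complex_manifold: "complex_manifold A"
begin

lemma chart_at: obtains \<kappa> where "\<kappa> \<in> A" "x \<in> fst \<kappa>"
  using complex_manifold unfolding complex_manifold_def by blast

lemma open_chart: "\<kappa> \<in> A \<Longrightarrow> open (fst \<kappa>)"
  and open_chart_image: "\<kappa> \<in> A \<Longrightarrow> open (snd \<kappa> ` fst \<kappa>)"
  and chart_homeo: "\<kappa> \<in> A \<Longrightarrow> homeomorphism (fst \<kappa>) (snd \<kappa> ` fst \<kappa>) (snd \<kappa>) (chart_inv \<kappa>)"
  and smooth_transition: "\<kappa> \<in> A \<Longrightarrow> \<mu> \<in> A \<Longrightarrow> smooth_on (snd \<kappa> ` (fst \<kappa> \<inter> fst \<mu>)) (transition \<kappa> \<mu>)"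
  using complex_manifold unfolding complex_manifold_def by blast+

lemma chart_inv_chart [simp]: "\<kappa> \<in> A \<Longrightarrow> x \<in> fst \<kappa> \<Longrightarrow> chart_inv \<kappa> (snd \<kappa> x) = x"
  using chart_homeo by (metis homeomorphism_apply1)

lemma chart_chart_inv: "\<kappa> \<in> A \<Longrightarrow> z \<in> snd \<kappa> ` fst \<kappa> \<Longrightarrow> snd \<kappa> (chart_inv \<kappa> z) = z"
  using chart_homeo by (metis homeomorphism_apply2)

lemma chart_continuous: "\<kappa> \<in> A \<Longrightarrow> continuous_on (fst \<kappa>) (snd \<kappa>)"
  using chart_homeo homeomorphism_cont1 by blast

lemma chart_inv_continuous: "\<kappa> \<in> A \<Longrightarrow> continuous_on (snd \<kappa> ` fst \<kappa>) (chart_inv \<kappa>)"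
  using chart_homeo homeomorphism_cont2 by blast

lemma open_chart_image_Int:
  assumes "\<kappa> \<in> A" "open O'"
  shows "open (snd \<kappa> ` (fst \<kappa> \<inter> O'))"
proof -
  have "snd \<kappa> ` (fst \<kappa> \<inter> O') = chart_inv \<kappa> -` O' \<inter> snd \<kappa> ` fst \<kappa>"
    using assms(1) by (auto intro!: imageI) 
  then show ?thesis
    using continuous_open_preimage[OF chart_inv_continuous[OF assms(1)] open_chart_image[OF assms(1)] assms(2)]
    by (simp add: Int_commute)
qed

lemma open_chart_vimage:
  assumes "\<kappa> \<in> A" "open W"
  shows "open (fst \<kappa> \<inter> snd \<kappa> -` W)"
  using continuous_open_preimage[OF chart_continuous[OF assms(1)] open_chart[OF assms(1)] assms(2)] .

abbreviation smooth_fun :: "'m set \<Rightarrow> ('m \<Rightarrow> 'b::real_normed_vector) \<Rightarrow> bool" where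
  "smooth_fun S f \<equiv> smooth_map_on A std_atlas S f"

text \<open>Smoothness is defined by a suitable chart at each point; as the chart changes are smooth, any chart will do.\<close>

lemma smooth_funD:
  assumes "open S" "smooth_fun S f" "\<kappa> \<in> A"
  shows "smooth_on (snd \<kappa> ` (fst \<kappa> \<inter> S)) (\<lambda>z. f (chart_inv \<kappa> z))"
proof (rule smooth_on_local)
  fix z assume "z \<in> snd \<kappa> ` (fst \<kappa> \<inter> S)"
  then obtain p where p: "z = snd \<kappa> p" "p \<in> fst \<kappa>" "p \<in> S" by blast
  obtain \<kappa>' W where k: "\<kappa>' \<in> A" "p \<in> fst \<kappa>'" "open W" "snd \<kappa>' p \<in> W" "W \<subseteq> snd \<kappa>' ` fst \<kappa>'"
    "chart_inv \<kappa>' ` W \<subseteq> S" "smooth_on W (f \<circ> chart_inv \<kappa>')"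
    using assms(2) p(3) unfolding smooth_map_on_def std_atlas_def by (fastforce simp: o_def)
  define O' where "O' = fst \<kappa>' \<inter> snd \<kappa>' -` W"
  define N where "N = snd \<kappa> ` (fst \<kappa> \<inter> O')"
  have N: "open N" unfolding N_def O'_def
    by (intro open_chart_image_Int open_chart_vimage assms k)
  have "smooth_on N (\<lambda>z. (f \<circ> chart_inv \<kappa>') (transition \<kappa> \<kappa>' z))"
  proof (rule smooth_on_compose[OF N k(3) _ k(7)])
    show "smooth_on N (transition \<kappa> \<kappa>')"
      by (rule smooth_on_subset[OF smooth_transition[OF assms(3) k(1)]]) (auto simp: N_def O'_def)
    show "transition \<kappa> \<kappa>' ` N \<subseteq> W"
      using assms(3) by (auto simp: N_def O'_def transition_def)
  qed
  then have "smooth_on N (\<lambda>z. f (chart_inv \<kappa> z))"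
    by (rule smooth_on_cong[OF _ N]) (use assms(3) k(1) in \<open>auto simp: N_def O'_def transition_def\<close>)
  moreover have "z \<in> N" using p k by (auto simp: N_def O'_def)
  ultimately show "\<exists>W. open W \<and> z \<in> W \<and> smooth_on W (\<lambda>z. f (chart_inv \<kappa> z))" using N by blast
qed

lemma smooth_funI:
  assumes "open S" "\<And>p. p \<in> S \<Longrightarrow> \<exists>\<kappa>\<in>A. p \<in> fst \<kappa> \<and> smooth_on (snd \<kappa> ` (fst \<kappa> \<inter> S)) (\<lambda>z. f (chart_inv \<kappa> z))"
  shows "smooth_fun S f"
  unfolding smooth_map_on_def
proof
  fix p assume p: "p \<in> S"
  then obtain \<kappa> where k: "\<kappa> \<in> A" "p \<in> fst \<kappa>" "smooth_on (snd \<kappa> ` (fst \<kappa> \<inter> S)) (\<lambda>z. f (chart_inv \<kappa> z))"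
    using assms(2) by blast
  show "\<exists>\<kappa>\<in>A. \<exists>\<mu>\<in>std_atlas. \<exists>W. p \<in> fst \<kappa> \<and> open W \<and> snd \<kappa> p \<in> W \<and> W \<subseteq> snd \<kappa> ` fst \<kappa> \<and>
      chart_inv \<kappa> ` W \<subseteq> S \<and> f ` chart_inv \<kappa> ` W \<subseteq> fst \<mu> \<and> smooth_on W (snd \<mu> \<circ> f \<circ> chart_inv \<kappa>)"
    using k p assms(1)
    by (intro bexI[of _ \<kappa>] bexI[of _ "(UNIV, \<lambda>x. x)"] exI[of _ "snd \<kappa> ` (fst \<kappa> \<inter> S)"])
      (auto simp: std_atlas_def o_def open_chart_image_Int)
qed

lemma smooth_fun_iff:
  assumes "open S"
  shows "smooth_fun S f \<longleftrightarrow> (\<forall>\<kappa>\<in>A. smooth_on (snd \<kappa> ` (fst \<kappa> \<inter> S)) (\<lambda>z. f (chart_inv \<kappa> z)))"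
  using smooth_funD[OF assms] smooth_funI[OF assms] chart_at by metis

lemma smooth_fun_subset: "smooth_fun S f \<Longrightarrow> open S \<Longrightarrow> open T \<Longrightarrow> T \<subseteq> S \<Longrightarrow> smooth_fun T f"
  by (simp add: smooth_fun_iff) (metis Int_mono image_mono order_refl smooth_on_subset)

lemma smooth_fun_cong:
  assumes "smooth_fun S f" "open S" "\<And>x. x \<in> S \<Longrightarrow> f x = g x"
  shows "smooth_fun S g"
  unfolding smooth_fun_iff[OF assms(2)]
proof
  fix \<kappa> assume k: "\<kappa> \<in> A"
  show "smooth_on (snd \<kappa> ` (fst \<kappa> \<inter> S)) (\<lambda>z. g (chart_inv \<kappa> z))"
    by (rule smooth_on_cong[OF smooth_funD[OF assms(2,1) k] open_chart_image_Int[OF k assms(2)]])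
      (use k assms(3) in auto)
qed

lemma smooth_fun_local:
  assumes "open S" "\<And>p. p \<in> S \<Longrightarrow> \<exists>T. open T \<and> p \<in> T \<and> smooth_fun T f"
  shows "smooth_fun S f"
  unfolding smooth_fun_iff[OF assms(1)]
proof (intro ballI smooth_on_local)
  fix \<kappa> z assume k: "\<kappa> \<in> A" and "z \<in> snd \<kappa> ` (fst \<kappa> \<inter> S)"
  then obtain p where p: "z = snd \<kappa> p" "p \<in> fst \<kappa>" "p \<in> S" by blast
  obtain T where T: "open T" "p \<in> T" "smooth_fun T f" using assms(2)[OF p(3)] by blast
  show "\<exists>W. open W \<and> z \<in> W \<and> smooth_on W (\<lambda>z. f (chart_inv \<kappa> z))"
    using smooth_funD[OF T(1,3) k] open_chart_image_Int[OF k T(1)] p T(2) by blast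
qed

lemma smooth_fun_const: "open S \<Longrightarrow> smooth_fun S (\<lambda>x. c)"
  by (simp add: smooth_fun_iff smooth_on_const open_chart_image_Int)

lemma smooth_fun_bilinear:
  assumes "open S" "bounded_bilinear b" "smooth_fun S f" "smooth_fun S g"
  shows "smooth_fun S (\<lambda>x. b (f x) (g x))"
  unfolding smooth_fun_iff[OF assms(1)]
proof
  fix \<kappa> assume k: "\<kappa> \<in> A"
  note D = smooth_funD[OF assms(1) _ k]
  show "smooth_on (snd \<kappa> ` (fst \<kappa> \<inter> S)) (\<lambda>z. b (f (chart_inv \<kappa> z)) (g (chart_inv \<kappa> z)))"
    by (rule smooth_on_bilinear[OF open_chart_image_Int[OF k assms(1)] assms(2) D[OF assms(3)] D[OF assms(4)]])
qed

lemma smooth_fun_linear: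
  assumes "open S" "bounded_linear L" "smooth_fun S f"
  shows "smooth_fun S (\<lambda>x. L (f x))"
  unfolding smooth_fun_iff[OF assms(1)]
proof
  fix \<kappa> assume k: "\<kappa> \<in> A"
  show "smooth_on (snd \<kappa> ` (fst \<kappa> \<inter> S)) (\<lambda>z. L (f (chart_inv \<kappa> z)))"
    by (rule smooth_on_linear_comp[OF open_chart_image_Int[OF k assms(1)] assms(2) smooth_funD[OF assms(1,3) k]])
qed

lemma smooth_fun_Pair:
  assumes "open S" "smooth_fun S f" "smooth_fun S g"
  shows "smooth_fun S (\<lambda>x. (f x, g x))"
  unfolding smooth_fun_iff[OF assms(1)]
proof
  fix \<kappa> assume k: "\<kappa> \<in> A"
  show "smooth_on (snd \<kappa> ` (fst \<kappa> \<inter> S)) (\<lambda>z. (f (chart_inv \<kappa> z), g (chart_inv \<kappa> z)))"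
    by (rule smooth_on_Pair[OF open_chart_image_Int[OF k assms(1)] smooth_funD[OF assms(1,2) k] smooth_funD[OF assms(1,3) k]])
qed

lemma smooth_fun_sum:
  assumes "open S" "\<And>i. i \<in> I \<Longrightarrow> smooth_fun S (f i)"
  shows "smooth_fun S (\<lambda>x. \<Sum>i\<in>I. f i x)"
  unfolding smooth_fun_iff[OF assms(1)]
proof
  fix \<kappa> assume k: "\<kappa> \<in> A"
  show "smooth_on (snd \<kappa> ` (fst \<kappa> \<inter> S)) (\<lambda>z. \<Sum>i\<in>I. f i (chart_inv \<kappa> z))"
    by (rule smooth_on_sum[OF open_chart_image_Int[OF k assms(1)] smooth_funD[OF assms(1) assms(2) k]])
qed

lemma smooth_fun_vec:
  fixes f :: "'m \<Rightarrow> 'b::euclidean_space^'n"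
  assumes "open S" "\<And>i. smooth_fun S (\<lambda>x. f x $ i)"
  shows "smooth_fun S f"
  unfolding smooth_fun_iff[OF assms(1)]
proof
  fix \<kappa> assume k: "\<kappa> \<in> A"
  show "smooth_on (snd \<kappa> ` (fst \<kappa> \<inter> S)) (\<lambda>z. f (chart_inv \<kappa> z))"
    by (rule smooth_on_vec[OF open_chart_image_Int[OF k assms(1)] smooth_funD[OF assms(1) assms(2) k]])
qed

lemma smooth_fun_chart:
  assumes "\<kappa> \<in> A" "open S" "S \<subseteq> fst \<kappa>"
  shows "smooth_fun S (snd \<kappa>)"
  unfolding smooth_fun_iff[OF assms(2)]
proof
  fix \<mu> assume m: "\<mu> \<in> A"
  show "smooth_on (snd \<mu> ` (fst \<mu> \<inter> S)) (\<lambda>z. snd \<kappa> (chart_inv \<mu> z))"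
    using smooth_on_subset[OF smooth_transition[OF m assms(1)], of "snd \<mu> ` (fst \<mu> \<inter> S)"] assms(3)
    by (auto simp: transition_def o_def subset_iff)
qed

text \<open>Smooth maps into a manifold are handled by way of their coordinate functions.\<close>

lemma smooth_map_onE:
  assumes "smooth_map_on A B S f" "p \<in> S"
  obtains \<mu> T where "\<mu> \<in> B" "open T" "p \<in> T" "T \<subseteq> S" "f ` T \<subseteq> fst \<mu>" "smooth_fun T (\<lambda>x. snd \<mu> (f x))"
proof -
  obtain \<kappa> \<mu> W where k: "\<kappa> \<in> A" "\<mu> \<in> B" "p \<in> fst \<kappa>" "open W" "snd \<kappa> p \<in> W" "W \<subseteq> snd \<kappa> ` fst \<kappa>"
    "chart_inv \<kappa> ` W \<subseteq> S" "f ` chart_inv \<kappa> ` W \<subseteq> fst \<mu>" "smooth_on W (snd \<mu> \<circ> f \<circ> chart_inv \<kappa>)"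
    using assms unfolding smooth_map_on_def by metis
  define T where "T = fst \<kappa> \<inter> snd \<kappa> -` W"
  have T: "open T" unfolding T_def by (intro open_chart_vimage k)
  have sub: "T \<subseteq> chart_inv \<kappa> ` W"
  proof
    fix x assume x: "x \<in> T"
    then have "x = chart_inv \<kappa> (snd \<kappa> x)" using k(1) by (auto simp: T_def)
    then show "x \<in> chart_inv \<kappa> ` W" using x by (auto simp: T_def)
  qed
  show ?thesis
  proof (rule that[OF k(2) T])
    show "smooth_fun T (\<lambda>x. snd \<mu> (f x))"
    proof (rule smooth_funI[OF T])
      have "snd \<kappa> ` (fst \<kappa> \<inter> T) \<subseteq> W" by (auto simp: T_def)
      then show "\<exists>\<kappa>\<in>A. p \<in> fst \<kappa> \<and> smooth_on (snd \<kappa> ` (fst \<kappa> \<inter> T)) (\<lambda>z. snd \<mu> (f (chart_inv \<kappa> z)))" if "p \<in> T" for p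
        using k(1) smooth_on_subset[OF k(9)] that by (intro bexI[of _ \<kappa>]) (auto simp: o_def T_def)
    qed
    show "f ` T \<subseteq> fst \<mu>" using sub k(8) by blast
    show "T \<subseteq> S" using sub k(7) by blast
  qed (use k in \<open>simp add: T_def\<close>)
qed

lemma smooth_map_onI:
  assumes "\<And>p. p \<in> S \<Longrightarrow> \<exists>\<mu>\<in>B. \<exists>T. open T \<and> p \<in> T \<and> T \<subseteq> S \<and> f ` T \<subseteq> fst \<mu> \<and> smooth_fun T (\<lambda>x. snd \<mu> (f x))"
  shows "smooth_map_on A B S f"
  unfolding smooth_map_on_def
proof
  fix p assume "p \<in> S"
  then obtain \<mu> T where m: "\<mu> \<in> B" and T: "open T" "p \<in> T" "T \<subseteq> S" "f ` T \<subseteq> fst \<mu>" "smooth_fun T (\<lambda>x. snd \<mu> (f x))"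
    using assms by metis
  obtain \<kappa> where k: "\<kappa> \<in> A" "p \<in> fst \<kappa>" by (rule chart_at)
  show "\<exists>\<kappa>\<in>A. \<exists>\<mu>\<in>B. \<exists>W. p \<in> fst \<kappa> \<and> open W \<and> snd \<kappa> p \<in> W \<and> W \<subseteq> snd \<kappa> ` fst \<kappa> \<and>
      chart_inv \<kappa> ` W \<subseteq> S \<and> f ` chart_inv \<kappa> ` W \<subseteq> fst \<mu> \<and> smooth_on W (snd \<mu> \<circ> f \<circ> chart_inv \<kappa>)"
    using k m T smooth_funD[OF T(1,5) k(1)] open_chart_image_Int[OF k(1) T(1)]
    by (intro bexI[of _ \<kappa>] bexI[of _ \<mu>] exI[of _ "snd \<kappa> ` (fst \<kappa> \<inter> T)"]) (auto simp: o_def)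
qed

end

lemma smooth_curveE:
  assumes "smooth_map_on std_atlas B T c" "t \<in> T"
  obtains \<mu> W where "\<mu> \<in> B" "open W" "t \<in> W" "W \<subseteq> T" "c ` W \<subseteq> fst \<mu>" "smooth_on W (\<lambda>t. snd \<mu> (c t))"
proof -
  have i: "inv_into UNIV (\<lambda>x. x) = (\<lambda>x::'a. x)" using inv_id by (simp add: id_def)
  obtain \<mu> W where "\<mu> \<in> B" "open W" "t \<in> W" "W \<subseteq> T" "c ` W \<subseteq> fst \<mu>" "smooth_on W (snd \<mu> \<circ> c)"
    using assms unfolding smooth_map_on_def std_atlas_def by (fastforce simp: i o_def)
  then show ?thesis using that by (simp add: o_def)
qed

lemma smooth_curveI:
  assumes "\<And>t. t \<in> T \<Longrightarrow> \<exists>\<mu>\<in>B. \<exists>W. open W \<and> t \<in> W \<and> W \<subseteq> T \<and> c ` W \<subseteq> fst \<mu> \<and> smooth_on W (\<lambda>t. snd \<mu> (c t))"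
  shows "smooth_map_on std_atlas B T c"
proof -
  have i: "inv_into UNIV (\<lambda>x. x) = (\<lambda>x::'a. x)" using inv_id by (simp add: id_def)
  show ?thesis
    unfolding smooth_map_on_def
  proof
    fix t assume "t \<in> T"
    from assms[OF this] obtain \<mu> W where "\<mu> \<in> B" "open W" "t \<in> W" "W \<subseteq> T" "c ` W \<subseteq> fst \<mu>" "smooth_on W (\<lambda>t. snd \<mu> (c t))"
      by blast
    then show "\<exists>\<kappa>\<in>std_atlas. \<exists>\<mu>\<in>B. \<exists>W. t \<in> fst \<kappa> \<and> open W \<and> snd \<kappa> t \<in> W \<and> W \<subseteq> snd \<kappa> ` fst \<kappa> \<and>
      chart_inv \<kappa> ` W \<subseteq> T \<and> c ` chart_inv \<kappa> ` W \<subseteq> fst \<mu> \<and> smooth_on W (snd \<mu> \<circ> c \<circ> chart_inv \<kappa>)"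
      by (intro bexI[of _ "(UNIV, \<lambda>x. x)"] bexI[of _ \<mu>] exI[of _ W]) (auto simp: std_atlas_def i o_def)
  qed
qed

lemma smooth_curve_subset:
  assumes "smooth_map_on std_atlas B T c" "open M" "M \<subseteq> T"
  shows "smooth_map_on std_atlas B M c"
proof (rule smooth_curveI)
  fix s assume s: "s \<in> M"
  then have "s \<in> T" using assms(3) by blast
  obtain \<mu> N where N: "\<mu> \<in> B" "open N" "s \<in> N" "N \<subseteq> T" "c ` N \<subseteq> fst \<mu>" "smooth_on N (\<lambda>t. snd \<mu> (c t))"
    by (rule smooth_curveE[OF assms(1) \<open>s \<in> T\<close>])
  have "smooth_on (N \<inter> M) (\<lambda>t. snd \<mu> (c t))" by (rule smooth_on_subset[OF N(6)]) simp
  then show "\<exists>\<mu>\<in>B. \<exists>W. open W \<and> s \<in> W \<and> W \<subseteq> M \<and> c ` W \<subseteq> fst \<mu> \<and> smooth_on W (\<lambda>t. snd \<mu> (c t))"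
    using N s assms(2) by (intro bexI[OF _ N(1)] exI[of _ "N \<inter> M"]) auto
qed

context complex_atlas
begin

lemma smooth_curve_continuous:
  fixes c :: "real \<Rightarrow> 'm"
  assumes "smooth_map_on std_atlas A T c" "t \<in> T"
  shows "isCont c t"
proof -
  obtain \<mu> W where m: "\<mu> \<in> A" "open W" "t \<in> W" "c ` W \<subseteq> fst \<mu>" "smooth_on W (\<lambda>t. snd \<mu> (c t))"
    using smooth_curveE[OF assms] by metis
  have "continuous_on W (\<lambda>t. chart_inv \<mu> (snd \<mu> (c t)))"
    by (rule continuous_on_compose2[OF chart_inv_continuous[OF m(1)] smooth_on_continuous_on[OF m(5)]]) (use m in auto)
  then have "continuous_on W c"
    by (rule continuous_on_cong[THEN iffD1, rotated -1]) (use m in auto)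
  then show ?thesis using m by (simp add: continuous_on_eq_continuous_at)
qed

lemma smooth_curve_eventually:
  fixes c :: "real \<Rightarrow> 'm"
  assumes "smooth_map_on std_atlas A T c" "t \<in> T" "open S" "c t \<in> S"
  obtains W where "open W" "t \<in> W" "W \<subseteq> T" "c ` W \<subseteq> S"
proof -
  obtain \<mu> W where m: "open W" "t \<in> W" "W \<subseteq> T"
    using smooth_curveE[OF assms(1,2)] by metis
  have "continuous_on W c"
    using smooth_curve_continuous[OF assms(1)] m(3) by (auto intro: continuous_at_imp_continuous_on)
  then have "open (W \<inter> c -` S)" using continuous_open_preimage m(1) assms(3) by blast
  then show ?thesis using m assms by (intro that[of "W \<inter> c -` S"]) auto
qed

lemma smooth_fun_curve:
  fixes c :: "real \<Rightarrow> 'm"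
  assumes "smooth_map_on std_atlas A T c" "open T" "open S" "smooth_fun S f" "c ` T \<subseteq> S"
  shows "smooth_on T (\<lambda>t. f (c t))"
proof (rule smooth_on_local)
  fix t assume t: "t \<in> T"
  obtain \<mu> W where m: "\<mu> \<in> A" "open W" "t \<in> W" "W \<subseteq> T" "c ` W \<subseteq> fst \<mu>" "smooth_on W (\<lambda>t. snd \<mu> (c t))"
    using smooth_curveE[OF assms(1) t] by metis
  have "c ` W \<subseteq> fst \<mu> \<inter> S" using m assms(5) by blast
  then have "smooth_on W (\<lambda>t. f (chart_inv \<mu> (snd \<mu> (c t))))"
    by (intro smooth_on_compose[OF m(2) open_chart_image_Int[OF m(1) assms(3)] _ smooth_funD[OF assms(3,4) m(1)] m(6)]) auto
  then have "smooth_on W (\<lambda>t. f (c t))"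
    by (rule smooth_on_cong[OF _ m(2)]) (use m in auto)
  with m show "\<exists>W. open W \<and> t \<in> W \<and> smooth_on W (\<lambda>t. f (c t))" by blast
qed

text \<open>The tangent vector at \<open>x\<close> with coordinates \<open>w\<close> in the chart \<open>\<kappa>\<close>.\<close>

definition lift :: "('m, complex^'d) chart \<Rightarrow> 'm \<Rightarrow> complex^'d \<Rightarrow> ('m, complex^'d) tvec" where
  "lift \<kappa> x w = (\<lambda>\<mu>. if \<mu> \<in> A \<and> x \<in> fst \<mu>
     then frechet_derivative (transition \<kappa> \<mu>) (at (snd \<kappa> x)) w else 0)"

lemma transition_has_derivative:
  assumes "\<kappa> \<in> A" "\<mu> \<in> A" "x \<in> fst \<kappa>" "x \<in> fst \<mu>"
  shows "(transition \<kappa> \<mu> has_derivative frechet_derivative (transition \<kappa> \<mu>) (at (snd \<kappa> x))) (at (snd \<kappa> x))"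
  by (rule smooth_on_has_derivative[OF smooth_transition[OF assms(1,2)]]) (use assms in auto)

lemma smooth_fun_has_derivative:
  assumes "open S" "smooth_fun S f" "\<kappa> \<in> A" "x \<in> fst \<kappa>" "x \<in> S"
  shows "((\<lambda>z. f (chart_inv \<kappa> z)) has_derivative frechet_derivative (\<lambda>z. f (chart_inv \<kappa> z)) (at (snd \<kappa> x))) (at (snd \<kappa> x))"
  by (rule smooth_on_has_derivative[OF smooth_funD[OF assms(1-3)]]) (use assms in auto)

text \<open>The chain rule for \<open>f \<circ> \<kappa>\<^sup>-\<^sup>1 = (f \<circ> \<mu>\<^sup>-\<^sup>1) \<circ> (\<mu> \<circ> \<kappa>\<^sup>-\<^sup>1)\<close>.\<close>

lemma frechet_derivative_change_chart:
  assumes "open S" "smooth_fun S f" "\<kappa> \<in> A" "x \<in> fst \<kappa>" "x \<in> S" "\<mu> \<in> A" "x \<in> fst \<mu>"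
  shows "frechet_derivative (\<lambda>z. f (chart_inv \<kappa> z)) (at (snd \<kappa> x)) w =
    frechet_derivative (\<lambda>z. f (chart_inv \<mu> z)) (at (snd \<mu> x)) (frechet_derivative (transition \<kappa> \<mu>) (at (snd \<kappa> x)) w)"
proof -
  let ?N = "snd \<kappa> ` (fst \<kappa> \<inter> fst \<mu>)"
  have t: "transition \<kappa> \<mu> (snd \<kappa> x) = snd \<mu> x" using assms by (simp add: transition_def)
  have "((\<lambda>z. f (chart_inv \<mu> (transition \<kappa> \<mu> z))) has_derivative
      (\<lambda>w. frechet_derivative (\<lambda>z. f (chart_inv \<mu> z)) (at (snd \<mu> x)) (frechet_derivative (transition \<kappa> \<mu>) (at (snd \<kappa> x)) w))) (at (snd \<kappa> x))"
    using smooth_fun_has_derivative[OF assms(1,2,6,7,5)] transition_has_derivative[OF assms(3,6,4,7)]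
    by (intro has_derivative_compose[of "transition \<kappa> \<mu>" _ "snd \<kappa> x" UNIV "\<lambda>z. f (chart_inv \<mu> z)"]) (simp_all add: t)
  then have "((\<lambda>z. f (chart_inv \<kappa> z)) has_derivative
      (\<lambda>w. frechet_derivative (\<lambda>z. f (chart_inv \<mu> z)) (at (snd \<mu> x)) (frechet_derivative (transition \<kappa> \<mu>) (at (snd \<kappa> x)) w))) (at (snd \<kappa> x))"
    by (rule has_derivative_transform_within_open[of _ _ _ _ ?N])
      (use assms in \<open>auto simp: transition_def open_chart_image_Int open_chart\<close>)
  from frechet_derivative_at[OF this] show ?thesis by metis
qed

lemma transition_change_chart:
  assumes "\<kappa> \<in> A" "\<mu> \<in> A" "\<nu> \<in> A" "x \<in> fst \<kappa>" "x \<in> fst \<mu>" "x \<in> fst \<nu>"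
  shows "frechet_derivative (transition \<kappa> \<nu>) (at (snd \<kappa> x)) w =
    frechet_derivative (transition \<mu> \<nu>) (at (snd \<mu> x)) (frechet_derivative (transition \<kappa> \<mu>) (at (snd \<kappa> x)) w)"
  using frechet_derivative_change_chart[OF open_chart[OF assms(3)] smooth_fun_chart[OF assms(3) open_chart[OF assms(3)] order_refl]
      assms(1,4,6,2,5)] by (simp add: transition_def o_def)

lemma transition_self:
  assumes "\<kappa> \<in> A" "x \<in> fst \<kappa>"
  shows "frechet_derivative (transition \<kappa> \<kappa>) (at (snd \<kappa> x)) w = w"
proof -
  have "(transition \<kappa> \<kappa> has_derivative (\<lambda>w. w)) (at (snd \<kappa> x))"
    by (rule has_derivative_transform_within_open[of "\<lambda>z. z" _ _ _ "snd \<kappa> ` fst \<kappa>"])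
      (use assms in \<open>auto simp: transition_def open_chart_image\<close>)
  from frechet_derivative_at[OF this] show ?thesis by metis
qed

lemma lift_in_tangent_space:
  assumes "\<kappa> \<in> A" "x \<in> fst \<kappa>"
  shows "lift \<kappa> x w \<in> tangent_space A x"
  unfolding tangent_space_def mem_Collect_eq
proof (intro conjI allI ballI impI)
  fix \<mu> \<nu> assume "\<mu> \<in> A" "\<nu> \<in> A" "x \<in> fst \<mu> \<and> x \<in> fst \<nu>"
  then show "lift \<kappa> x w \<nu> = frechet_derivative (transition \<mu> \<nu>) (at (snd \<mu> x)) (lift \<kappa> x w \<mu>)"
    using transition_change_chart[OF assms(1) _ _ assms(2), of \<mu> \<nu> w] by (simp add: lift_def)
qed (auto simp: lift_def)

lemma lift_same_chart: "\<kappa> \<in> A \<Longrightarrow> x \<in> fst \<kappa> \<Longrightarrow> lift \<kappa> x w \<kappa> = w"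
  by (simp add: lift_def transition_self)

lemma lift_add: "\<kappa> \<in> A \<Longrightarrow> x \<in> fst \<kappa> \<Longrightarrow> lift \<kappa> x (v + w) = lift \<kappa> x v + lift \<kappa> x w"
  by (rule ext) (simp add: lift_def linear_add[OF has_derivative_linear[OF transition_has_derivative]])

lemma lift_scaleR: "\<kappa> \<in> A \<Longrightarrow> x \<in> fst \<kappa> \<Longrightarrow> lift \<kappa> x (r *\<^sub>R v) = r *\<^sub>R lift \<kappa> x v"
  by (rule ext) (simp add: lift_def scaleR_fun_def linear_cmul[OF has_derivative_linear[OF transition_has_derivative]])

text \<open>The coordinate vector fields of \<open>\<kappa>\<close> are smooth in every chart. They are the fields along which the
  smoothness of the connection matrix is tested.\<close>

lemma smooth_vector_field_lift:
  assumes "\<kappa> \<in> A" "open S" "S \<subseteq> fst \<kappa>"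
  shows "smooth_vector_field A S (\<lambda>x. lift \<kappa> x w)"
  unfolding smooth_vector_field_def
proof (intro conjI ballI)
  show "lift \<kappa> x w \<in> tangent_space A x" if "x \<in> S" for x
    using lift_in_tangent_space[OF assms(1)] assms(3) that by blast
  fix \<mu> assume m: "\<mu> \<in> A"
  let ?N = "snd \<mu> ` (fst \<mu> \<inter> S)" and ?D = "\<lambda>z. frechet_derivative (transition \<kappa> \<mu>) (at z) w"
  have o: "open (snd \<kappa> ` (fst \<kappa> \<inter> fst \<mu>))" by (intro open_chart_image_Int open_chart assms m)
  have "smooth_on ?N (\<lambda>z. ?D (transition \<mu> \<kappa> z))"
  proof (rule smooth_on_compose[OF open_chart_image_Int[OF m assms(2)] o _ smooth_on_frechet[OF smooth_transition[OF assms(1) m]]])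
    show "transition \<mu> \<kappa> ` ?N \<subseteq> snd \<kappa> ` (fst \<kappa> \<inter> fst \<mu>)"
      using m assms(3) by (auto simp: transition_def)
    show "smooth_on ?N (transition \<mu> \<kappa>)"
      by (rule smooth_on_subset[OF smooth_transition[OF m assms(1)]]) (use assms(3) in auto)
  qed
  then show "smooth_on ?N (\<lambda>z. lift \<kappa> (chart_inv \<mu> z) w \<mu>)"
    by (rule smooth_on_cong[OF _ open_chart_image_Int[OF m assms(2)]])
      (use m in \<open>auto simp: lift_def transition_def\<close>)
qed

text \<open>A curve that is smooth in some chart is differentiable in all charts, and the chain rule relates the
  coordinate velocities. The second part is the chain rule for functions along the curve.\<close>

lemma velocity_eq_lift:
  fixes c :: "real \<Rightarrow> 'm"
  assumes "smooth_map_on std_atlas A T c" "t \<in> T" "\<kappa> \<in> A" "c t \<in> fst \<kappa>"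
  shows "velocity A c t = lift \<kappa> (c t) (velocity A c t \<kappa>)"
    and "open S \<Longrightarrow> smooth_fun S f \<Longrightarrow> c t \<in> S \<Longrightarrow>
      ((\<lambda>t. f (c t)) has_vector_derivative
        frechet_derivative (\<lambda>z. f (chart_inv \<kappa> z)) (at (snd \<kappa> (c t))) (velocity A c t \<kappa>)) (at t)"
proof -
  have vd: "((\<lambda>t. snd \<mu> (c t)) has_vector_derivative velocity A c t \<mu>) (at t)" if "\<mu> \<in> A" "c t \<in> fst \<mu>" for \<mu>
  proof -
    note m = that
    obtain W where W: "open W" "t \<in> W" "W \<subseteq> T" "c ` W \<subseteq> fst \<mu>"
      by (rule smooth_curve_eventually[OF assms(1,2) open_chart[OF m(1)] m(2)])
    have "smooth_map_on std_atlas A W c" by (rule smooth_curve_subset[OF assms(1) W(1,3)])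
    from smooth_fun_curve[OF this W(1) open_chart[OF that(1)] smooth_fun_chart[OF that(1) open_chart[OF that(1)] order_refl] W(4)]
    have "(\<lambda>t. snd \<mu> (c t)) differentiable (at t)" using smooth_on_differentiable W by blast
    then show ?thesis
      using that by (simp add: velocity_def o_def vector_derivative_works)
  qed
  have main: "((\<lambda>t. f (c t)) has_vector_derivative
        frechet_derivative (\<lambda>z. f (chart_inv \<kappa> z)) (at (snd \<kappa> (c t))) (velocity A c t \<kappa>)) (at t)"
    if S: "open S" "smooth_fun S f" "c t \<in> S" for S and f :: "'m \<Rightarrow> 'z::real_normed_vector"
  proof -
    obtain W where W: "open W" "t \<in> W" "W \<subseteq> T" "c ` W \<subseteq> fst \<kappa>"
      by (rule smooth_curve_eventually[OF assms(1,2) open_chart[OF assms(3)] assms(4)])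
    have "((\<lambda>t. f (chart_inv \<kappa> (snd \<kappa> (c t)))) has_derivative
       (\<lambda>r. frechet_derivative (\<lambda>z. f (chart_inv \<kappa> z)) (at (snd \<kappa> (c t))) (r *\<^sub>R velocity A c t \<kappa>))) (at t)"
      using smooth_fun_has_derivative[OF S(1,2) assms(3,4) S(3)] vd[OF assms(3,4)]
      unfolding has_vector_derivative_def
      by (intro has_derivative_compose[of "\<lambda>t. snd \<kappa> (c t)" _ t UNIV "\<lambda>z. f (chart_inv \<kappa> z)"])
    then have "((\<lambda>t. f (c t)) has_derivative
       (\<lambda>r. frechet_derivative (\<lambda>z. f (chart_inv \<kappa> z)) (at (snd \<kappa> (c t))) (r *\<^sub>R velocity A c t \<kappa>))) (at t)"
      by (rule has_derivative_transform_within_open[OF _ W(1,2)]) (use W assms(3) in auto)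
    then show ?thesis
      unfolding has_vector_derivative_def
      using linear_cmul[OF has_derivative_linear[OF smooth_fun_has_derivative[OF S(1,2) assms(3,4) S(3)]]] by simp
  qed
  show "open S \<Longrightarrow> smooth_fun S f \<Longrightarrow> c t \<in> S \<Longrightarrow>
      ((\<lambda>t. f (c t)) has_vector_derivative
        frechet_derivative (\<lambda>z. f (chart_inv \<kappa> z)) (at (snd \<kappa> (c t))) (velocity A c t \<kappa>)) (at t)"
    by (rule main)
  show "velocity A c t = lift \<kappa> (c t) (velocity A c t \<kappa>)"
  proof
    fix \<mu>
    show "velocity A c t \<mu> = lift \<kappa> (c t) (velocity A c t \<kappa>) \<mu>"
    proof (cases "\<mu> \<in> A \<and> c t \<in> fst \<mu>")
      case True
      then have m: "\<mu> \<in> A" "c t \<in> fst \<mu>" by auto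
      from vector_derivative_unique_at[OF vd[OF m] main[OF open_chart[OF m(1)] smooth_fun_chart[OF m(1) open_chart[OF m(1)] order_refl] m(2)]]
      show ?thesis using m by (simp add: lift_def transition_def o_def)
    qed (auto simp: velocity_def lift_def)
  qed
qed

lemma smooth_line:
  assumes "\<kappa> \<in> A" "x \<in> fst \<kappa>"
  obtains r where "r > 0" "\<And>t. \<bar>t\<bar> < r \<Longrightarrow> snd \<kappa> x + t *\<^sub>R v \<in> snd \<kappa> ` fst \<kappa>"
    "smooth_map_on std_atlas A {-r<..<r} (\<lambda>t. chart_inv \<kappa> (snd \<kappa> x + t *\<^sub>R v))"
    "\<And>t. \<bar>t\<bar> < r \<Longrightarrow> velocity A (\<lambda>t. chart_inv \<kappa> (snd \<kappa> x + t *\<^sub>R v)) t \<kappa> = v"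
proof -
  let ?l = "\<lambda>t. snd \<kappa> x + t *\<^sub>R v"
  have "isCont ?l 0" by (intro continuous_intros)
  then have "\<forall>\<^sub>F t in at 0. ?l t \<in> snd \<kappa> ` fst \<kappa>"
    using topological_tendstoD[of ?l "snd \<kappa> x" "at 0" "snd \<kappa> ` fst \<kappa>"] open_chart_image[OF assms(1)] assms(2)
    by (auto simp: isCont_def)
  then have "\<forall>\<^sub>F t in nhds 0. ?l t \<in> snd \<kappa> ` fst \<kappa>"
    using assms(2) by (simp add: eventually_nhds_conv_at)
  then obtain r where r: "r > 0" "\<And>t. \<bar>t\<bar> < r \<Longrightarrow> ?l t \<in> snd \<kappa> ` fst \<kappa>"
    unfolding eventually_nhds_metric by (auto simp: dist_real_def)
  have inv: "snd \<kappa> (chart_inv \<kappa> (?l t)) = ?l t" "chart_inv \<kappa> (?l t) \<in> fst \<kappa>" if "\<bar>t\<bar> < r" for t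
    using r(2)[OF that] assms(1) by (auto simp: chart_chart_inv inv_into_into)
  show ?thesis
  proof (rule that[OF r])
    have "smooth_on {-r<..<r} (\<lambda>t. ?l t)"
      by (intro smooth_on_add smooth_on_const smooth_on_bounded_linear bounded_linear_scaleR_left) auto
    then have "smooth_on {-r<..<r} (\<lambda>t. snd \<kappa> (chart_inv \<kappa> (?l t)))"
      by (rule smooth_on_cong) (auto simp: inv)
    then show "smooth_map_on std_atlas A {-r<..<r} (\<lambda>t. chart_inv \<kappa> (?l t))"
      by (intro smooth_curveI bexI[OF _ assms(1)] exI[of _ "{-r<..<r}"]) (auto simp: inv)
    fix t assume t: "\<bar>t\<bar> < r"
    have "((\<lambda>t. ?l t) has_vector_derivative v) (at t)" by (auto intro!: derivative_eq_intros)
    then have "((\<lambda>t. snd \<kappa> (chart_inv \<kappa> (?l t))) has_vector_derivative v) (at t)"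
      by (rule has_vector_derivative_transform_within_open[of _ _ _ "{-r<..<r}"]) (use t in \<open>auto simp: inv\<close>)
    then show "velocity A (\<lambda>t. chart_inv \<kappa> (?l t)) t \<kappa> = v"
      using inv(2)[OF t] assms(1) by (simp add: velocity_def o_def vector_derivative_at)
  qed
qed

end

section \<open>Trivialisations\<close>

locale complex_bundle = complex_atlas A
  for A :: "('m::{t2_space, second_countable_topology}, complex^'d) chart set" +
  fixes E :: "('m, 'e, 'k::finite) vbundle"
  assumes vector_bundle: "vector_bundle A E"
begin

lemma triv_at: obtains W \<Phi> where "(W, \<Phi>) \<in> trivs E" "x \<in> W"
proof -
  have "x \<in> (\<Union>(U, \<Phi>)\<in>trivs E. U)"
    using vector_bundle[unfolded vector_bundle_def, THEN conjunct1] by simp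
  then show ?thesis using that by auto
qed

lemma triv_local:
  assumes "(W, \<Phi>) \<in> trivs E"
  shows "open W \<and> (\<forall>x\<in>W. bij_betw \<Phi> (fibre E x) UNIV \<and>
           (\<forall>a\<in>fibre E x. \<forall>b\<in>fibre E x.
              vadd E a b \<in> fibre E x \<and> \<Phi> (vadd E a b) = \<Phi> a + \<Phi> b) \<and>
           (\<forall>r. \<forall>a\<in>fibre E x.
              vscale E r a \<in> fibre E x \<and> \<Phi> (vscale E r a) = r *\<^sub>R \<Phi> a))"
  using bspec[OF vector_bundle[unfolded vector_bundle_def, THEN conjunct2, THEN conjunct1] assms]
  unfolding prod.case .

lemma open_triv: "(W, \<Phi>) \<in> trivs E \<Longrightarrow> open W"
  using triv_local by blast

lemma triv_bij: "(W, \<Phi>) \<in> trivs E \<Longrightarrow> x \<in> W \<Longrightarrow> bij_betw \<Phi> (fibre E x) UNIV"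
  using triv_local by blast

lemma triv_vadd:
  assumes "(W, \<Phi>) \<in> trivs E" "x \<in> W" "a \<in> fibre E x" "b \<in> fibre E x"
  shows "vadd E a b \<in> fibre E x" "\<Phi> (vadd E a b) = \<Phi> a + \<Phi> b"
  using triv_local[OF assms(1)] assms(2-) by blast+

lemma triv_vscale:
  assumes "(W, \<Phi>) \<in> trivs E" "x \<in> W" "a \<in> fibre E x"
  shows "vscale E r a \<in> fibre E x" "\<Phi> (vscale E r a) = r *\<^sub>R \<Phi> a"
  using triv_local[OF assms(1)] assms(2-) by blast+

lemma smooth_triv_change:
  assumes "(U, \<Phi>) \<in> trivs E" "(W, \<Psi>) \<in> trivs E"
  shows "smooth_fun (U \<inter> W) (\<lambda>x. \<Psi> (triv_inv E \<Phi> x w))"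
proof -
  from bspec[OF vector_bundle[unfolded vector_bundle_def, THEN conjunct2, THEN conjunct2] assms(1)]
  have "\<forall>(W, \<Psi>)\<in>trivs E. \<forall>w. smooth_fun (U \<inter> W) (\<lambda>x. \<Psi> (triv_inv E \<Phi> x w))"
    by (simp only: prod.case)
  from bspec[OF this assms(2)] show ?thesis by (simp only: prod.case)
qed

lemma vscale_in_fibre: "a \<in> fibre E x \<Longrightarrow> vscale E r a \<in> fibre E x"
  using triv_at triv_vscale(1) by metis

context
  fixes W \<Phi> x
  assumes W: "(W, \<Phi>) \<in> trivs E" "x \<in> W"
begin

lemma triv_inv_in_fibre: "triv_inv E \<Phi> x w \<in> fibre E x"
  unfolding triv_inv_def using triv_bij[OF W] by (metis UNIV_I bij_betw_def inv_into_into)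

lemma triv_triv_inv: "\<Phi> (triv_inv E \<Phi> x w) = w"
  unfolding triv_inv_def using triv_bij[OF W] by (simp add: bij_betw_inv_into_right)

lemma triv_inv_triv: "a \<in> fibre E x \<Longrightarrow> triv_inv E \<Phi> x (\<Phi> a) = a"
  unfolding triv_inv_def using triv_bij[OF W] by (simp add: bij_betw_inv_into_left)

lemma triv_inject: "a \<in> fibre E x \<Longrightarrow> b \<in> fibre E x \<Longrightarrow> \<Phi> a = \<Phi> b \<longleftrightarrow> a = b"
  using triv_inv_triv by metis

lemma triv_inv_add: "triv_inv E \<Phi> x (u + w) = vadd E (triv_inv E \<Phi> x u) (triv_inv E \<Phi> x w)"
  by (subst triv_inject[symmetric])
    (simp_all add: triv_vadd[OF W] triv_inv_in_fibre triv_triv_inv)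

lemma triv_inv_scale: "triv_inv E \<Phi> x (r *\<^sub>R w) = vscale E r (triv_inv E \<Phi> x w)"
  by (subst triv_inject[symmetric])
    (simp_all add: triv_vscale[OF W] triv_inv_in_fibre triv_triv_inv)

end

definition trans_mat :: "('e \<Rightarrow> real^'k) \<Rightarrow> ('e \<Rightarrow> real^'k) \<Rightarrow> 'm \<Rightarrow> real^'k^'k" where
  "trans_mat \<Phi> \<Psi> x = matrix (\<lambda>w. \<Psi> (triv_inv E \<Phi> x w))"

definition end_mat :: "('e \<Rightarrow> real^'k) \<Rightarrow> 'm \<Rightarrow> ('e \<Rightarrow> 'e) \<Rightarrow> real^'k^'k" where
  "end_mat \<Phi> x B = matrix (\<lambda>w. \<Phi> (B (triv_inv E \<Phi> x w)))"

definition mat_end :: "('e \<Rightarrow> real^'k) \<Rightarrow> 'm \<Rightarrow> real^'k^'k \<Rightarrow> 'e \<Rightarrow> 'e" where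
  "mat_end \<Phi> x M = restrict (\<lambda>a. triv_inv E \<Phi> x (M *v \<Phi> a)) (fibre E x)"

lemma trans_mat_apply:
  assumes "(W, \<Phi>) \<in> trivs E" "(V, \<Psi>) \<in> trivs E" "x \<in> W" "x \<in> V" "a \<in> fibre E x"
  shows "trans_mat \<Phi> \<Psi> x *v \<Phi> a = \<Psi> a"
proof -
  have "linear (\<lambda>w. \<Psi> (triv_inv E \<Phi> x w))"
    by (intro linearI) (simp_all add: triv_inv_add[OF assms(1,3)] triv_inv_scale[OF assms(1,3)]
        triv_vadd[OF assms(2,4)] triv_vscale[OF assms(2,4)] triv_inv_in_fibre[OF assms(1,3)])
  then show ?thesis
    using triv_inv_triv[OF assms(1,3,5)] by (simp add: trans_mat_def matrix_works linear_matrix_vector_mul_eq)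
qed

lemma trans_mat_inverse:
  assumes "(W, \<Phi>) \<in> trivs E" "(V, \<Psi>) \<in> trivs E" "x \<in> W" "x \<in> V"
  shows "trans_mat \<Psi> \<Phi> x ** trans_mat \<Phi> \<Psi> x = mat 1"
proof -
  have "trans_mat \<Psi> \<Phi> x *v (trans_mat \<Phi> \<Psi> x *v w) = w" for w
  proof -
    have a: "triv_inv E \<Phi> x w \<in> fibre E x" "\<Phi> (triv_inv E \<Phi> x w) = w"
      using triv_inv_in_fibre[OF assms(1,3)] triv_triv_inv[OF assms(1,3)] by auto
    show ?thesis
      using trans_mat_apply[OF assms a(1)] trans_mat_apply[OF assms(2,1,4,3) a(1)] a(2) by simp
  qed
  then show ?thesis by (simp add: matrix_eq matrix_vector_mul_assoc[symmetric])
qed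

lemma smooth_trans_mat:
  assumes "(W, \<Phi>) \<in> trivs E" "(V, \<Psi>) \<in> trivs E"
  shows "smooth_fun (W \<inter> V) (trans_mat \<Phi> \<Psi>)"
proof -
  have o: "open (W \<inter> V)" using open_triv assms by blast
  have "smooth_fun (W \<inter> V) (\<lambda>x. \<Psi> (triv_inv E \<Phi> x (axis j 1)) $ i)" for i j
    by (rule smooth_fun_linear[OF o bounded_linear_vec_nth smooth_triv_change[OF assms]])
  then have "smooth_fun (W \<inter> V) (\<lambda>x. trans_mat \<Phi> \<Psi> x $ i $ j)" for i j
    by (simp add: trans_mat_def matrix_def)
  then show ?thesis by (intro smooth_fun_vec o)
qed

lemma end_mat_apply:
  assumes "(W, \<Phi>) \<in> trivs E" "x \<in> W" "B \<in> End_fibre E x" "a \<in> fibre E x"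
  shows "end_mat \<Phi> x B *v \<Phi> a = \<Phi> (B a)"
proof -
  have "linear (\<lambda>w. \<Phi> (B (triv_inv E \<Phi> x w)))"
    using assms(3) by (intro linearI) (simp_all add: End_fibre_def triv_inv_add[OF assms(1,2)] triv_inv_scale[OF assms(1,2)]
        triv_vadd[OF assms(1,2)] triv_vscale[OF assms(1,2)] triv_inv_in_fibre[OF assms(1,2)])
  then show ?thesis
    using triv_inv_triv[OF assms(1,2,4)] by (simp add: end_mat_def matrix_works linear_matrix_vector_mul_eq)
qed

lemma End_fibreD: "B \<in> End_fibre E x \<Longrightarrow> a \<in> fibre E x \<Longrightarrow> B a \<in> fibre E x"
  by (simp add: End_fibre_def)

lemma end_mat_eqI:
  assumes "(W, \<Phi>) \<in> trivs E" "x \<in> W" "B \<in> End_fibre E x"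
    and "\<And>a. a \<in> fibre E x \<Longrightarrow> \<Phi> (B a) = M *v \<Phi> a"
  shows "end_mat \<Phi> x B = M"
  unfolding matrix_eq
proof
  fix w
  show "end_mat \<Phi> x B *v w = M *v w"
    using end_mat_apply[OF assms(1-3) triv_inv_in_fibre[OF assms(1,2)], of w]
      assms(4)[OF triv_inv_in_fibre[OF assms(1,2)], of w] by (simp add: triv_triv_inv[OF assms(1,2)])
qed

lemma end_mat_inject:
  assumes "(W, \<Phi>) \<in> trivs E" "x \<in> W" "B \<in> End_fibre E x" "C \<in> End_fibre E x" "end_mat \<Phi> x B = end_mat \<Phi> x C"
  shows "B = C"
proof
  fix a
  show "B a = C a"
  proof (cases "a \<in> fibre E x")
    case True
    then have "\<Phi> (B a) = \<Phi> (C a)"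
      using end_mat_apply[OF assms(1,2)] assms(3-5) by metis
    then show ?thesis
      using triv_inject[OF assms(1,2)] End_fibreD assms(3,4) True by metis
  next
    case False
    then show ?thesis using assms(3,4) by (simp add: End_fibre_def extensional_def)
  qed
qed

lemma mat_end_in_End_fibre:
  assumes "(W, \<Phi>) \<in> trivs E" "x \<in> W"
  shows "mat_end \<Phi> x M \<in> End_fibre E x"
  using triv_vadd[OF assms] triv_vscale[OF assms] triv_inv_in_fibre[OF assms]
  by (simp add: End_fibre_def mat_end_def matrix_vector_right_distrib matrix_vector_mult_scaleR
      triv_inv_add[OF assms] triv_inv_scale[OF assms])

lemma end_mat_mat_end:
  assumes "(W, \<Phi>) \<in> trivs E" "x \<in> W"
  shows "end_mat \<Phi> x (mat_end \<Phi> x M) = M"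
  by (rule end_mat_eqI[OF assms mat_end_in_End_fibre[OF assms]]) (simp add: mat_end_def triv_triv_inv[OF assms])

lemma mat_end_end_mat:
  assumes "(W, \<Phi>) \<in> trivs E" "x \<in> W" "B \<in> End_fibre E x"
  shows "mat_end \<Phi> x (end_mat \<Phi> x B) = B"
  by (rule end_mat_inject[OF assms(1,2) mat_end_in_End_fibre[OF assms(1,2)] assms(3) end_mat_mat_end[OF assms(1,2)]])

lemma end_mat_change:
  assumes "(W, \<Phi>) \<in> trivs E" "(V, \<Psi>) \<in> trivs E" "x \<in> W" "x \<in> V" "B \<in> End_fibre E x"
  shows "end_mat \<Psi> x B = trans_mat \<Phi> \<Psi> x ** end_mat \<Phi> x B ** trans_mat \<Psi> \<Phi> x"
proof (rule end_mat_eqI[OF assms(2,4,5)])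
  fix a assume a: "a \<in> fibre E x"
  show "\<Psi> (B a) = (trans_mat \<Phi> \<Psi> x ** end_mat \<Phi> x B ** trans_mat \<Psi> \<Phi> x) *v \<Psi> a"
    by (simp add: matrix_vector_mul_assoc[symmetric] trans_mat_apply[OF assms(2,1,4,3) a]
        end_mat_apply[OF assms(1,3,5) a] trans_mat_apply[OF assms(1-4) End_fibreD[OF assms(5) a]])
qed

section \<open>Smooth sections\<close>

lemma total_atlasE:
  assumes "\<mu> \<in> total_atlas A E"
  obtains \<kappa> V \<Psi> where "\<kappa> \<in> A" "(V, \<Psi>) \<in> trivs E"
    "\<mu> = ({e. proj E e \<in> fst \<kappa> \<inter> V}, \<lambda>e. (snd \<kappa> (proj E e), \<Psi> e))"
proof -
  from assms obtain U \<phi> V \<Psi> where "\<mu> = ({e. proj E e \<in> U \<inter> V}, \<lambda>e. (\<phi> (proj E e), \<Psi> e))"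
    "(U, \<phi>) \<in> A" "(V, \<Psi>) \<in> trivs E"
    unfolding total_atlas_def by (elim CollectE exE conjE)
  then show ?thesis by (intro that[of "(U, \<phi>)" V \<Psi>]) simp_all
qed

lemma total_atlasI:
  assumes "\<kappa> \<in> A" "(V, \<Psi>) \<in> trivs E"
  shows "({e. proj E e \<in> fst \<kappa> \<inter> V}, \<lambda>e. (snd \<kappa> (proj E e), \<Psi> e)) \<in> total_atlas A E"
  unfolding total_atlas_def mem_Collect_eq
  by (intro exI[of _ "fst \<kappa>"] exI[of _ "snd \<kappa>"] exI[of _ V] exI[of _ \<Psi>] conjI refl) (use assms in simp_all)

definition End_chart :: "('m, complex^'d) chart \<Rightarrow> 'm set \<Rightarrow> ('e \<Rightarrow> real^'k) \<Rightarrow>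
    ('m \<times> ('e \<Rightarrow> 'e), (complex^'d) \<times> (real^'k^'k)) chart" where
  "End_chart \<kappa> V \<Psi> = ({(x, B). x \<in> fst \<kappa> \<inter> V \<and> B \<in> End_fibre E x}, \<lambda>(x, B). (snd \<kappa> x, end_mat \<Psi> x B))"

lemma End_atlasE:
  assumes "\<mu> \<in> End_atlas A E"
  obtains \<kappa> V \<Psi> where "\<kappa> \<in> A" "(V, \<Psi>) \<in> trivs E" "\<mu> = End_chart \<kappa> V \<Psi>"
proof -
  from assms obtain U \<phi> V \<Psi> where "\<mu> = ({(x, B). x \<in> U \<inter> V \<and> B \<in> End_fibre E x},
       \<lambda>(x, B). (\<phi> x, matrix (\<lambda>w. \<Psi> (B (triv_inv E \<Psi> x w)))))"
    "(U, \<phi>) \<in> A" "(V, \<Psi>) \<in> trivs E"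
    unfolding End_atlas_def by (elim CollectE exE conjE)
  then show ?thesis by (intro that[of "(U, \<phi>)" V \<Psi>]) (simp_all add: End_chart_def end_mat_def)
qed

lemma End_atlasI:
  assumes "\<kappa> \<in> A" "(V, \<Psi>) \<in> trivs E"
  shows "End_chart \<kappa> V \<Psi> \<in> End_atlas A E"
  unfolding End_atlas_def mem_Collect_eq
  by (intro exI[of _ "fst \<kappa>"] exI[of _ "snd \<kappa>"] exI[of _ V] exI[of _ \<Psi>] conjI)
    (use assms in \<open>simp_all add: End_chart_def end_mat_def\<close>)

lemma smooth_sectionD:
  assumes "open S" "smooth_section A E S s" "(W, \<Phi>) \<in> trivs E"
  shows "smooth_fun (S \<inter> W) (\<lambda>x. \<Phi> (s x))"
proof (rule smooth_fun_local)
  show "open (S \<inter> W)" using assms open_triv by blast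
  fix p assume p: "p \<in> S \<inter> W"
  have s: "s x \<in> fibre E x" if "x \<in> S" for x using assms(2) that by (simp add: smooth_section_def)
  obtain \<mu> T where T: "\<mu> \<in> total_atlas A E" "open T" "p \<in> T" "T \<subseteq> S" "s ` T \<subseteq> fst \<mu>" "smooth_fun T (\<lambda>x. snd \<mu> (s x))"
  proof -
    have 1: "smooth_map_on A (total_atlas A E) S s" "p \<in> S"
      using assms(2) p by (simp_all add: smooth_section_def)
    show ?thesis by (rule smooth_map_onE[OF 1]) (rule that)
  qed
  obtain \<kappa> V \<Psi> where V: "(V, \<Psi>) \<in> trivs E"
    and m: "\<mu> = ({e. proj E e \<in> fst \<kappa> \<inter> V}, \<lambda>e. (snd \<kappa> (proj E e), \<Psi> e))"
    by (rule total_atlasE[OF T(1)])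
  have TV: "T \<subseteq> V"
  proof
    fix x assume "x \<in> T"
    then have "proj E (s x) \<in> V" "proj E (s x) = x" using T(4,5) s m by (auto simp: fibre_def)
    then show "x \<in> V" by simp
  qed
  define N where "N = T \<inter> (V \<inter> W)"
  have N: "open N" "N \<subseteq> V \<inter> W" "p \<in> N" unfolding N_def using T p TV open_triv[OF V] open_triv[OF assms(3)] by auto
  have "smooth_fun T (\<lambda>x. snd (snd \<mu> (s x)))" by (rule smooth_fun_linear[OF T(2) bounded_linear_snd T(6)])
  then have "smooth_fun T (\<lambda>x. \<Psi> (s x))" by (simp add: m)
  then have 1: "smooth_fun N (\<lambda>x. \<Psi> (s x))" by (rule smooth_fun_subset) (use T N in \<open>auto simp: N_def\<close>)
  have 2: "smooth_fun N (trans_mat \<Psi> \<Phi>)"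
    by (rule smooth_fun_subset[OF smooth_trans_mat[OF V assms(3)]]) (use N open_triv V assms(3) in auto)
  have "smooth_fun N (\<lambda>x. trans_mat \<Psi> \<Phi> x *v \<Psi> (s x))"
    by (rule smooth_fun_bilinear[OF N(1) bounded_bilinear_matrix_vector 2 1])
  then have "smooth_fun N (\<lambda>x. \<Phi> (s x))"
  proof (rule smooth_fun_cong[OF _ N(1)])
    fix x assume "x \<in> N"
    then show "trans_mat \<Psi> \<Phi> x *v \<Psi> (s x) = \<Phi> (s x)"
      using N(2) T(4) by (intro trans_mat_apply[OF V assms(3)] s) (auto simp: N_def)
  qed
  with N show "\<exists>T. open T \<and> p \<in> T \<and> smooth_fun T (\<lambda>x. \<Phi> (s x))" by blast
qed

lemma smooth_sectionI:
  assumes "open S" "\<And>x. x \<in> S \<Longrightarrow> s x \<in> fibre E x"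
    and "\<And>p. p \<in> S \<Longrightarrow> \<exists>W \<Phi>. (W, \<Phi>) \<in> trivs E \<and> p \<in> W \<and> smooth_fun (S \<inter> W) (\<lambda>x. \<Phi> (s x))"
  shows "smooth_section A E S s"
  unfolding smooth_section_def
proof (intro conjI smooth_map_onI ballI)
  fix p assume p: "p \<in> S"
  obtain W \<Phi> where W: "(W, \<Phi>) \<in> trivs E" "p \<in> W" "smooth_fun (S \<inter> W) (\<lambda>x. \<Phi> (s x))" using assms(3)[OF p] by blast
  obtain \<kappa> where k: "\<kappa> \<in> A" "p \<in> fst \<kappa>" by (rule chart_at)
  define N where "N = S \<inter> W \<inter> fst \<kappa>"
  have N: "open N" "N \<subseteq> S \<inter> W" "p \<in> N" using open_triv[OF W(1)] open_chart[OF k(1)] assms(1) p W k by (auto simp: N_def)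
  have pr: "proj E (s x) = x" if "x \<in> N" for x using assms(2)[of x] that by (simp add: N_def fibre_def)
  have "smooth_fun N (\<lambda>x. (snd \<kappa> x, \<Phi> (s x)))"
    using k N W(3) open_triv[OF W(1)] assms(1)
    by (intro smooth_fun_Pair smooth_fun_chart smooth_fun_subset[OF W(3)]) (auto simp: N_def)
  then have sm: "smooth_fun N (\<lambda>x. (snd \<kappa> (proj E (s x)), \<Phi> (s x)))"
    by (rule smooth_fun_cong[OF _ N(1)]) (simp add: pr)
  note m = total_atlasI[OF k(1) W(1)]
  have sub: "s ` N \<subseteq> {e. proj E e \<in> fst \<kappa> \<inter> W}" using pr by (auto simp: N_def)
  show "\<exists>\<mu>\<in>total_atlas A E. \<exists>T. open T \<and> p \<in> T \<and> T \<subseteq> S \<and> s ` T \<subseteq> fst \<mu> \<and> smooth_fun T (\<lambda>x. snd \<mu> (s x))"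
    by (rule bexI[OF _ m]) (use N sm sub in auto)
qed (use assms in auto)

lemma smooth_section_triv_inv:
  assumes "(W, \<Phi>) \<in> trivs E" "open S" "S \<subseteq> W" "smooth_fun S f"
  shows "smooth_section A E S (\<lambda>y. triv_inv E \<Phi> y (f y))"
proof (rule smooth_sectionI[OF assms(2)])
  show "triv_inv E \<Phi> x (f x) \<in> fibre E x" if "x \<in> S" for x
    using triv_inv_in_fibre[OF assms(1)] that assms(3) by blast
  show "\<exists>W \<Phi>'. (W, \<Phi>') \<in> trivs E \<and> p \<in> W \<and> smooth_fun (S \<inter> W) (\<lambda>x. \<Phi>' (triv_inv E \<Phi> x (f x)))" if "p \<in> S" for p
  proof (intro exI conjI)
    show "smooth_fun (S \<inter> W) (\<lambda>x. \<Phi> (triv_inv E \<Phi> x (f x)))"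
    proof (rule smooth_fun_cong)
      show "smooth_fun (S \<inter> W) f" using assms by (simp add: Int_absorb2)
      show "open (S \<inter> W)" using assms open_triv by blast
      show "f x = \<Phi> (triv_inv E \<Phi> x (f x))" if "x \<in> S \<inter> W" for x
        using triv_triv_inv[OF assms(1)] that by simp
    qed
  qed (use assms that in auto)
qed

section \<open>Smooth curves in the bundles\<close>

text \<open>The matrices of an endomorphism in two trivialisations are conjugate by the transition matrices, which are
  smooth. So a curve that is smooth in some bundle chart has smooth matrices in all trivialisations.\<close>

lemma End_curveD:
  fixes c :: "real \<Rightarrow> 'm"
  assumes "smooth_map_on std_atlas (End_atlas A E) T (\<lambda>t. (c t, B t))" "open T"
  shows "t \<in> T \<Longrightarrow> B t \<in> End_fibre E (c t)"
    and "smooth_map_on std_atlas A T c"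
    and "(W, \<Phi>) \<in> trivs E \<Longrightarrow> open T' \<Longrightarrow> T' \<subseteq> T \<Longrightarrow> c ` T' \<subseteq> W \<Longrightarrow>
      smooth_on T' (\<lambda>t. end_mat \<Phi> (c t) (B t))"
proof -
  have local: "\<exists>\<kappa> W \<Phi> N. \<kappa> \<in> A \<and> (W, \<Phi>) \<in> trivs E \<and> open N \<and> t \<in> N \<and> N \<subseteq> T \<and> c ` N \<subseteq> fst \<kappa> \<inter> W \<and>
      (\<forall>t\<in>N. B t \<in> End_fibre E (c t)) \<and> smooth_on N (\<lambda>t. snd \<kappa> (c t)) \<and> smooth_on N (\<lambda>t. end_mat \<Phi> (c t) (B t))"
    if t: "t \<in> T" for t
  proof -
    obtain \<mu> N where N: "\<mu> \<in> End_atlas A E" "open N" "t \<in> N" "N \<subseteq> T" "(\<lambda>t. (c t, B t)) ` N \<subseteq> fst \<mu>"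
      "smooth_on N (\<lambda>t. snd \<mu> (c t, B t))"
      by (rule smooth_curveE[OF assms(1) t])
    obtain \<kappa> W \<Phi> where m: "\<kappa> \<in> A" "(W, \<Phi>) \<in> trivs E" "\<mu> = End_chart \<kappa> W \<Phi>"
      by (rule End_atlasE[OF N(1)])
    have "smooth_on N (\<lambda>t. fst (snd \<mu> (c t, B t)))" "smooth_on N (\<lambda>t. snd (snd \<mu> (c t, B t)))"
      by (rule smooth_on_linear_comp[OF N(2) bounded_linear_fst N(6)] smooth_on_linear_comp[OF N(2) bounded_linear_snd N(6)])+
    then have "smooth_on N (\<lambda>t. snd \<kappa> (c t))" "smooth_on N (\<lambda>t. end_mat \<Phi> (c t) (B t))"
      by (simp_all add: m(3) End_chart_def)
    moreover have "c ` N \<subseteq> fst \<kappa> \<inter> W" "\<forall>t\<in>N. B t \<in> End_fibre E (c t)" using N(5) by (auto simp: m(3) End_chart_def)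
    ultimately show ?thesis
      using N(2-4) m(1,2) by (intro exI[of _ \<kappa>] exI[of _ W] exI[of _ \<Phi>] exI[of _ N]) simp
  qed
  show "B t \<in> End_fibre E (c t)" if "t \<in> T" for t using local[OF that] by blast
  show c: "smooth_map_on std_atlas A T c"
  proof (rule smooth_curveI)
    fix t assume "t \<in> T"
    from local[OF this] show "\<exists>\<mu>\<in>A. \<exists>W. open W \<and> t \<in> W \<and> W \<subseteq> T \<and> c ` W \<subseteq> fst \<mu> \<and> smooth_on W (\<lambda>t. snd \<mu> (c t))" by blast
  qed
  assume W: "(W, \<Phi>) \<in> trivs E" and T': "open T'" "T' \<subseteq> T" "c ` T' \<subseteq> W"
  show "smooth_on T' (\<lambda>t. end_mat \<Phi> (c t) (B t))"
  proof (rule smooth_on_local)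
    fix t assume t: "t \<in> T'"
    then have "t \<in> T" using T' by blast
    from local[OF this] obtain \<kappa> V \<Psi> N where "\<kappa> \<in> A" and N: "(V, \<Psi>) \<in> trivs E" "open N" "t \<in> N" "N \<subseteq> T"
      "c ` N \<subseteq> fst \<kappa> \<inter> V" "\<forall>t\<in>N. B t \<in> End_fibre E (c t)" "smooth_on N (\<lambda>t. snd \<kappa> (c t))"
      "smooth_on N (\<lambda>t. end_mat \<Psi> (c t) (B t))"
      by (elim exE conjE)
    define M where "M = N \<inter> T'"
    have M: "open M" "t \<in> M" "c ` M \<subseteq> W \<inter> V" "c ` M \<subseteq> V \<inter> W" using N T' t by (auto simp: M_def)
    have cM: "smooth_map_on std_atlas A M c"
      using smooth_curve_subset[OF c M(1)] N(4) by (auto simp: M_def)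
    have o: "open (W \<inter> V)" "open (V \<inter> W)" using open_triv W N(1) by auto
    have "smooth_on M (\<lambda>t. trans_mat \<Psi> \<Phi> (c t) ** end_mat \<Psi> (c t) (B t) ** trans_mat \<Phi> \<Psi> (c t))"
      by (intro smooth_on_bilinear[OF M(1) bounded_bilinear_matrix_mult] smooth_on_subset[OF N(8)]
          smooth_fun_curve[OF cM M(1) o(1) smooth_trans_mat[OF W N(1)] M(3)]
          smooth_fun_curve[OF cM M(1) o(2) smooth_trans_mat[OF N(1) W] M(4)]) (auto simp: M_def)
    then have "smooth_on M (\<lambda>t. end_mat \<Phi> (c t) (B t))"
    proof (rule smooth_on_cong[OF _ M(1)])
      fix s assume "s \<in> M"
      then show "trans_mat \<Psi> \<Phi> (c s) ** end_mat \<Psi> (c s) (B s) ** trans_mat \<Phi> \<Psi> (c s) = end_mat \<Phi> (c s) (B s)"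
        using M N(6) by (intro end_mat_change[OF N(1) W, symmetric]) (auto simp: M_def)
    qed
    with M show "\<exists>W. open W \<and> t \<in> W \<and> smooth_on W (\<lambda>t. end_mat \<Phi> (c t) (B t))" by blast
  qed
qed

end

context complex_bundle
begin

lemma End_curveI:
  fixes c :: "real \<Rightarrow> 'm"
  assumes c: "smooth_map_on std_atlas A T c" and T: "open T" and W: "(W, \<Phi>) \<in> trivs E" "c ` T \<subseteq> W"
    and B: "\<And>t. t \<in> T \<Longrightarrow> B t \<in> End_fibre E (c t)" "smooth_on T (\<lambda>t. end_mat \<Phi> (c t) (B t))"
  shows "smooth_map_on std_atlas (End_atlas A E) T (\<lambda>t. (c t, B t))"
proof (rule smooth_curveI)
  fix t assume t: "t \<in> T"
  obtain \<mu> N where N: "\<mu> \<in> A" "open N" "t \<in> N" "N \<subseteq> T" "c ` N \<subseteq> fst \<mu>" "smooth_on N (\<lambda>t. snd \<mu> (c t))"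
    by (rule smooth_curveE[OF c t])
  have "smooth_on N (\<lambda>t. (snd \<mu> (c t), end_mat \<Phi> (c t) (B t)))"
    by (rule smooth_on_Pair[OF N(2,6) smooth_on_subset[OF B(2) N(4)]])
  then have "smooth_on N (\<lambda>t. snd (End_chart \<mu> W \<Phi>) (c t, B t))" by (simp add: End_chart_def)
  moreover have "(\<lambda>t. (c t, B t)) ` N \<subseteq> fst (End_chart \<mu> W \<Phi>)"
    using N(4,5) W(2) B(1) by (auto simp: End_chart_def)
  ultimately show "\<exists>\<mu>\<in>End_atlas A E. \<exists>W. open W \<and> t \<in> W \<and> W \<subseteq> T \<and> (\<lambda>t. (c t, B t)) ` W \<subseteq> fst \<mu> \<and>
      smooth_on W (\<lambda>t. snd \<mu> (c t, B t))"
    using N by (intro bexI[OF _ End_atlasI[OF N(1) W(1)]] exI[of _ N]) simp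
qed

text \<open>As for curves of endomorphisms, the choice of trivialisation is immaterial because the transition matrices are smooth.\<close>

lemma section_along_differentiable:
  fixes c :: "real \<Rightarrow> 'm"
  assumes s: "smooth_map_on std_atlas (total_atlas A E) T s" "\<And>t. t \<in> T \<Longrightarrow> s t \<in> fibre E (c t)"
    and c: "smooth_map_on std_atlas A T c" and t: "t \<in> T" and W: "(W, \<Phi>) \<in> trivs E" "c t \<in> W"
  shows "(\<lambda>r. \<Phi> (s r)) differentiable (at t)"
proof -
  obtain \<mu> N where N: "\<mu> \<in> total_atlas A E" "open N" "t \<in> N" "N \<subseteq> T" "s ` N \<subseteq> fst \<mu>" "smooth_on N (\<lambda>t. snd \<mu> (s t))"
    by (rule smooth_curveE[OF s(1) t])
  obtain \<kappa> V \<Psi> where V: "(V, \<Psi>) \<in> trivs E"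
    and m: "\<mu> = ({e. proj E e \<in> fst \<kappa> \<inter> V}, \<lambda>e. (snd \<kappa> (proj E e), \<Psi> e))"
    by (rule total_atlasE[OF N(1)])
  have cV: "c r \<in> V" if "r \<in> N" for r
  proof -
    have "s r \<in> fst \<mu>" "r \<in> T" using N(4,5) that by auto
    then show ?thesis using s(2)[of r] by (simp add: m fibre_def)
  qed
  obtain M where M: "open M" "t \<in> M" "M \<subseteq> N" "c ` M \<subseteq> V \<inter> W"
  proof -
    have cN: "smooth_map_on std_atlas A N c" by (rule smooth_curve_subset[OF c N(2,4)])
    have "open (V \<inter> W)" "c t \<in> V \<inter> W" using open_triv[OF V] open_triv[OF W(1)] cV[OF N(3)] W(2) by auto
    from smooth_curve_eventually[OF cN N(3) this] show ?thesis using that by metis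
  qed
  have cM: "smooth_map_on std_atlas A M c" using smooth_curve_subset[OF c M(1)] M(3) N(4) by blast
  have "smooth_on N (\<lambda>t. snd (snd \<mu> (s t)))" by (rule smooth_on_linear_comp[OF N(2) bounded_linear_snd N(6)])
  then have 1: "smooth_on M (\<lambda>t. \<Psi> (s t))" by (intro smooth_on_subset[OF _ M(3)]) (simp add: m)
  have "open (V \<inter> W)" using open_triv[OF V] open_triv[OF W(1)] by auto
  then have 2: "smooth_on M (\<lambda>t. trans_mat \<Psi> \<Phi> (c t))"
    by (rule smooth_fun_curve[OF cM M(1) _ smooth_trans_mat[OF V W(1)] M(4)])
  have "smooth_on M (\<lambda>t. trans_mat \<Psi> \<Phi> (c t) *v \<Psi> (s t))"
    by (rule smooth_on_bilinear[OF M(1) bounded_bilinear_matrix_vector 2 1])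
  then have "smooth_on M (\<lambda>t. \<Phi> (s t))"
  proof (rule smooth_on_cong[OF _ M(1)])
    fix r assume "r \<in> M"
    then show "trans_mat \<Psi> \<Phi> (c r) *v \<Psi> (s r) = \<Phi> (s r)"
      using M N(4) by (intro trans_mat_apply[OF V W(1)] s(2)) auto
  qed
  then show ?thesis using smooth_on_differentiable M(2) by blast
qed

lemma fibre_nonempty: "fibre E x \<noteq> {}"
  using triv_at triv_inv_in_fibre by (metis empty_iff)

text \<open>A section with constant coordinates, cut off by a bump function before the curve leaves the domain of the
  trivialisation and continued by \<open>0\<close>. Since the definition of parallel curves tests with sections
  along the whole curve, local sections do not suffice.\<close>

lemma section_along_with_value:
  fixes c :: "real \<Rightarrow> 'm"
  assumes c: "smooth_map_on std_atlas A {-\<epsilon><..<\<epsilon>} c" and e: "\<epsilon> > 0" and W: "(W, \<Phi>) \<in> trivs E" "c 0 \<in> W"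
  obtains s where "smooth_map_on std_atlas (total_atlas A E) {-\<epsilon><..<\<epsilon>} s"
    "\<And>t. t \<in> {-\<epsilon><..<\<epsilon>} \<Longrightarrow> s t \<in> fibre E (c t)" "\<Phi> (s 0) = w"
proof -
  obtain N where N: "open N" "0 \<in> N" "N \<subseteq> {-\<epsilon><..<\<epsilon>}" "c ` N \<subseteq> W"
  proof -
    have "0 \<in> {-\<epsilon><..<\<epsilon>}" using e by simp
    from smooth_curve_eventually[OF c this open_triv[OF W(1)] W(2)] show ?thesis using that by metis
  qed
  then obtain r where r: "r > 0" "ball 0 r \<subseteq> N" using open_contains_ball by metis
  have rN: "t \<in> N" if "\<bar>t\<bar> < r" for t using r that by (auto simp: subset_iff dist_real_def)
  obtain \<beta> :: "real \<Rightarrow> real" where \<beta>: "smooth_on UNIV \<beta>" "\<beta> 0 = 1" "\<And>x. \<bar>x\<bar> \<ge> r / 2 \<Longrightarrow> \<beta> x = 0"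
    using smooth_bump[of "r / 2"] r(1) by auto
  define z where "z x = vscale E 0 (SOME a. a \<in> fibre E x)" for x
  have z_fib: "(SOME a. a \<in> fibre E x) \<in> fibre E x" for x
    using fibre_nonempty by (simp add: some_in_eq)
  have z: "z x \<in> fibre E x" for x unfolding z_def by (rule vscale_in_fibre[OF z_fib])
  have z0: "\<Psi> (z x) = 0" if "(V, \<Psi>) \<in> trivs E" "x \<in> V" for V \<Psi> x
    unfolding z_def by (simp add: triv_vscale[OF that z_fib])
  define s where "s t = (if \<bar>t\<bar> < r then triv_inv E \<Phi> (c t) (\<beta> t *\<^sub>R w) else z (c t))" for t
  have cW: "c t \<in> W" if "\<bar>t\<bar> < r" for t using N(4) rN[OF that] by blast
  have s_fib: "s t \<in> fibre E (c t)" for t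
    unfolding s_def using z triv_inv_in_fibre[OF W(1) cW] by auto
  have s_proj: "proj E (s t) = c t" for t using s_fib by (simp add: fibre_def)
  \<comment> \<open>The two definitions of \<open>s\<close> overlap for \<open>r/2 < \<bar>t\<bar> < r\<close>, so each point has a neighbourhood on which one of them is valid.\<close>
  have s_far: "s t = z (c t)" if "\<bar>t\<bar> > r / 2" for t
  proof (cases "\<bar>t\<bar> < r")
    case True
    have "\<Phi> (triv_inv E \<Phi> (c t) 0) = \<Phi> (z (c t))"
      by (simp add: triv_triv_inv[OF W(1) cW[OF True]] z0[OF W(1) cW[OF True]])
    then have "triv_inv E \<Phi> (c t) 0 = z (c t)"
      using triv_inject[OF W(1) cW[OF True] triv_inv_in_fibre[OF W(1) cW[OF True]] z] by blast
    then show ?thesis using True that \<beta>(3)[of t] by (simp add: s_def)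
  qed (simp add: s_def)
  have near: "\<Phi> (s t) = \<beta> t *\<^sub>R w" if "\<bar>t\<bar> < r" for t
    using that by (simp add: s_def triv_triv_inv[OF W(1) cW[OF that]])
  have "smooth_map_on std_atlas (total_atlas A E) {-\<epsilon><..<\<epsilon>} s"
  proof (rule smooth_curveI)
    fix t assume t: "t \<in> {-\<epsilon><..<\<epsilon>}"
    obtain \<mu> M where M: "\<mu> \<in> A" "open M" "t \<in> M" "M \<subseteq> {-\<epsilon><..<\<epsilon>}" "c ` M \<subseteq> fst \<mu>" "smooth_on M (\<lambda>t. snd \<mu> (c t))"
      by (rule smooth_curveE[OF c t])
    have "\<exists>V \<Psi> M'. (V, \<Psi>) \<in> trivs E \<and> open M' \<and> t \<in> M' \<and> M' \<subseteq> M \<and> c ` M' \<subseteq> V \<and> smooth_on M' (\<lambda>t. \<Psi> (s t))"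
    proof (cases "\<bar>t\<bar> < r")
      case True
      define M' where "M' = M \<inter> ball 0 r"
      have M': "open M'" "t \<in> M'" "M' \<subseteq> M" "\<And>u. u \<in> M' \<Longrightarrow> \<bar>u\<bar> < r"
        using M True by (auto simp: M'_def dist_real_def)
      have "smooth_on M' (\<lambda>t. \<beta> t *\<^sub>R w)"
        by (rule smooth_on_linear_comp[OF M'(1) bounded_linear_scaleR_left smooth_on_subset[OF \<beta>(1)]]) simp
      then have "smooth_on M' (\<lambda>t. \<Phi> (s t))"
        by (rule smooth_on_cong[OF _ M'(1)]) (simp add: near M'(4))
      moreover have "c ` M' \<subseteq> W" using cW M'(4) by blast
      ultimately show ?thesis using W(1) M' by (intro exI[of _ W] exI[of _ \<Phi>] exI[of _ M']) simp
    next
      case False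
      obtain V \<Psi> where V: "(V, \<Psi>) \<in> trivs E" "c t \<in> V" by (rule triv_at)
      obtain L where L: "open L" "t \<in> L" "L \<subseteq> {-\<epsilon><..<\<epsilon>}" "c ` L \<subseteq> V"
        by (rule smooth_curve_eventually[OF c t open_triv[OF V(1)] V(2)])
      define M' where "M' = M \<inter> L \<inter> {u. \<bar>u\<bar> > r / 2}"
      have "open {u::real. \<bar>u\<bar> > r / 2}" by (intro open_Collect_less continuous_intros)
      then have M': "open M'" "t \<in> M'" "M' \<subseteq> M" "c ` M' \<subseteq> V"
        using M L False r(1) by (auto simp: M'_def)
      have "smooth_on M' (\<lambda>t. \<Psi> (s t))"
      proof (rule smooth_on_cong[OF smooth_on_const[OF M'(1), of 0] M'(1)])
        fix u assume u: "u \<in> M'"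
        then have "s u = z (c u)" by (intro s_far) (simp add: M'_def)
        moreover have "c u \<in> V" using u M'(4) by blast
        ultimately show "0 = \<Psi> (s u)" using z0[OF V(1)] by simp
      qed
      then show ?thesis using V(1) M' by (intro exI[of _ V] exI[of _ \<Psi>] exI[of _ M']) simp
    qed
    then obtain V \<Psi> M' where V: "(V, \<Psi>) \<in> trivs E" and M': "open M'" "t \<in> M'" "M' \<subseteq> M" "c ` M' \<subseteq> V" "smooth_on M' (\<lambda>t. \<Psi> (s t))"
      by (elim exE conjE)
    have "smooth_on M' (\<lambda>t. (snd \<mu> (c t), \<Psi> (s t)))"
      by (rule smooth_on_Pair[OF M'(1) smooth_on_subset[OF M(6) M'(3)] M'(5)])
    moreover have "c ` M' \<subseteq> fst \<mu> \<inter> V" using M(5) M'(3,4) by blast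
    ultimately show "\<exists>\<mu>\<in>total_atlas A E. \<exists>N. open N \<and> t \<in> N \<and> N \<subseteq> {-\<epsilon><..<\<epsilon>} \<and> s ` N \<subseteq> fst \<mu> \<and> smooth_on N (\<lambda>t. snd \<mu> (s t))"
      using M' M(4) by (intro bexI[OF _ total_atlasI[OF M(1) V]] exI[of _ M']) (auto simp: s_proj)
  qed
  then show ?thesis
    by (rule that) (use s_fib near[of 0] r(1) \<beta>(2) in simp_all)
qed

section \<open>The strata in a trivialisation\<close>

lemma has_fibre_dim_iff:
  assumes W: "(W, \<Phi>) \<in> trivs E" "x \<in> W" and N: "N \<subseteq> fibre E x"
  shows "has_fibre_dim E x N d \<longleftrightarrow> dim (\<Phi> ` N) = d"
proof -
  have "dim (\<Psi> ` N) = dim (\<Phi> ` N)" if V: "(V, \<Psi>) \<in> trivs E" "x \<in> V" for V \<Psi>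
  proof -
    let ?T = "trans_mat \<Phi> \<Psi> x"
    have "\<Psi> ` N = (*v) ?T ` \<Phi> ` N"
      using trans_mat_apply[OF W(1) V(1) W(2) V(2)] N by (force simp: image_image)
    moreover have "invertible ?T"
      using trans_mat_inverse[OF W(1) V(1) W(2) V(2)] trans_mat_inverse[OF V(1) W(1) V(2) W(2)]
      unfolding invertible_def by blast
    ultimately show ?thesis
      by (simp add: dim_image_eq inj_on_subset[OF inj_matrix_vector_mult])
  qed
  then show ?thesis using W unfolding has_fibre_dim_def by blast
qed

lemma triv_image_Ker:
  assumes W: "(W, \<Phi>) \<in> trivs E" "x \<in> W" and PQ: "P \<in> End_fibre E x" "Q \<in> End_fibre E x"
  shows "\<Phi> ` Ker_plus E x P Q = {w. (end_mat \<Phi> x P + end_mat \<Phi> x Q) *v w = 0}"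
    and "\<Phi> ` Ker_minus E x P Q = {w. (end_mat \<Phi> x P - end_mat \<Phi> x Q) *v w = 0}"
proof -
  have eq: "vadd E (P a) (Q a) = vscale E 0 a \<longleftrightarrow> (end_mat \<Phi> x P + end_mat \<Phi> x Q) *v \<Phi> a = 0"
    "vsub E (P a) (Q a) = vscale E 0 a \<longleftrightarrow> (end_mat \<Phi> x P - end_mat \<Phi> x Q) *v \<Phi> a = 0" if a: "a \<in> fibre E x" for a
  proof -
    note PQa = End_fibreD[OF PQ(1) a] End_fibreD[OF PQ(2) a]
    have "vadd E (P a) (Q a) = vscale E 0 a \<longleftrightarrow> \<Phi> (vadd E (P a) (Q a)) = \<Phi> (vscale E 0 a)"
      using triv_inject[OF W] triv_vadd(1)[OF W PQa] triv_vscale(1)[OF W a] by blast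
    then show "vadd E (P a) (Q a) = vscale E 0 a \<longleftrightarrow> (end_mat \<Phi> x P + end_mat \<Phi> x Q) *v \<Phi> a = 0"
      by (simp add: triv_vadd(2)[OF W PQa] triv_vscale(2)[OF W a] matrix_vector_mult_add_rdistrib
          end_mat_apply[OF W PQ(1) a] end_mat_apply[OF W PQ(2) a])
    note Qa' = triv_vscale[OF W PQa(2), of "-1"]
    have "vsub E (P a) (Q a) = vscale E 0 a \<longleftrightarrow> \<Phi> (vsub E (P a) (Q a)) = \<Phi> (vscale E 0 a)"
      using triv_inject[OF W] triv_vadd(1)[OF W PQa(1) Qa'(1)] triv_vscale(1)[OF W a] unfolding vsub_def by blast
    then show "vsub E (P a) (Q a) = vscale E 0 a \<longleftrightarrow> (end_mat \<Phi> x P - end_mat \<Phi> x Q) *v \<Phi> a = 0"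
      by (simp add: vsub_def triv_vadd(2)[OF W PQa(1) Qa'(1)] Qa'(2) triv_vscale(2)[OF W a] matrix_vector_mult_diff_rdistrib
          end_mat_apply[OF W PQ(1) a] end_mat_apply[OF W PQ(2) a])
  qed
  have sur: "\<exists>a\<in>fibre E x. w = \<Phi> a" for w
    using triv_inv_in_fibre[OF W] triv_triv_inv[OF W] by metis
  show "\<Phi> ` Ker_plus E x P Q = {w. (end_mat \<Phi> x P + end_mat \<Phi> x Q) *v w = 0}"
  proof (intro set_eqI iffI)
    fix w assume "w \<in> {w. (end_mat \<Phi> x P + end_mat \<Phi> x Q) *v w = 0}"
    then show "w \<in> \<Phi> ` Ker_plus E x P Q" using sur[of w] eq(1) by (auto simp: Ker_plus_def)
  qed (use eq(1) in \<open>auto simp: Ker_plus_def\<close>)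
  show "\<Phi> ` Ker_minus E x P Q = {w. (end_mat \<Phi> x P - end_mat \<Phi> x Q) *v w = 0}"
  proof (intro set_eqI iffI)
    fix w assume "w \<in> {w. (end_mat \<Phi> x P - end_mat \<Phi> x Q) *v w = 0}"
    then show "w \<in> \<Phi> ` Ker_minus E x P Q" using sur[of w] eq(2) by (auto simp: Ker_minus_def)
  qed (use eq(2) in \<open>auto simp: Ker_minus_def\<close>)
qed

lemma twistor_space_iff:
  assumes W: "(W, \<Phi>) \<in> trivs E" "x \<in> W"
  shows "(x, K) \<in> twistor_space E \<longleftrightarrow> K \<in> End_fibre E x \<and> end_mat \<Phi> x K ** end_mat \<Phi> x K = - mat 1"
proof -
  have "(\<forall>a\<in>fibre E x. K (K a) = vscale E (-1) a) \<longleftrightarrow> end_mat \<Phi> x K ** end_mat \<Phi> x K = - mat 1"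
    if K: "K \<in> End_fibre E x"
  proof -
    have eq: "K (K a) = vscale E (-1) a \<longleftrightarrow> (end_mat \<Phi> x K ** end_mat \<Phi> x K) *v \<Phi> a = - mat 1 *v \<Phi> a" if a: "a \<in> fibre E x" for a
    proof -
      note Ka = End_fibreD[OF K a]
      have "K (K a) = vscale E (-1) a \<longleftrightarrow> \<Phi> (K (K a)) = \<Phi> (vscale E (-1) a)"
        using triv_inject[OF W End_fibreD[OF K Ka] triv_vscale(1)[OF W a]] by simp
      then show ?thesis
        by (simp add: triv_vscale(2)[OF W a] matrix_vector_mul_assoc[symmetric] end_mat_apply[OF W K a]
            end_mat_apply[OF W K Ka] matrix_vector_neg)
    qed
    have sur: "\<exists>a\<in>fibre E x. w = \<Phi> a" for w
      using triv_inv_in_fibre[OF W] triv_triv_inv[OF W] by metis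
    show ?thesis unfolding matrix_eq using eq sur by metis
  qed
  then show ?thesis unfolding twistor_space_def by auto
qed

text \<open>The three kinds of strata in one definition, as for \<open>stratum\<close>.\<close>

definition twistor_stratum :: "('m \<Rightarrow> 'e \<Rightarrow> 'e) \<Rightarrow> bool \<Rightarrow> bool \<Rightarrow> nat \<Rightarrow> nat \<Rightarrow> ('m \<times> ('e \<Rightarrow> 'e)) set" where
  "twistor_stratum J pl mi d1 d2 = {(x, K) \<in> twistor_space E.
     (pl \<longrightarrow> has_fibre_dim E x (Ker_plus E x (J x) K) d1) \<and>
     (mi \<longrightarrow> has_fibre_dim E x (Ker_minus E x (J x) K) d2)}"

text \<open>Membership in a stratum, which is defined with all trivialisations, is read off in a single one.\<close>

lemma twistor_stratum_iff:
  assumes W: "(W, \<Phi>) \<in> trivs E" "x \<in> W" and J: "J x \<in> End_fibre E x"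
  shows "(x, K) \<in> twistor_stratum J pl mi d1 d2 \<longleftrightarrow>
    K \<in> End_fibre E x \<and> end_mat \<Phi> x K \<in> stratum (end_mat \<Phi> x (J x)) pl mi d1 d2"
proof -
  have "has_fibre_dim E x (Ker_plus E x (J x) K) d \<longleftrightarrow> dim {w. (end_mat \<Phi> x (J x) + end_mat \<Phi> x K) *v w = 0} = d"
    "has_fibre_dim E x (Ker_minus E x (J x) K) d \<longleftrightarrow> dim {w. (end_mat \<Phi> x (J x) - end_mat \<Phi> x K) *v w = 0} = d"
    if K: "K \<in> End_fibre E x" for d
  proof -
    have "Ker_plus E x (J x) K \<subseteq> fibre E x" "Ker_minus E x (J x) K \<subseteq> fibre E x"
      by (auto simp: Ker_plus_def Ker_minus_def)
    from this[THEN has_fibre_dim_iff[OF W]] triv_image_Ker[OF W J K]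
    show "has_fibre_dim E x (Ker_plus E x (J x) K) d \<longleftrightarrow> dim {w. (end_mat \<Phi> x (J x) + end_mat \<Phi> x K) *v w = 0} = d"
      "has_fibre_dim E x (Ker_minus E x (J x) K) d \<longleftrightarrow> dim {w. (end_mat \<Phi> x (J x) - end_mat \<Phi> x K) *v w = 0} = d"
      by simp_all
  qed
  then show ?thesis
    unfolding twistor_stratum_def stratum_def using twistor_space_iff[OF W] by auto
qed

lemma smooth_twistor_sectionD:
  assumes J: "smooth_twistor_section A E J"
  shows "J x \<in> End_fibre E x" "(W, \<Phi>) \<in> trivs E \<Longrightarrow> smooth_fun W (\<lambda>x. end_mat \<Phi> x (J x))"
proof -
  show Jx: "J x \<in> End_fibre E x" for x using J by (auto simp: smooth_twistor_section_def twistor_space_def)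
  assume W: "(W, \<Phi>) \<in> trivs E"
  have sJ: "smooth_map_on A (End_atlas A E) UNIV (\<lambda>x. (x, J x))" using J by (simp add: smooth_twistor_section_def)
  show "smooth_fun W (\<lambda>x. end_mat \<Phi> x (J x))"
  proof (rule smooth_fun_local[OF open_triv[OF W]])
    fix p assume p: "p \<in> W"
    obtain \<mu> T where T: "\<mu> \<in> End_atlas A E" "open T" "p \<in> T" "T \<subseteq> UNIV" "(\<lambda>x. (x, J x)) ` T \<subseteq> fst \<mu>"
      "smooth_fun T (\<lambda>x. snd \<mu> (x, J x))"
      by (rule smooth_map_onE[OF sJ UNIV_I])
    obtain \<kappa> V \<Psi> where k: "\<kappa> \<in> A" "(V, \<Psi>) \<in> trivs E" "\<mu> = End_chart \<kappa> V \<Psi>"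
      by (rule End_atlasE[OF T(1)])
    have TV: "T \<subseteq> V" using T(5) by (auto simp: k(3) End_chart_def)
    define N where "N = T \<inter> W"
    have N: "open N" "p \<in> N" "N \<subseteq> T" "N \<subseteq> V \<inter> W" "N \<subseteq> W \<inter> V"
      using T TV p open_triv[OF W] by (auto simp: N_def)
    have o: "open (V \<inter> W)" "open (W \<inter> V)" using open_triv[OF W] open_triv[OF k(2)] by auto
    have "smooth_fun T (\<lambda>x. snd (snd \<mu> (x, J x)))" by (rule smooth_fun_linear[OF T(2) bounded_linear_snd T(6)])
    then have "smooth_fun T (\<lambda>x. end_mat \<Psi> x (J x))" by (simp add: k(3) End_chart_def)
    then have 1: "smooth_fun N (\<lambda>x. end_mat \<Psi> x (J x))" by (rule smooth_fun_subset[OF _ T(2) N(1,3)])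
    have "smooth_fun N (\<lambda>x. trans_mat \<Psi> \<Phi> x ** end_mat \<Psi> x (J x) ** trans_mat \<Phi> \<Psi> x)"
      by (intro smooth_fun_bilinear[OF N(1) bounded_bilinear_matrix_mult] 1
          smooth_fun_subset[OF smooth_trans_mat[OF k(2) W] o(1) N(1,4)]
          smooth_fun_subset[OF smooth_trans_mat[OF W k(2)] o(2) N(1,5)])
    then have "smooth_fun N (\<lambda>x. end_mat \<Phi> x (J x))"
    proof (rule smooth_fun_cong[OF _ N(1)])
      fix x assume "x \<in> N"
      then show "trans_mat \<Psi> \<Phi> x ** end_mat \<Psi> x (J x) ** trans_mat \<Phi> \<Psi> x = end_mat \<Phi> x (J x)"
        using N(4) by (intro end_mat_change[OF k(2) W, symmetric] Jx) auto
    qed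
    with N show "\<exists>T. open T \<and> p \<in> T \<and> smooth_fun T (\<lambda>x. end_mat \<Phi> x (J x))" by blast
  qed
qed

section \<open>Tangent vectors of the endomorphism bundle\<close>

lemma End_chart_apply: "snd (End_chart \<kappa> V \<Psi>) (x, B) = (snd \<kappa> x, end_mat \<Psi> x B)"
  by (simp add: End_chart_def)

lemma End_chart_inv:
  assumes k: "\<kappa> \<in> A" "(V, \<Psi>) \<in> trivs E" and z: "z \<in> snd \<kappa> ` (fst \<kappa> \<inter> V)"
  shows "chart_inv (End_chart \<kappa> V \<Psi>) (z, M) = (chart_inv \<kappa> z, mat_end \<Psi> (chart_inv \<kappa> z) M)"
proof -
  obtain x where x: "x \<in> fst \<kappa>" "x \<in> V" "z = snd \<kappa> x" using z by blast
  have inj: "inj_on (snd (End_chart \<kappa> V \<Psi>)) (fst (End_chart \<kappa> V \<Psi>))"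
  proof (rule inj_onI)
    fix p q assume pq: "p \<in> fst (End_chart \<kappa> V \<Psi>)" "q \<in> fst (End_chart \<kappa> V \<Psi>)"
      "snd (End_chart \<kappa> V \<Psi>) p = snd (End_chart \<kappa> V \<Psi>) q"
    then have 1: "snd \<kappa> (fst p) = snd \<kappa> (fst q)" "fst p \<in> fst \<kappa>" "fst q \<in> fst \<kappa>" by (auto simp: End_chart_def)
    then have e: "fst p = fst q" using chart_inv_chart[OF k(1)] by metis
    have "snd p = snd q"
      by (rule end_mat_inject[OF k(2), of "fst p"]) (use pq e in \<open>auto simp: End_chart_def\<close>)
    with e show "p = q" by (simp add: prod_eq_iff)
  qed
  have "chart_inv (End_chart \<kappa> V \<Psi>) (snd (End_chart \<kappa> V \<Psi>) (x, mat_end \<Psi> x M)) = (x, mat_end \<Psi> x M)"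
    by (rule inv_into_f_f[OF inj]) (use x mat_end_in_End_fibre[OF k(2) x(2)] in \<open>simp add: End_chart_def\<close>)
  then show ?thesis
    using x k(1) by (simp add: End_chart_def end_mat_mat_end[OF k(2) x(2)])
qed

text \<open>In matrices, a change of bundle charts is conjugation by a transition matrix that depends smoothly on the
  base point.\<close>

lemma End_transition_differentiable:
  assumes k: "\<kappa> \<in> A" "(V, \<Psi>) \<in> trivs E" and k': "\<kappa>' \<in> A" "(V', \<Psi>') \<in> trivs E"
    and p: "p \<in> fst (End_chart \<kappa> V \<Psi>)" "p \<in> fst (End_chart \<kappa>' V' \<Psi>')"
  shows "transition (End_chart \<kappa> V \<Psi>) (End_chart \<kappa>' V' \<Psi>') differentiable (at (snd (End_chart \<kappa> V \<Psi>) p))"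
proof -
  let ?O = "fst \<kappa>' \<inter> (V \<inter> V')"
  define N where "N = snd \<kappa> ` (fst \<kappa> \<inter> ?O)"
  have oO: "open ?O" using open_triv[OF k(2)] open_triv[OF k'(2)] open_chart[OF k'(1)] by auto
  have oN: "open (N \<times> (UNIV :: (real^'k^'k) set))"
    unfolding N_def by (intro open_Times open_chart_image_Int[OF k(1) oO] open_UNIV)
  have N1: "open N" unfolding N_def by (rule open_chart_image_Int[OF k(1) oO])
  have oV: "open (V \<inter> V')" "open (V' \<inter> V)" using open_triv[OF k(2)] open_triv[OF k'(2)] by auto
  have g: "smooth_on (N \<times> UNIV) (\<lambda>q :: (complex^'d) \<times> (real^'k^'k). f (fst q))" if "smooth_on N f" for f :: "complex^'d \<Rightarrow> 'z::real_normed_vector"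
    by (rule smooth_on_compose[OF oN N1 _ that smooth_on_bounded_linear[OF oN bounded_linear_fst]]) auto
  have s1: "smooth_on N (transition \<kappa> \<kappa>')"
    by (rule smooth_on_subset[OF smooth_transition[OF k(1) k'(1)]]) (auto simp: N_def)
  have s2: "smooth_on N (\<lambda>z. trans_mat \<Psi> \<Psi>' (chart_inv \<kappa> z))"
    by (rule smooth_on_subset[OF smooth_funD[OF oV(1) smooth_trans_mat[OF k(2) k'(2)] k(1)]]) (auto simp: N_def)
  have s3: "smooth_on N (\<lambda>z. trans_mat \<Psi>' \<Psi> (chart_inv \<kappa> z))"
    by (rule smooth_on_subset[OF smooth_funD[OF oV(2) smooth_trans_mat[OF k'(2) k(2)] k(1)]]) (auto simp: N_def)
  let ?f = "\<lambda>q. (transition \<kappa> \<kappa>' (fst q),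
      trans_mat \<Psi> \<Psi>' (chart_inv \<kappa> (fst q)) ** snd q ** trans_mat \<Psi>' \<Psi> (chart_inv \<kappa> (fst q)))"
  have "smooth_on (N \<times> UNIV) ?f"
    by (intro smooth_on_Pair[OF oN] g[OF s1] smooth_on_bilinear[OF oN bounded_bilinear_matrix_mult] g[OF s2] g[OF s3]
        smooth_on_bounded_linear[OF oN bounded_linear_snd])
  then have "smooth_on (N \<times> UNIV) (transition (End_chart \<kappa> V \<Psi>) (End_chart \<kappa>' V' \<Psi>'))"
  proof (rule smooth_on_cong[OF _ oN])
    fix q assume q: "q \<in> N \<times> (UNIV :: (real^'k^'k) set)"
    obtain z M where zM: "q = (z, M)" by (cases q)
    obtain x where x: "z = snd \<kappa> x" "x \<in> fst \<kappa>" "x \<in> fst \<kappa>'" "x \<in> V" "x \<in> V'" using q by (auto simp: zM N_def)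
    have z: "z \<in> snd \<kappa> ` (fst \<kappa> \<inter> V)" using x by blast
    show "?f q = transition (End_chart \<kappa> V \<Psi>) (End_chart \<kappa>' V' \<Psi>') q"
      using x k(1) by (simp add: transition_def zM End_chart_inv[OF k z[unfolded x(1)]] End_chart_apply
          end_mat_change[OF k(2) k'(2) x(4,5) mat_end_in_End_fibre[OF k(2) x(4)]] end_mat_mat_end[OF k(2) x(4)])
  qed
  then show ?thesis
    by (rule smooth_on_differentiable) (use p in \<open>auto simp: End_chart_def N_def\<close>)
qed

text \<open>The tangent vector of \<open>End E\<close> at \<open>p\<close> with coordinates \<open>w\<close> in the chart \<open>\<nu>\<close>.\<close>

definition End_lift :: "('m \<times> ('e \<Rightarrow> 'e), (complex^'d) \<times> (real^'k^'k)) chart \<Rightarrow> 'm \<times> ('e \<Rightarrow> 'e) \<Rightarrow>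
    (complex^'d) \<times> (real^'k^'k) \<Rightarrow> ('m \<times> ('e \<Rightarrow> 'e), (complex^'d) \<times> (real^'k^'k)) tvec" where
  "End_lift \<nu> p w = (\<lambda>\<mu>. if \<mu> \<in> End_atlas A E \<and> p \<in> fst \<mu>
     then frechet_derivative (transition \<nu> \<mu>) (at (snd \<nu> p)) w else 0)"

lemma End_transition_linear:
  assumes "\<nu> \<in> End_atlas A E" "p \<in> fst \<nu>" "\<mu> \<in> End_atlas A E" "p \<in> fst \<mu>"
  shows "(transition \<nu> \<mu> has_derivative frechet_derivative (transition \<nu> \<mu>) (at (snd \<nu> p))) (at (snd \<nu> p))"
proof -
  obtain \<kappa> V \<Psi> where k: "\<kappa> \<in> A" "(V, \<Psi>) \<in> trivs E" "\<nu> = End_chart \<kappa> V \<Psi>" by (rule End_atlasE[OF assms(1)])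
  obtain \<kappa>' V' \<Psi>' where k': "\<kappa>' \<in> A" "(V', \<Psi>') \<in> trivs E" "\<mu> = End_chart \<kappa>' V' \<Psi>'" by (rule End_atlasE[OF assms(3)])
  show ?thesis
    using End_transition_differentiable[OF k(1,2) k'(1,2)] assms by (simp add: k(3) k'(3) frechet_derivative_works)
qed

lemma linear_End_lift:
  assumes "\<nu> \<in> End_atlas A E" "p \<in> fst \<nu>"
  shows "linear (End_lift \<nu> p)"
proof (rule linearI; rule ext)
  fix v w r \<mu>
  show "End_lift \<nu> p (v + w) \<mu> = (End_lift \<nu> p v + End_lift \<nu> p w) \<mu>"
    using linear_add[OF has_derivative_linear[OF End_transition_linear[OF assms, of \<mu>]]] by (simp add: End_lift_def)
  show "End_lift \<nu> p (r *\<^sub>R v) \<mu> = (r *\<^sub>R End_lift \<nu> p v) \<mu>"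
    using linear_cmul[OF has_derivative_linear[OF End_transition_linear[OF assms, of \<mu>]]] by (simp add: End_lift_def scaleR_fun_def)
qed

lemma End_lift_same_chart:
  assumes k: "\<kappa> \<in> A" "(V, \<Psi>) \<in> trivs E" and p: "p \<in> fst (End_chart \<kappa> V \<Psi>)"
  shows "End_lift (End_chart \<kappa> V \<Psi>) p w (End_chart \<kappa> V \<Psi>) = w"
proof -
  let ?\<nu> = "End_chart \<kappa> V \<Psi>"
  have oN: "open (snd \<kappa> ` (fst \<kappa> \<inter> V) \<times> (UNIV :: (real^'k^'k) set))"
    by (intro open_Times open_chart_image_Int[OF k(1) open_triv[OF k(2)]] open_UNIV)
  have "(transition ?\<nu> ?\<nu> has_derivative (\<lambda>w. w)) (at (snd ?\<nu> p))"
  proof (rule has_derivative_transform_within_open[OF has_derivative_ident oN])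
    show "snd ?\<nu> p \<in> snd \<kappa> ` (fst \<kappa> \<inter> V) \<times> UNIV" using p by (auto simp: End_chart_def)
    fix q assume q: "q \<in> snd \<kappa> ` (fst \<kappa> \<inter> V) \<times> (UNIV :: (real^'k^'k) set)"
    obtain x M where x: "q = (snd \<kappa> x, M)" "x \<in> fst \<kappa>" "x \<in> V" using q by auto
    have z: "snd \<kappa> x \<in> snd \<kappa> ` (fst \<kappa> \<inter> V)" using x by blast
    show "q = transition ?\<nu> ?\<nu> q"
      using x k(1) by (simp add: transition_def End_chart_inv[OF k z] End_chart_apply end_mat_mat_end[OF k(2) x(3)])
  qed
  from frechet_derivative_at[OF this] have "frechet_derivative (transition ?\<nu> ?\<nu>) (at (snd ?\<nu> p)) w = w" by metis
  then show ?thesis using p End_atlasI[OF k] by (simp add: End_lift_def)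
qed

text \<open>By the chain rule the velocity in one bundle chart determines that in all others. Hence spaces of
  velocities are images under \<open>End_lift\<close> of sets of coordinate vectors.\<close>

lemma End_velocity_eq_lift:
  fixes c :: "real \<Rightarrow> 'm"
  assumes cB: "smooth_map_on std_atlas (End_atlas A E) T (\<lambda>t. (c t, B t))" and T: "open T" "0 \<in> T"
    and k: "\<kappa> \<in> A" "(V, \<Psi>) \<in> trivs E" and c0: "c 0 \<in> fst \<kappa>" "c 0 \<in> V"
    and X: "((\<lambda>t. end_mat \<Psi> (c t) (B t)) has_vector_derivative X) (at 0)"
  shows "velocity (End_atlas A E) (\<lambda>t. (c t, B t)) 0 = End_lift (End_chart \<kappa> V \<Psi>) (c 0, B 0) (velocity A c 0 \<kappa>, X)"
proof
  fix \<mu>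
  let ?\<nu> = "End_chart \<kappa> V \<Psi>" and ?v = "velocity A c 0 \<kappa>"
  note B = End_curveD(1)[OF cB T(1)]
  note c = End_curveD(2)[OF cB T(1)]
  show "velocity (End_atlas A E) (\<lambda>t. (c t, B t)) 0 \<mu> = End_lift ?\<nu> (c 0, B 0) (?v, X) \<mu>"
  proof (cases "\<mu> \<in> End_atlas A E \<and> (c 0, B 0) \<in> fst \<mu>")
    case True
    obtain \<kappa>' V' \<Psi>' where k': "\<kappa>' \<in> A" "(V', \<Psi>') \<in> trivs E" "\<mu> = End_chart \<kappa>' V' \<Psi>'"
      using End_atlasE True by metis
    have c0': "c 0 \<in> fst \<kappa>'" "c 0 \<in> V'" using True by (auto simp: k'(3) End_chart_def)
    have "((\<lambda>t. snd \<kappa> (c t)) has_vector_derivative ?v) (at 0)"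
    proof -
      note d = velocity_eq_lift(2)[OF c T(2) k(1) c0(1) open_chart[OF k(1)] smooth_fun_chart[OF k(1) open_chart[OF k(1)] order_refl] c0(1)]
      from vector_derivative_at[OF d] have "?v = frechet_derivative (\<lambda>z. snd \<kappa> (chart_inv \<kappa> z)) (at (snd \<kappa> (c 0))) ?v"
        using k(1) c0(1) by (simp add: velocity_def o_def)
      with d show ?thesis by simp
    qed
    from has_vector_derivative_Pair[OF this X]
    have dv: "((\<lambda>t. snd ?\<nu> (c t, B t)) has_vector_derivative (?v, X)) (at 0)" by (simp add: End_chart_def)
    have D: "(transition ?\<nu> \<mu> has_derivative frechet_derivative (transition ?\<nu> \<mu>) (at (snd ?\<nu> (c 0, B 0)))) (at (snd ?\<nu> (c 0, B 0)))"
      using True k c0 B[OF T(2)] by (intro End_transition_linear End_atlasI) (auto simp: End_chart_def)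
    have "((\<lambda>t. transition ?\<nu> \<mu> (snd ?\<nu> (c t, B t))) has_derivative
        (\<lambda>r. frechet_derivative (transition ?\<nu> \<mu>) (at (snd ?\<nu> (c 0, B 0))) (r *\<^sub>R (?v, X)))) (at 0)"
      using has_derivative_compose[OF dv[unfolded has_vector_derivative_def] D] .
    then have 1: "((\<lambda>t. transition ?\<nu> \<mu> (snd ?\<nu> (c t, B t))) has_vector_derivative
        frechet_derivative (transition ?\<nu> \<mu>) (at (snd ?\<nu> (c 0, B 0))) (?v, X)) (at 0)"
      unfolding has_vector_derivative_def linear_cmul[OF has_derivative_linear[OF D]] .
    obtain M where M: "open M" "0 \<in> M" "M \<subseteq> T" "c ` M \<subseteq> fst \<kappa> \<inter> V"
    proof -
      have "open (fst \<kappa> \<inter> V)" "c 0 \<in> fst \<kappa> \<inter> V" using c0 open_chart[OF k(1)] open_triv[OF k(2)] by auto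
      from smooth_curve_eventually[OF c T(2) this] show ?thesis using that by metis
    qed
    have "((\<lambda>t. snd \<mu> (c t, B t)) has_vector_derivative
        frechet_derivative (transition ?\<nu> \<mu>) (at (snd ?\<nu> (c 0, B 0))) (?v, X)) (at 0)"
    proof (rule has_vector_derivative_transform_within_open[OF 1 M(1,2)])
      fix t assume t: "t \<in> M"
      have x: "c t \<in> fst \<kappa>" "c t \<in> V" "B t \<in> End_fibre E (c t)" using M t B by auto
      have z: "snd \<kappa> (c t) \<in> snd \<kappa> ` (fst \<kappa> \<inter> V)" using x by blast
      have "chart_inv ?\<nu> (snd ?\<nu> (c t, B t)) = (c t, B t)"
        using x k(1) by (simp add: End_chart_apply End_chart_inv[OF k z] mat_end_end_mat[OF k(2) x(2,3)])
      then show "transition ?\<nu> \<mu> (snd ?\<nu> (c t, B t)) = snd \<mu> (c t, B t)" by (simp add: transition_def)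
    qed
    from vector_derivative_at[OF this] show ?thesis
      using True by (simp add: velocity_def End_lift_def o_def)
  next
    case False
    then show ?thesis by (auto simp: velocity_def End_lift_def)
  qed
qed

end

section \<open>The connection matrix\<close>

locale bundle_connection = complex_bundle A E
  for A :: "('m::{t2_space, second_countable_topology}, complex^'d) chart set"
    and E :: "('m, 'e, 'k::finite) vbundle" +
  fixes nab :: "('m, 'd, 'e) conn"
  assumes connection: "connection A E nab"
begin

lemma nab_axioms:
  assumes "open U" "x \<in> U" "smooth_section A E U s"
  shows nab_in_fibre: "v \<in> tangent_space A x \<Longrightarrow> nab x v s \<in> fibre E x"
    and nab_add_direction: "v \<in> tangent_space A x \<Longrightarrow> w \<in> tangent_space A x \<Longrightarrow>
      nab x (v + w) s = vadd E (nab x v s) (nab x w s)"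
    and nab_scale_direction: "v \<in> tangent_space A x \<Longrightarrow> nab x (r *\<^sub>R v) s = vscale E r (nab x v s)"
    and nab_cong: "smooth_section A E U s' \<Longrightarrow> v \<in> tangent_space A x \<Longrightarrow> (\<And>y. y \<in> U \<Longrightarrow> s y = s' y) \<Longrightarrow>
      nab x v s = nab x v s'"
    and nab_add: "smooth_section A E U s' \<Longrightarrow> v \<in> tangent_space A x \<Longrightarrow>
      nab x v (\<lambda>y. vadd E (s y) (s' y)) = vadd E (nab x v s) (nab x v s')"
    and nab_Leibniz: "smooth_fun U f \<Longrightarrow> v \<in> tangent_space A x \<Longrightarrow> \<kappa> \<in> A \<Longrightarrow> x \<in> fst \<kappa> \<Longrightarrow>
      nab x v (\<lambda>y. vscale E (f y) (s y)) =
        vadd E (vscale E (dir_deriv \<kappa> x v f) (s x)) (vscale E (f x) (nab x v s))"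
proof -
  note ax = connection[unfolded connection_def, THEN conjunct1, THEN spec, THEN spec, THEN spec,
      THEN mp, OF conjI[OF assms(1) conjI[OF assms(2,3)]]]
  note c1 = ax[THEN conjunct1] and r1 = ax[THEN conjunct2]
  note c2 = r1[THEN conjunct1] and r2 = r1[THEN conjunct2]
  note c3 = r2[THEN conjunct1] and r3 = r2[THEN conjunct2]
  note c4 = r3[THEN conjunct1] and c5 = r3[THEN conjunct2]
  show "v \<in> tangent_space A x \<Longrightarrow> nab x v s \<in> fibre E x" using c1 by blast
  show "v \<in> tangent_space A x \<Longrightarrow> w \<in> tangent_space A x \<Longrightarrow>
      nab x (v + w) s = vadd E (nab x v s) (nab x w s)" using c2 by blast
  show "v \<in> tangent_space A x \<Longrightarrow> nab x (r *\<^sub>R v) s = vscale E r (nab x v s)" using c3 by blast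
  show "smooth_section A E U s' \<Longrightarrow> v \<in> tangent_space A x \<Longrightarrow> (\<And>y. y \<in> U \<Longrightarrow> s y = s' y) \<Longrightarrow>
      nab x v s = nab x v s'"
    using c4[THEN spec, THEN mp, THEN bspec, THEN conjunct1, THEN mp] by blast
  show "smooth_section A E U s' \<Longrightarrow> v \<in> tangent_space A x \<Longrightarrow>
      nab x v (\<lambda>y. vadd E (s y) (s' y)) = vadd E (nab x v s) (nab x v s')"
    using c4[THEN spec, THEN mp, THEN bspec, THEN conjunct2] .
  show "smooth_fun U f \<Longrightarrow> v \<in> tangent_space A x \<Longrightarrow> \<kappa> \<in> A \<Longrightarrow> x \<in> fst \<kappa> \<Longrightarrow>
      nab x v (\<lambda>y. vscale E (f y) (s y)) =
        vadd E (vscale E (dir_deriv \<kappa> x v f) (s x)) (vscale E (f x) (nab x v s))"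
    using c5[THEN spec, THEN mp, THEN bspec, THEN bspec, THEN mp] .
qed

lemma nab_smooth:
  assumes "open U" "smooth_section A E U s" "smooth_vector_field A U X"
  shows "smooth_section A E U (\<lambda>x. nab x (X x) s)"
  using connection[unfolded connection_def, THEN conjunct2, THEN spec, THEN spec, THEN spec,
      THEN mp, OF conjI[OF assms(1) conjI[OF assms(2,3)]]] .

lemma smooth_section_subset:
  assumes "smooth_section A E S s" "open S" "open N" "N \<subseteq> S"
  shows "smooth_section A E N s"
proof (rule smooth_sectionI[OF assms(3)])
  show "s x \<in> fibre E x" if "x \<in> N" for x using assms(1,4) that by (auto simp: smooth_section_def)
  fix p assume "p \<in> N"
  obtain W \<Phi> where W: "(W, \<Phi>) \<in> trivs E" "p \<in> W" by (rule triv_at)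
  have "smooth_fun (N \<inter> W) (\<lambda>x. \<Phi> (s x))"
    by (rule smooth_fun_subset[OF smooth_sectionD[OF assms(2,1) W(1)]])
      (use assms open_triv[OF W(1)] in auto)
  with W show "\<exists>W \<Phi>. (W, \<Phi>) \<in> trivs E \<and> p \<in> W \<and> smooth_fun (N \<inter> W) (\<lambda>x. \<Phi> (s x))" by blast
qed

lemma smooth_section_cong:
  assumes "smooth_section A E S s" "open S" "\<And>y. y \<in> S \<Longrightarrow> s y = s' y"
  shows "smooth_section A E S s'"
proof (rule smooth_sectionI[OF assms(2)])
  show "s' x \<in> fibre E x" if "x \<in> S" for x
    using assms(1,3) that by (metis smooth_section_def)
  fix p assume "p \<in> S"
  obtain W \<Phi> where W: "(W, \<Phi>) \<in> trivs E" "p \<in> W" by (rule triv_at)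
  have "open (S \<inter> W)" using assms(2) open_triv[OF W(1)] by auto
  then have "smooth_fun (S \<inter> W) (\<lambda>x. \<Phi> (s' x))"
    by (rule smooth_fun_cong[OF smooth_sectionD[OF assms(2,1) W(1)]]) (simp add: assms(3))
  with W show "\<exists>W \<Phi>. (W, \<Phi>) \<in> trivs E \<and> p \<in> W \<and> smooth_fun (S \<inter> W) (\<lambda>x. \<Phi> (s' x))" by blast
qed

abbreviation frame :: "('e \<Rightarrow> real^'k) \<Rightarrow> 'k \<Rightarrow> 'm \<Rightarrow> 'e" where
  "frame \<Phi> b \<equiv> \<lambda>y. triv_inv E \<Phi> y (axis b 1)"

definition conn_mat :: "('e \<Rightarrow> real^'k) \<Rightarrow> 'm \<Rightarrow> ('m, complex^'d) tvec \<Rightarrow> real^'k^'k" where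
  "conn_mat \<Phi> x v = (\<chi> a b. \<Phi> (nab x v (frame \<Phi> b)) $ a)"

lemma conn_mat_apply: "conn_mat \<Phi> x v *v w = (\<Sum>b\<in>UNIV. (w $ b) *\<^sub>R \<Phi> (nab x v (frame \<Phi> b)))"
  by (simp add: conn_mat_def matrix_vector_mult_def vec_eq_iff mult.commute)

lemma conn_mat_frame: "conn_mat \<Phi> x v *v axis b 1 = \<Phi> (nab x v (frame \<Phi> b))"
  by (simp add: conn_mat_apply axis_def if_distrib[of "\<lambda>r. r *\<^sub>R _"] cong: if_cong)

lemma smooth_frame:
  assumes "(W, \<Phi>) \<in> trivs E" "open N" "N \<subseteq> W"
  shows "smooth_section A E N (frame \<Phi> b)"
  by (rule smooth_section_triv_inv[OF assms smooth_fun_const[OF assms(2)]])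

text \<open>Write \<open>s\<close> as a sum of the frame sections with smooth coefficients, and use additivity and the Leibniz
  rule. The induction runs over subsets of the frame and starts from the zero section \<open>z\<close>, whose covariant
  derivative vanishes because \<open>z + z = z\<close>.\<close>

lemma nab_local:
  assumes W: "(W, \<Phi>) \<in> trivs E" "x \<in> W" and S: "open S" "smooth_section A E S s" "x \<in> S"
    and v: "v \<in> tangent_space A x" and k: "\<kappa> \<in> A" "x \<in> fst \<kappa>"
  shows "\<Phi> (nab x v s) = frechet_derivative (\<lambda>z. \<Phi> (s (chart_inv \<kappa> z))) (at (snd \<kappa> x)) (v \<kappa>) + conn_mat \<Phi> x v *v \<Phi> (s x)"
proof -
  define N where "N = S \<inter> W"
  have N: "open N" "x \<in> N" "N \<subseteq> W" "N \<subseteq> S" using S W open_triv[OF W(1)] by (auto simp: N_def)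
  have sN: "smooth_section A E N s" by (rule smooth_section_subset[OF S(2,1) N(1,4)])
  have s_fib: "s y \<in> fibre E y" if "y \<in> N" for y using sN that by (simp add: smooth_section_def)
  define f where "f b y = \<Phi> (s y) $ b" for b y
  have sf: "smooth_fun N (\<lambda>y. \<Phi> (s y))" using smooth_sectionD[OF S(1,2) W(1)] by (simp add: N_def)
  have f: "smooth_fun N (f b)" for b
    unfolding f_def by (rule smooth_fun_linear[OF N(1) bounded_linear_vec_nth sf])
  define g where "g F y = (\<Sum>b\<in>F. f b y *\<^sub>R axis b (1::real))" for F y
  have g: "smooth_fun N (g F)" for F
    unfolding g_def by (intro smooth_fun_sum[OF N(1)] smooth_fun_linear[OF N(1) bounded_linear_scaleR_left f])
  define sF where "sF F = (\<lambda>y. triv_inv E \<Phi> y (g F y))" for F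
  have sF: "smooth_section A E N (sF F)" for F
    unfolding sF_def by (rule smooth_section_triv_inv[OF W(1) N(1,3) g])
  have e: "smooth_section A E N (frame \<Phi> b)" for b by (rule smooth_frame[OF W(1) N(1,3)])
  have fe: "smooth_section A E N (\<lambda>y. triv_inv E \<Phi> y (f b y *\<^sub>R axis b 1))" for b
    by (rule smooth_section_triv_inv[OF W(1) N(1,3) smooth_fun_linear[OF N(1) bounded_linear_scaleR_left f]])
  note nab_fib = nab_in_fibre[OF N(1,2) _ v]
  have sums: "\<Phi> (nab x v (sF F)) = (\<Sum>b\<in>F. dir_deriv \<kappa> x v (f b) *\<^sub>R axis b 1 + f b x *\<^sub>R \<Phi> (nab x v (frame \<Phi> b)))"
    if "finite F" for F
    using that
  proof induction
    case empty
    have z: "sF {} y = vadd E (sF {} y) (sF {} y)" if "y \<in> N" for y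
    proof -
      have y: "y \<in> W" using that N by blast
      show ?thesis
        unfolding sF_def g_def by (simp add: triv_inv_add[OF W(1) y, symmetric])
    qed
    have "nab x v (sF {}) = nab x v (\<lambda>y. vadd E (sF {} y) (sF {} y))"
      by (rule nab_cong[OF N(1,2) sF smooth_section_cong[OF sF N(1) z] v z])
    also have "\<dots> = vadd E (nab x v (sF {})) (nab x v (sF {}))"
      by (rule nab_add[OF N(1,2) sF sF v])
    finally have "\<Phi> (nab x v (sF {})) = \<Phi> (nab x v (sF {})) + \<Phi> (nab x v (sF {}))"
      using triv_vadd(2)[OF W nab_fib[OF sF] nab_fib[OF sF], of "{}" "{}"] by simp
    then show ?case by simp
  next
    case (insert b F)
    let ?t = "\<lambda>y. vscale E (f b y) (frame \<Phi> b y)"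
    have t_eq: "triv_inv E \<Phi> y (f b y *\<^sub>R axis b 1) = ?t y" if "y \<in> N" for y
      using that N by (intro triv_inv_scale[OF W(1)]) auto
    have t: "smooth_section A E N ?t" by (rule smooth_section_cong[OF fe N(1) t_eq])
    have eq: "sF (insert b F) y = vadd E (?t y) (sF F y)" if y: "y \<in> N" for y
    proof -
      have yW: "y \<in> W" using y N by blast
      show ?thesis
        using insert.hyps by (simp add: sF_def g_def triv_inv_add[OF W(1) yW] t_eq[OF y])
    qed
    have "nab x v (sF (insert b F)) = nab x v (\<lambda>y. vadd E (?t y) (sF F y))"
      by (rule nab_cong[OF N(1,2) sF smooth_section_cong[OF sF N(1) eq] v eq])
    also have "\<dots> = vadd E (nab x v ?t) (nab x v (sF F))" by (rule nab_add[OF N(1,2) t sF v])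
    finally have 1: "\<Phi> (nab x v (sF (insert b F))) = \<Phi> (nab x v ?t) + \<Phi> (nab x v (sF F))"
      using triv_vadd(2)[OF W nab_fib[OF t] nab_fib[OF sF]] by simp
    have "nab x v ?t = vadd E (vscale E (dir_deriv \<kappa> x v (f b)) (frame \<Phi> b x)) (vscale E (f b x) (nab x v (frame \<Phi> b)))"
      by (rule nab_Leibniz[OF N(1,2) e f v k])
    then have "\<Phi> (nab x v ?t) = dir_deriv \<kappa> x v (f b) *\<^sub>R axis b 1 + f b x *\<^sub>R \<Phi> (nab x v (frame \<Phi> b))"
      by (simp add: triv_vadd[OF W] triv_vscale[OF W] triv_inv_in_fibre[OF W] nab_fib[OF e] triv_triv_inv[OF W])
    with 1 insert show ?case by simp
  qed
  have basis: "(\<Sum>b\<in>UNIV. (w $ b) *\<^sub>R axis b (1::real)) = w" for w :: "real^'k"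
    using basis_expansion[of w] by (simp add: scalar_mult_eq_scaleR)
  have "sF UNIV y = s y" if "y \<in> N" for y
    using that N s_fib triv_inv_triv[OF W(1)] by (auto simp: sF_def g_def f_def basis)
  then have nabs: "nab x v s = nab x v (sF UNIV)"
    by (intro nab_cong[OF N(1,2) sN sF v]) auto
  let ?D = "frechet_derivative (\<lambda>z. \<Phi> (s (chart_inv \<kappa> z))) (at (snd \<kappa> x)) (v \<kappa>)"
  have "dir_deriv \<kappa> x v (f b) = ?D $ b" for b
  proof -
    have "((\<lambda>z. \<Phi> (s (chart_inv \<kappa> z))) has_derivative frechet_derivative (\<lambda>z. \<Phi> (s (chart_inv \<kappa> z))) (at (snd \<kappa> x))) (at (snd \<kappa> x))"
      by (rule smooth_fun_has_derivative[OF N(1) sf k N(2)])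
    from bounded_linear.has_derivative[OF bounded_linear_vec_nth[of b] this] frechet_derivative_at
    have "(\<lambda>w. frechet_derivative (\<lambda>z. \<Phi> (s (chart_inv \<kappa> z))) (at (snd \<kappa> x)) w $ b)
        = frechet_derivative (\<lambda>z. \<Phi> (s (chart_inv \<kappa> z)) $ b) (at (snd \<kappa> x))" by blast
    then show ?thesis by (simp add: dir_deriv_def f_def o_def fun_eq_iff)
  qed
  then show ?thesis
    unfolding nabs sums[OF finite] by (simp add: sum.distrib basis conn_mat_apply f_def)
qed

text \<open>The special case that is used below: the coordinates of \<open>s\<close> are a smooth matrix times a constant vector.\<close>

lemma nab_local_matrix:
  fixes P :: "'m \<Rightarrow> real^'k^'k"
  assumes W: "(W, \<Phi>) \<in> trivs E" and N: "open N" "x \<in> N" "N \<subseteq> W" and P: "smooth_fun N P"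
    and s: "\<And>y. y \<in> N \<Longrightarrow> s y \<in> fibre E y" "\<And>y. y \<in> N \<Longrightarrow> \<Phi> (s y) = P y *v w"
    and v: "v \<in> tangent_space A x" and k: "\<kappa> \<in> A" "x \<in> fst \<kappa>"
  shows "smooth_section A E N s"
    and "\<Phi> (nab x v s) = frechet_derivative (\<lambda>z. P (chart_inv \<kappa> z)) (at (snd \<kappa> x)) (v \<kappa>) *v w + conn_mat \<Phi> x v *v (P x *v w)"
proof -
  let ?D = "frechet_derivative (\<lambda>z. P (chart_inv \<kappa> z)) (at (snd \<kappa> x))"
  have bl: "bounded_linear (\<lambda>a::real^'k^'k. a *v w)"
    by (rule bounded_bilinear.bounded_linear_left[OF bounded_bilinear_matrix_vector])
  show sm: "smooth_section A E N s"
  proof (rule smooth_section_cong[OF smooth_section_triv_inv[OF W N(1,3) smooth_fun_linear[OF N(1) bl P]] N(1)])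
    fix y assume y: "y \<in> N"
    then have "triv_inv E \<Phi> y (\<Phi> (s y)) = s y" using N(3) s(1) by (intro triv_inv_triv[OF W]) auto
    then show "triv_inv E \<Phi> y (P y *v w) = s y" using s(2)[OF y] by simp
  qed
  have "((\<lambda>z. P (chart_inv \<kappa> z) *v w) has_derivative (\<lambda>h. ?D h *v w)) (at (snd \<kappa> x))"
    by (rule bounded_linear.has_derivative[OF bl smooth_fun_has_derivative[OF N(1) P k N(2)]])
  then have "((\<lambda>z. \<Phi> (s (chart_inv \<kappa> z))) has_derivative (\<lambda>h. ?D h *v w)) (at (snd \<kappa> x))"
    by (rule has_derivative_transform_within_open[OF _ open_chart_image_Int[OF k(1) N(1)]])
      (use k N(2) s(2) in auto)
  from frechet_derivative_at[OF this]
  have "frechet_derivative (\<lambda>z. \<Phi> (s (chart_inv \<kappa> z))) (at (snd \<kappa> x)) (v \<kappa>) = ?D (v \<kappa>) *v w" by (simp add: fun_eq_iff)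
  then show "\<Phi> (nab x v s) = ?D (v \<kappa>) *v w + conn_mat \<Phi> x v *v (P x *v w)"
    using nab_local[OF W _ N(1) sm N(2) v k] N(2,3) s(2)[OF N(2)] by auto
qed

lemma conn_mat_linear:
  assumes W: "(W, \<Phi>) \<in> trivs E" "x \<in> W" and k: "\<kappa> \<in> A" "x \<in> fst \<kappa>"
  shows "linear (\<lambda>w. conn_mat \<Phi> x (lift \<kappa> x w))"
proof (rule linearI)
  note f = smooth_frame[OF W(1) open_triv[OF W(1)] order_refl]
  note t = lift_in_tangent_space[OF k]
  note fib = nab_in_fibre[OF open_triv[OF W(1)] W(2) f t]
  show "conn_mat \<Phi> x (lift \<kappa> x (v + w)) = conn_mat \<Phi> x (lift \<kappa> x v) + conn_mat \<Phi> x (lift \<kappa> x w)" for v w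
    by (simp add: conn_mat_def vec_eq_iff lift_add[OF k] nab_add_direction[OF open_triv[OF W(1)] W(2) f t t]
        triv_vadd[OF W fib fib])
  show "conn_mat \<Phi> x (lift \<kappa> x (r *\<^sub>R w)) = r *\<^sub>R conn_mat \<Phi> x (lift \<kappa> x w)" for r w
    by (simp add: conn_mat_def vec_eq_iff lift_scaleR[OF k] nab_scale_direction[OF open_triv[OF W(1)] W(2) f t]
        triv_vscale[OF W fib])
qed

text \<open>The columns are the coordinates of the covariant derivatives of the frame along a coordinate vector field.\<close>

lemma smooth_conn_mat:
  assumes W: "(W, \<Phi>) \<in> trivs E" and k: "\<kappa> \<in> A"
  shows "smooth_fun (W \<inter> fst \<kappa>) (\<lambda>x. conn_mat \<Phi> x (lift \<kappa> x w))"
proof -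
  let ?N = "W \<inter> fst \<kappa>"
  have N: "open ?N" using open_triv[OF W] open_chart[OF k] by auto
  have "smooth_fun ?N (\<lambda>x. \<Phi> (nab x (lift \<kappa> x w) (frame \<Phi> b)))" for b
  proof -
    have "smooth_section A E ?N (\<lambda>x. nab x (lift \<kappa> x w) (frame \<Phi> b))"
      by (intro nab_smooth[OF N] smooth_frame[OF W N] smooth_vector_field_lift[OF k N]) auto
    from smooth_sectionD[OF N this W] show ?thesis by (simp add: Int_absorb2 Int_commute inf.absorb1)
  qed
  then have "smooth_fun ?N (\<lambda>x. \<Phi> (nab x (lift \<kappa> x w) (frame \<Phi> b)) $ a)" for a b
    by (rule smooth_fun_linear[OF N bounded_linear_vec_nth])
  then have "smooth_fun ?N (\<lambda>x. conn_mat \<Phi> x (lift \<kappa> x w) $ a $ b)" for a b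
    by (simp add: conn_mat_def)
  then show ?thesis by (intro smooth_fun_vec N)
qed

lemma matrix_eq_on_axis:
  fixes P Q :: "real^'p^'q"
  assumes "\<And>b. P *v axis b 1 = Q *v axis b 1"
  shows "P = Q"
  using assms by (simp add: matrix_vector_mult_basis column_def vec_eq_iff)

text \<open>The gauge transformation of the connection matrix. With the transition matrix \<open>g\<close>, the covariant derivatives of the
  frame sections of \<open>\<Phi>\<close> have the coordinates \<open>g \<omega>\<^sub>\<Phi>\<close> in \<open>\<Psi>\<close> when computed in \<open>\<Phi>\<close>, and \<open>dg + \<omega>\<^sub>\<Psi> g\<close> when computed in \<open>\<Psi>\<close>.\<close>

lemma conn_mat_change:
  assumes W: "(W, \<Phi>) \<in> trivs E" "x \<in> W" and V: "(V, \<Psi>) \<in> trivs E" "x \<in> V"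
    and v: "v \<in> tangent_space A x" and k: "\<kappa> \<in> A" "x \<in> fst \<kappa>"
  shows "frechet_derivative (\<lambda>z. trans_mat \<Phi> \<Psi> (chart_inv \<kappa> z)) (at (snd \<kappa> x)) (v \<kappa>) =
    trans_mat \<Phi> \<Psi> x ** conn_mat \<Phi> x v - conn_mat \<Psi> x v ** trans_mat \<Phi> \<Psi> x"
proof -
  let ?D = "frechet_derivative (\<lambda>z. trans_mat \<Phi> \<Psi> (chart_inv \<kappa> z)) (at (snd \<kappa> x))"
  define N where "N = W \<inter> V"
  have N: "open N" "N \<subseteq> W" "x \<in> N" "x \<in> V" "N \<subseteq> V" using W V open_triv[OF W(1)] open_triv[OF V(1)] by (auto simp: N_def)
  have sm: "smooth_fun N (trans_mat \<Phi> \<Psi>)" unfolding N_def by (rule smooth_trans_mat[OF W(1) V(1)])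
  have "?D (v \<kappa>) *v axis b 1 = (trans_mat \<Phi> \<Psi> x ** conn_mat \<Phi> x v - conn_mat \<Psi> x v ** trans_mat \<Phi> \<Psi> x) *v axis b 1" for b
  proof -
    have fr: "frame \<Phi> b y \<in> fibre E y" "\<Psi> (frame \<Phi> b y) = trans_mat \<Phi> \<Psi> y *v axis b 1" if "y \<in> N" for y
    proof -
      have y: "y \<in> W" "y \<in> V" using that N by auto
      show "frame \<Phi> b y \<in> fibre E y" by (rule triv_inv_in_fibre[OF W(1) y(1)])
      from trans_mat_apply[OF W(1) V(1) y this] show "\<Psi> (frame \<Phi> b y) = trans_mat \<Phi> \<Psi> y *v axis b 1"
        by (simp add: triv_triv_inv[OF W(1) y(1)])
    qed
    have "\<Psi> (nab x v (frame \<Phi> b)) = ?D (v \<kappa>) *v axis b 1 + conn_mat \<Psi> x v *v (trans_mat \<Phi> \<Psi> x *v axis b 1)"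
      by (rule nab_local_matrix(2)[OF V(1) N(1,3,5) sm fr v k])
    also have "\<Psi> (nab x v (frame \<Phi> b)) = trans_mat \<Phi> \<Psi> x *v (conn_mat \<Phi> x v *v axis b 1)"
      unfolding conn_mat_frame
      by (rule trans_mat_apply[OF W(1) V(1) W(2) V(2) nab_in_fibre[OF N(1,3) smooth_frame[OF W(1) N(1,2)] v], symmetric])
    finally show ?thesis
      by (simp add: matrix_vector_mult_diff_rdistrib matrix_vector_mul_assoc[symmetric])
  qed
  then show ?thesis by (rule matrix_eq_on_axis)
qed

end

context bundle_connection
begin

text \<open>The coordinate form \<open>dj(v) = j \<omega>(v) - \<omega>(v) j\<close> of \<open>\<nabla>J = 0\<close>. It is read off from \<open>\<nabla>\<^sub>v (J e) = J \<nabla>\<^sub>v e\<close> for the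
  frame sections \<open>e\<close>.\<close>

lemma parallel_section_deriv:
  assumes J: "smooth_twistor_section A E J" "parallel_section A E nab J"
    and W: "(W, \<Phi>) \<in> trivs E" "x \<in> W" and v: "v \<in> tangent_space A x" and k: "\<kappa> \<in> A" "x \<in> fst \<kappa>"
  shows "frechet_derivative (\<lambda>z. end_mat \<Phi> (chart_inv \<kappa> z) (J (chart_inv \<kappa> z))) (at (snd \<kappa> x)) (v \<kappa>) =
    end_mat \<Phi> x (J x) ** conn_mat \<Phi> x v - conn_mat \<Phi> x v ** end_mat \<Phi> x (J x)"
proof -
  let ?j = "\<lambda>x. end_mat \<Phi> x (J x)"
  let ?D = "frechet_derivative (\<lambda>z. ?j (chart_inv \<kappa> z)) (at (snd \<kappa> x))"
  note oW = open_triv[OF W(1)]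
  note Jx = smooth_twistor_sectionD(1)[OF J(1)] and sj = smooth_twistor_sectionD(2)[OF J(1) W(1)]
  have "?D (v \<kappa>) *v axis b 1 = (?j x ** conn_mat \<Phi> x v - conn_mat \<Phi> x v ** ?j x) *v axis b 1" for b
  proof -
    let ?s = "\<lambda>y. J y (frame \<Phi> b y)"
    note f = smooth_frame[OF W(1) oW order_refl, of b]
    have s: "?s y \<in> fibre E y" "\<Phi> (?s y) = ?j y *v axis b 1" if "y \<in> W" for y
      using end_mat_apply[OF W(1) that Jx triv_inv_in_fibre[OF W(1) that], of "axis b 1"]
        End_fibreD[OF Jx triv_inv_in_fibre[OF W(1) that]] by (simp_all add: triv_triv_inv[OF W(1) that])
    have "nab x v ?s = J x (nab x v (frame \<Phi> b))"
      using J(2) oW f W(2) v unfolding parallel_section_def by blast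
    then have "\<Phi> (nab x v ?s) = ?j x *v (conn_mat \<Phi> x v *v axis b 1)"
      using end_mat_apply[OF W Jx nab_in_fibre[OF oW W(2) f v]] by (simp add: conn_mat_frame)
    moreover have "\<Phi> (nab x v ?s) = ?D (v \<kappa>) *v axis b 1 + conn_mat \<Phi> x v *v (?j x *v axis b 1)"
      by (rule nab_local_matrix(2)[OF W(1) oW W(2) order_refl sj s v k])
    ultimately show ?thesis
      by (simp add: matrix_vector_mult_diff_rdistrib matrix_vector_mul_assoc[symmetric] algebra_simps)
  qed
  then show ?thesis by (rule matrix_eq_on_axis)
qed

section \<open>Parallel curves\<close>

lemma cov_along_eq:
  "cov_along A E nab \<Phi> c s t = triv_inv E \<Phi> (c t)
     (vector_derivative (\<lambda>r. \<Phi> (s r)) (at t) + conn_mat \<Phi> (c t) (velocity A c t) *v \<Phi> (s t))"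
  by (simp add: cov_along_def conn_mat_apply)

lemma velocity_in_tangent_space:
  fixes c :: "real \<Rightarrow> 'm"
  assumes "smooth_map_on std_atlas A T c" "t \<in> T"
  shows "velocity A c t \<in> tangent_space A (c t)"
proof -
  obtain \<kappa> where k: "\<kappa> \<in> A" "c t \<in> fst \<kappa>" by (rule chart_at)
  show ?thesis
    by (subst velocity_eq_lift(1)[OF assms k]) (rule lift_in_tangent_space[OF k])
qed

text \<open>The derivatives of the test section on the two sides of \<open>\<nabla>(B s) = B \<nabla>s\<close> cancel, so only its value at \<open>0\<close>
  remains, and this can be any vector.\<close>

lemma parallel_along_deriv:
  fixes c :: "real \<Rightarrow> 'm"
  assumes par: "parallel_along A E nab {-\<epsilon><..<\<epsilon>} c B" and e: "\<epsilon> > 0"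
    and W: "(W, \<Phi>) \<in> trivs E" "c 0 \<in> W"
  defines "\<omega> \<equiv> conn_mat \<Phi> (c 0) (velocity A c 0)"
  shows "((\<lambda>t. end_mat \<Phi> (c t) (B t)) has_vector_derivative
    (end_mat \<Phi> (c 0) (B 0) ** \<omega> - \<omega> ** end_mat \<Phi> (c 0) (B 0))) (at 0)"
proof -
  let ?T = "{-\<epsilon><..<\<epsilon>}" and ?m = "\<lambda>t. end_mat \<Phi> (c t) (B t)"
  have cB: "smooth_map_on std_atlas (End_atlas A E) ?T (\<lambda>t. (c t, B t))"
    using par by (simp add: parallel_along_def)
  have T: "open ?T" "0 \<in> ?T" using e by auto
  note B = End_curveD(1)[OF cB T(1)] and c = End_curveD(2)[OF cB T(1)]
  obtain M where M: "open M" "0 \<in> M" "M \<subseteq> ?T" "c ` M \<subseteq> W"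
    by (rule smooth_curve_eventually[OF c T(2) open_triv[OF W(1)] W(2)])
  have "smooth_on M ?m" by (rule End_curveD(3)[OF cB T(1) W(1) M(1,3,4)])
  from smooth_on_differentiable[OF this M(2)]
  obtain m' where m': "(?m has_vector_derivative m') (at 0)"
    by (auto simp: differentiable_iff_scaleR has_vector_derivative_def)
  have "m' *v w = (?m 0 ** \<omega> - \<omega> ** ?m 0) *v w" for w
  proof -
    obtain s where s: "smooth_map_on std_atlas (total_atlas A E) ?T s"
      "\<And>t. t \<in> ?T \<Longrightarrow> s t \<in> fibre E (c t)" "\<Phi> (s 0) = w"
      using section_along_with_value[OF c e W, of w] by metis
    obtain \<sigma> where \<sigma>: "((\<lambda>r. \<Phi> (s r)) has_vector_derivative \<sigma>) (at 0)"
      using section_along_differentiable[OF s(1,2) c T(2) W]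
      by (auto simp: differentiable_iff_scaleR has_vector_derivative_def)
    have ms: "\<Phi> (B r (s r)) = ?m r *v \<Phi> (s r)" if "r \<in> M" for r
      using end_mat_apply[OF W(1) _ B s(2)] that M by (metis image_subset_iff subsetD)
    have "((\<lambda>r. ?m r *v \<Phi> (s r)) has_vector_derivative (?m 0 *v \<sigma> + m' *v w)) (at 0)"
      using bounded_bilinear.has_vector_derivative[OF bounded_bilinear_matrix_vector m' \<sigma>] by (simp add: s(3))
    then have "((\<lambda>r. \<Phi> (B r (s r))) has_vector_derivative (?m 0 *v \<sigma> + m' *v w)) (at 0)"
      by (rule has_vector_derivative_transform_within_open[OF _ M(1,2)]) (simp add: ms)
    then have vd: "vector_derivative (\<lambda>r. \<Phi> (B r (s r))) (at 0) = ?m 0 *v \<sigma> + m' *v w"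
      by (rule vector_derivative_at)
    have "cov_along A E nab \<Phi> c (\<lambda>r. B r (s r)) 0 = B 0 (cov_along A E nab \<Phi> c s 0)"
      using par s(1,2) T(2) W unfolding parallel_along_def by blast
    then have "\<Phi> (cov_along A E nab \<Phi> c (\<lambda>r. B r (s r)) 0) = \<Phi> (B 0 (cov_along A E nab \<Phi> c s 0))" by simp
    then have "(?m 0 *v \<sigma> + m' *v w) + \<omega> *v (?m 0 *v w) = ?m 0 *v (\<sigma> + \<omega> *v w)"
      unfolding cov_along_eq
      by (simp add: vd vector_derivative_at[OF \<sigma>] ms[OF M(2)] s(3) triv_triv_inv[OF W] \<omega>_def
          end_mat_apply[OF W B[OF T(2)] triv_inv_in_fibre[OF W], symmetric])
    then show ?thesis
      by (simp add: matrix_vector_mult_diff_rdistrib matrix_vector_mul_assoc[symmetric] matrix_vector_right_distrib algebra_simps)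
  qed
  then have "m' = ?m 0 ** \<omega> - \<omega> ** ?m 0" by (simp add: matrix_eq)
  with m' show ?thesis by simp
qed

text \<open>The definition asks for \<open>\<nabla>(B s) = B \<nabla>s\<close> in every trivialisation. The equation \<open>b' = b \<omega> - \<omega> b\<close> passes from one to another,
  because the gauge transformation of \<open>\<omega>\<close> compensates the derivatives of the transition matrices.\<close>

lemma parallel_alongI:
  fixes c :: "real \<Rightarrow> 'm"
  assumes c: "smooth_map_on std_atlas A T c" and T: "open T" and W: "(W, \<Phi>) \<in> trivs E" "c ` T \<subseteq> W"
    and B: "\<And>t. t \<in> T \<Longrightarrow> B t \<in> End_fibre E (c t)" and sm: "smooth_on T (\<lambda>t. end_mat \<Phi> (c t) (B t))"
    and deriv: "\<And>t. t \<in> T \<Longrightarrow> ((\<lambda>t. end_mat \<Phi> (c t) (B t)) has_vector_derivative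
      (end_mat \<Phi> (c t) (B t) ** conn_mat \<Phi> (c t) (velocity A c t) -
       conn_mat \<Phi> (c t) (velocity A c t) ** end_mat \<Phi> (c t) (B t))) (at t)"
  shows "parallel_along A E nab T c B"
proof -
  have main: "cov_along A E nab \<Psi> c (\<lambda>r. B r (s r)) t = B t (cov_along A E nab \<Psi> c s t)"
    if s: "smooth_map_on std_atlas (total_atlas A E) T s" "\<forall>t\<in>T. s t \<in> fibre E (c t)"
      and t: "t \<in> T" and V: "(V, \<Psi>) \<in> trivs E" "c t \<in> V" for s t V \<Psi>
  proof -
    let ?v = "velocity A c t" and ?m = "\<lambda>t. end_mat \<Psi> (c t) (B t)"
    obtain \<kappa> where k: "\<kappa> \<in> A" "c t \<in> fst \<kappa>" by (rule chart_at)
    have ctW: "c t \<in> W" using W t by blast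
    note tv = velocity_in_tangent_space[OF c t]
    define g h where "g r = trans_mat \<Phi> \<Psi> (c r)" and "h r = trans_mat \<Psi> \<Phi> (c r)" for r
    define o1 o2 where "o1 = conn_mat \<Phi> (c t) ?v" and "o2 = conn_mat \<Psi> (c t) ?v"
    define b where "b r = end_mat \<Phi> (c r) (B r)" for r
    have op: "open (W \<inter> V)" "open (V \<inter> W)" using open_triv[OF W(1)] open_triv[OF V(1)] by auto
    have dg: "(g has_vector_derivative (g t ** o1 - o2 ** g t)) (at t)"
      using velocity_eq_lift(2)[OF c t k op(1) smooth_trans_mat[OF W(1) V(1)]] ctW V(2)
      unfolding conn_mat_change[OF W(1) ctW V tv k] g_def o1_def o2_def by simp
    have dh: "(h has_vector_derivative (h t ** o2 - o1 ** h t)) (at t)"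
      using velocity_eq_lift(2)[OF c t k op(2) smooth_trans_mat[OF V(1) W(1)]] ctW V(2)
      unfolding conn_mat_change[OF V W(1) ctW tv k] h_def o1_def o2_def by simp
    have db: "(b has_vector_derivative (b t ** o1 - o1 ** b t)) (at t)"
      using deriv[OF t] unfolding b_def o1_def .
    note bmm = bounded_bilinear_matrix_mult
    have 1: "((\<lambda>r. g r ** b r ** h r) has_vector_derivative
        (g t ** b t ** (h t ** o2 - o1 ** h t) + (g t ** (b t ** o1 - o1 ** b t) + (g t ** o1 - o2 ** g t) ** b t) ** h t)) (at t)"
      by (intro bounded_bilinear.has_vector_derivative[OF bmm] dg dh db)
    have eq: "g t ** b t ** (h t ** o2 - o1 ** h t) + (g t ** (b t ** o1 - o1 ** b t) + (g t ** o1 - o2 ** g t) ** b t) ** h t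
        = (g t ** b t ** h t) ** o2 - o2 ** (g t ** b t ** h t)"
      by (simp add: matrix_eq matrix_vector_mul_assoc[symmetric] matrix_vector_right_distrib
          matrix_vector_mult_diff_distrib matrix_vector_mult_add_rdistrib matrix_vector_mult_diff_rdistrib)
    obtain M where M: "open M" "t \<in> M" "M \<subseteq> T" "c ` M \<subseteq> V"
      by (rule smooth_curve_eventually[OF c t open_triv[OF V(1)] V(2)])
    have m_eq: "g r ** b r ** h r = ?m r" if "r \<in> M" for r
      unfolding g_def b_def h_def using that M W(2)
      by (intro end_mat_change[OF W(1) V(1), symmetric] B) auto
    have dm: "(?m has_vector_derivative (?m t ** o2 - o2 ** ?m t)) (at t)"
      using has_vector_derivative_transform_within_open[OF 1[unfolded eq] M(1,2) m_eq] by (simp add: m_eq[OF M(2)])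
    obtain \<sigma> where \<sigma>: "((\<lambda>r. \<Psi> (s r)) has_vector_derivative \<sigma>) (at t)"
      using section_along_differentiable[OF s(1) _ c t V] s(2)
      by (auto simp: differentiable_iff_scaleR has_vector_derivative_def)
    have ms: "\<Psi> (B r (s r)) = ?m r *v \<Psi> (s r)" if "r \<in> M" for r
    proof -
      have "c r \<in> V" "r \<in> T" using M that by auto
      then show ?thesis using end_mat_apply[OF V(1), of "c r" "B r" "s r"] B s(2) by simp
    qed
    have "((\<lambda>r. ?m r *v \<Psi> (s r)) has_vector_derivative (?m t *v \<sigma> + (?m t ** o2 - o2 ** ?m t) *v \<Psi> (s t))) (at t)"
      by (rule bounded_bilinear.has_vector_derivative[OF bounded_bilinear_matrix_vector dm \<sigma>])
    then have "((\<lambda>r. \<Psi> (B r (s r))) has_vector_derivative (?m t *v \<sigma> + (?m t ** o2 - o2 ** ?m t) *v \<Psi> (s t))) (at t)"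
      by (rule has_vector_derivative_transform_within_open[OF _ M(1,2)]) (simp add: ms)
    then have vd: "vector_derivative (\<lambda>r. \<Psi> (B r (s r))) (at t) = ?m t *v \<sigma> + (?m t ** o2 - o2 ** ?m t) *v \<Psi> (s t)"
      by (rule vector_derivative_at)
    have fib: "cov_along A E nab \<Psi> c s t \<in> fibre E (c t)" "cov_along A E nab \<Psi> c (\<lambda>r. B r (s r)) t \<in> fibre E (c t)"
      unfolding cov_along_eq by (rule triv_inv_in_fibre[OF V])+
    have "\<Psi> (cov_along A E nab \<Psi> c (\<lambda>r. B r (s r)) t) = \<Psi> (B t (cov_along A E nab \<Psi> c s t))"
      unfolding end_mat_apply[OF V B[OF t] fib(1), symmetric]
      by (simp add: cov_along_eq vd vector_derivative_at[OF \<sigma>] ms[OF M(2)] triv_triv_inv[OF V] o2_def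
          matrix_vector_right_distrib matrix_vector_mult_diff_rdistrib matrix_vector_mul_assoc[symmetric])
    then show ?thesis
      using triv_inject[OF V fib(2) End_fibreD[OF B[OF t] fib(1)]] by simp
  qed
  show ?thesis
    unfolding parallel_along_def
  proof (intro conjI allI impI ballI)
    show "smooth_map_on std_atlas (End_atlas A E) T (\<lambda>t. (c t, B t))"
      by (rule End_curveI[OF c T W B sm])
    fix s t p
    assume s: "smooth_map_on std_atlas (total_atlas A E) T s \<and> (\<forall>t\<in>T. s t \<in> fibre E (c t))"
      and t: "t \<in> T" and p: "p \<in> trivs E"
    show "case p of (W, \<Phi>) \<Rightarrow> c t \<in> W \<longrightarrow>
        cov_along A E nab \<Phi> c (\<lambda>r. B r (s r)) t = B t (cov_along A E nab \<Phi> c s t)"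
      using main[of s t] s t p by (cases p) simp
  qed
qed

text \<open>A curve that is straight in the chart \<open>\<kappa>\<close>. For \<open>v = 0\<close> it is constant, so that vertical curves are included as a special case.\<close>

lemma line_in_domain:
  assumes k: "\<kappa> \<in> A" "x \<in> fst \<kappa>" and W: "(W, \<Phi>) \<in> trivs E" "x \<in> W"
  obtains r c where "r > 0" "smooth_map_on std_atlas A {-r<..<r} c" "c 0 = x"
    "\<And>t. t \<in> {-r<..<r} \<Longrightarrow> c t \<in> fst \<kappa> \<inter> W"
    "\<And>t. t \<in> {-r<..<r} \<Longrightarrow> velocity A c t = lift \<kappa> (c t) v" "v = 0 \<longrightarrow> (\<forall>t. c t = x)"
proof -
  let ?c = "\<lambda>t. chart_inv \<kappa> (snd \<kappa> x + t *\<^sub>R v)"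
  obtain r where r: "r > 0" "\<And>t. \<bar>t\<bar> < r \<Longrightarrow> snd \<kappa> x + t *\<^sub>R v \<in> snd \<kappa> ` fst \<kappa>"
    "smooth_map_on std_atlas A {-r<..<r} ?c" "\<And>t. \<bar>t\<bar> < r \<Longrightarrow> velocity A ?c t \<kappa> = v"
    by (rule smooth_line[OF k, of v]) (rule that)
  have c0: "?c 0 = x" using k by simp
  obtain M where M: "open M" "0 \<in> M" "M \<subseteq> {-r<..<r}" "?c ` M \<subseteq> fst \<kappa> \<inter> W"
  proof -
    have "0 \<in> {-r<..<r}" "open (fst \<kappa> \<inter> W)" "?c 0 \<in> fst \<kappa> \<inter> W"
      using r(1) open_chart[OF k(1)] open_triv[OF W(1)] c0 k W by auto
    from smooth_curve_eventually[OF r(3) this] show ?thesis using that by metis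
  qed
  obtain \<delta> where d: "\<delta> > 0" "ball 0 \<delta> \<subseteq> M" using M open_contains_ball by metis
  have dM: "t \<in> M" if "t \<in> {-\<delta><..<\<delta>}" for t using d that by (auto simp: subset_iff dist_real_def)
  show ?thesis
  proof (rule that[OF d(1) smooth_curve_subset[OF r(3)] c0])
    show "{-\<delta><..<\<delta>} \<subseteq> {-r<..<r}" using dM M(3) by blast
    show dom: "?c t \<in> fst \<kappa> \<inter> W" if "t \<in> {-\<delta><..<\<delta>}" for t using dM[OF that] M(4) by blast
    show "velocity A ?c t = lift \<kappa> (?c t) v" if t: "t \<in> {-\<delta><..<\<delta>}" for t
    proof -
      have tr: "t \<in> {-r<..<r}" using dM[OF t] M(3) by blast
      then have "velocity A ?c t \<kappa> = v" by (intro r(4)) auto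
      with velocity_eq_lift(1)[OF r(3) tr k(1)] dom[OF t] show ?thesis by auto
    qed
    show "v = 0 \<longrightarrow> (\<forall>t. ?c t = x)" using k by simp
  qed simp
qed

text \<open>The equation \<open>b' = b \<Omega> - \<Omega> b\<close> is solved along a straight line with velocity \<open>v\<close>, where \<open>\<Omega>\<close> is smooth.
  Its right hand side is as often differentiable as \<open>b\<close>, whence \<open>b\<close> is smooth.\<close>

lemma parallel_along_exists:
  assumes k: "\<kappa> \<in> A" "x \<in> fst \<kappa>" and W: "(W, \<Phi>) \<in> trivs E" "x \<in> W" and B0: "B0 \<in> End_fibre E x"
  obtains \<epsilon> c B where "\<epsilon> > 0" "smooth_map_on std_atlas A {-\<epsilon><..<\<epsilon>} c" "c 0 = x" "B 0 = B0"
    "velocity A c 0 = lift \<kappa> x v" "parallel_along A E nab {-\<epsilon><..<\<epsilon>} c B"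
proof -
  obtain r c where r: "r > 0" "smooth_map_on std_atlas A {-r<..<r} c" "c 0 = x"
    "\<And>t. t \<in> {-r<..<r} \<Longrightarrow> c t \<in> fst \<kappa> \<inter> W"
    "\<And>t. t \<in> {-r<..<r} \<Longrightarrow> velocity A c t = lift \<kappa> (c t) v"
    using line_in_domain[OF k W, of v] by metis
  define \<Omega> where "\<Omega> t = conn_mat \<Phi> (c t) (velocity A c t)" for t
  have "open (W \<inter> fst \<kappa>)" using open_triv[OF W(1)] open_chart[OF k(1)] by auto
  then have "smooth_on {-r<..<r} (\<lambda>t. conn_mat \<Phi> (c t) (lift \<kappa> (c t) v))"
    by (intro smooth_fun_curve[OF r(2) _ _ smooth_conn_mat[OF W(1) k(1)]]) (use r(4) in auto)
  then have s\<Omega>: "smooth_on {-r<..<r} \<Omega>"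
    by (rule smooth_on_cong) (simp_all add: \<Omega>_def r(5))
  \<comment> \<open>A compact interval, on which \<open>\<Omega>\<close> is bounded.\<close>
  define q where "q = r / 2"
  have q: "q > 0" "{-q..q} \<subseteq> {-r<..<r}" using r(1) by (auto simp: q_def)
  have c\<Omega>: "continuous_on {-q..q} \<Omega>"
    by (rule continuous_on_subset[OF smooth_on_continuous_on[OF s\<Omega>] q(2)])
  obtain K where K: "K > 0" "\<And>t. t \<in> {-q..q} \<Longrightarrow> norm (\<Omega> t) \<le> K"
    using compact_imp_bounded[OF compact_continuous_image[OF c\<Omega> compact_Icc]] unfolding bounded_pos by auto
  have "\<exists>C>0. \<forall>(a::real^'k^'k) (b::real^'k^'k). norm (a ** b) \<le> norm a * norm b * C"
    by (rule bounded_bilinear.pos_bounded[OF bounded_bilinear_matrix_mult])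
  then obtain C where C: "C > 0" "\<And>(a::real^'k^'k) (b::real^'k^'k). norm (a ** b) \<le> norm a * norm b * C" by blast
  define F where "F t y = y ** \<Omega> t - \<Omega> t ** y" for t y
  obtain \<delta> b where b: "\<delta> > 0" "\<delta> \<le> q" "b 0 = end_mat \<Phi> x B0"
    "\<And>t. t \<in> {-\<delta><..<\<delta>} \<Longrightarrow> (b has_vector_derivative F t (b t)) (at t)"
  proof (rule lipschitz_ode_exists[OF q(1), of F "2 * K * C" "end_mat \<Phi> x B0"])
    show "continuous_on {-q..q} (\<lambda>t. F t (b t))" if "continuous_on {-q..q} b" for b
      unfolding F_def by (intro continuous_on_diff bounded_bilinear.continuous_on[OF bounded_bilinear_matrix_mult] that c\<Omega>)
    show "norm (F t y - F t z) \<le> 2 * K * C * norm (y - z)" if t: "t \<in> {-q..q}" for t y z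
    proof -
      have "F t y - F t z = (y - z) ** \<Omega> t - \<Omega> t ** (y - z)"
        by (simp add: F_def bounded_bilinear.diff_left[OF bounded_bilinear_matrix_mult]
            bounded_bilinear.diff_right[OF bounded_bilinear_matrix_mult])
      then have "norm (F t y - F t z) \<le> norm ((y - z) ** \<Omega> t) + norm (\<Omega> t ** (y - z))"
        by (simp add: norm_triangle_ineq4)
      also have "\<dots> \<le> norm (y - z) * norm (\<Omega> t) * C + norm (\<Omega> t) * norm (y - z) * C"
        by (intro add_mono C)
      also have "\<dots> = 2 * C * norm (y - z) * norm (\<Omega> t)" by simp
      also have "\<dots> \<le> 2 * C * norm (y - z) * K"
        using K(2)[OF t] C(1) by (intro mult_left_mono) auto
      finally show ?thesis by (simp add: mult_ac)
    qed
  qed (use that in blast)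
  let ?D = "{-\<delta><..<\<delta>}"
  have D: "open ?D" "?D \<subseteq> {-r<..<r}" "0 \<in> ?D" using b(1,2) q by auto
  note bmm = bounded_bilinear_matrix_mult
  have "ck_on l ?D b" for l
  proof (induction l)
    case 0
    have "isCont b t" if "t \<in> ?D" for t using has_vector_derivative_continuous[OF b(4)[OF that]] .
    then show ?case by (simp add: continuous_at_imp_continuous_on)
  next
    case (Suc l)
    have "ck_on l ?D \<Omega>" using smooth_on_subset[OF s\<Omega> D(2)] by (simp add: smooth_on_def)
    then have "ck_on l ?D (\<lambda>t. b t ** \<Omega> t)" "ck_on l ?D (\<lambda>t. \<Omega> t ** b t)"
      using ck_on_bilinear[OF D(1) bmm] Suc.IH by blast+
    then have "ck_on l ?D (\<lambda>t. b t ** \<Omega> t + - (\<Omega> t ** b t))"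
      by (intro ck_on_add[OF D(1)] ck_on_linear_comp[OF D(1) bounded_linear_minus[OF bounded_linear_ident]])
    then have "ck_on l ?D (\<lambda>t. F t (b t))" by (simp add: F_def)
    then have "ck_on l ?D (\<lambda>t. h *\<^sub>R F t (b t))" for h
      by (rule ck_on_linear_comp[OF D(1) bounded_linear_scaleR_right])
    then show ?case
      by (intro ck_on_SucI[where f' = "\<lambda>t h. h *\<^sub>R F t (b t)"] D(1)) (use b(4) in \<open>simp add: has_vector_derivative_def\<close>)
  qed
  then have sb: "smooth_on ?D b" by (simp add: smooth_on_def)
  define B where "B t = mat_end \<Phi> (c t) (b t)" for t
  have cW: "c t \<in> W" if "t \<in> ?D" for t using r(4) D(2) that by blast
  have mB: "end_mat \<Phi> (c t) (B t) = b t" if "t \<in> ?D" for t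
    unfolding B_def by (rule end_mat_mat_end[OF W(1) cW[OF that]])
  have cD: "smooth_map_on std_atlas A ?D c" by (rule smooth_curve_subset[OF r(2) D(1,2)])
  have "parallel_along A E nab ?D c B"
  proof (rule parallel_alongI[OF cD D(1) W(1)])
    show "c ` ?D \<subseteq> W" using cW by blast
    show "B t \<in> End_fibre E (c t)" if "t \<in> ?D" for t
      unfolding B_def by (rule mat_end_in_End_fibre[OF W(1) cW[OF that]])
    show "smooth_on ?D (\<lambda>t. end_mat \<Phi> (c t) (B t))"
      by (rule smooth_on_cong[OF sb D(1)]) (simp add: mB)
    fix t assume t: "t \<in> ?D"
    have "((\<lambda>t. end_mat \<Phi> (c t) (B t)) has_vector_derivative F t (b t)) (at t)"
      by (rule has_vector_derivative_transform_within_open[OF b(4)[OF t] D(1) t]) (simp add: mB)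
    then show "((\<lambda>t. end_mat \<Phi> (c t) (B t)) has_vector_derivative
      (end_mat \<Phi> (c t) (B t) ** conn_mat \<Phi> (c t) (velocity A c t) -
       conn_mat \<Phi> (c t) (velocity A c t) ** end_mat \<Phi> (c t) (B t))) (at t)"
      by (simp add: mB[OF t] F_def \<Omega>_def)
  qed
  moreover have "B 0 = B0"
    unfolding B_def by (simp add: r(3) b(3) mat_end_end_mat[OF W B0])
  moreover have "velocity A c 0 = lift \<kappa> x v" using r(5)[of 0] r(1,3) by simp
  ultimately show ?thesis using that[OF b(1) cD r(3)] by blast
qed

end

section \<open>The tangent space of a stratum\<close>

locale stratum_at = bundle_connection A E nab
  for A :: "('m::{t2_space, second_countable_topology}, complex^'d) chart set"
    and E :: "('m, 'e, 'k::finite) vbundle"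
    and nab :: "('m, 'd, 'e) conn" +
  fixes J :: "'m \<Rightarrow> 'e \<Rightarrow> 'e" and pl mi :: bool and d1 d2 :: nat
    and x :: 'm and K :: "'e \<Rightarrow> 'e" and \<kappa> :: "('m, complex^'d) chart" and W :: "'m set" and \<Phi> :: "'e \<Rightarrow> real^'k"
  assumes J: "smooth_twistor_section A E J" and J_parallel: "parallel_section A E nab J"
    and K: "(x, K) \<in> twistor_stratum J pl mi d1 d2"
    and \<kappa>: "\<kappa> \<in> A" "x \<in> fst \<kappa>" and W: "(W, \<Phi>) \<in> trivs E" "x \<in> W"
begin

abbreviation "Strat \<equiv> twistor_stratum J pl mi d1 d2"
abbreviation "\<nu> \<equiv> End_chart \<kappa> W \<Phi>"
definition "b0 = end_mat \<Phi> x K"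
definition "j0 = end_mat \<Phi> x (J x)"
definition "\<omega> v = conn_mat \<Phi> x (lift \<kappa> x v)"
abbreviation "V0 \<equiv> stratum_tangent j0 b0 pl mi"

lemmas J_End = smooth_twistor_sectionD(1)[OF J]

lemma K_End: "K \<in> End_fibre E x" and b0_stratum: "b0 \<in> stratum j0 pl mi d1 d2"
  using K twistor_stratum_iff[of W \<Phi> x J, OF W J_End] by (auto simp: b0_def j0_def)

lemma j_squared: "y \<in> W \<Longrightarrow> end_mat \<Phi> y (J y) ** end_mat \<Phi> y (J y) = - mat 1"
  using J twistor_space_iff[OF W(1)] unfolding smooth_twistor_section_def by blast

lemma linear_\<omega>: "linear \<omega>"
  unfolding \<omega>_def by (rule conn_mat_linear[OF W \<kappa>])

lemma J_along_curve:
  fixes c :: "real \<Rightarrow> 'm"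
  assumes c: "smooth_map_on std_atlas A T c" and T: "0 \<in> T" and c0: "c 0 = x" and v: "v = velocity A c 0 \<kappa>"
  shows "((\<lambda>t. end_mat \<Phi> (c t) (J (c t))) has_vector_derivative (j0 ** \<omega> v - \<omega> v ** j0)) (at 0)"
    and "velocity A c 0 = lift \<kappa> x v"
proof -
  show vel: "velocity A c 0 = lift \<kappa> x v"
    using velocity_eq_lift(1)[OF c T \<kappa>(1)] \<kappa>(2) c0 v by simp
  have tv: "velocity A c 0 \<in> tangent_space A x" using velocity_in_tangent_space[OF c T] c0 by simp
  show "((\<lambda>t. end_mat \<Phi> (c t) (J (c t))) has_vector_derivative (j0 ** \<omega> v - \<omega> v ** j0)) (at 0)"
    using velocity_eq_lift(2)[OF c T \<kappa>(1) _ open_triv[OF W(1)] smooth_twistor_sectionD(2)[OF J W(1)]] \<kappa>(2) W(2)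
      parallel_section_deriv[OF J J_parallel W tv \<kappa>]
    by (simp add: c0 vel j0_def \<omega>_def)
qed

lemma stratum_curve_tangent:
  fixes c :: "real \<Rightarrow> 'm"
  assumes e: "\<epsilon> > 0" and cB: "smooth_map_on std_atlas (End_atlas A E) {-\<epsilon><..<\<epsilon>} (\<lambda>t. (c t, B t))"
    and 0: "c 0 = x" "B 0 = K" and inS: "\<And>t. t \<in> {-\<epsilon><..<\<epsilon>} \<Longrightarrow> (c t, B t) \<in> Strat"
  obtains v Y where "velocity (End_atlas A E) (\<lambda>t. (c t, B t)) 0 = End_lift \<nu> (x, K) (v, Y)"
    "v = velocity A c 0 \<kappa>" "Y + \<omega> v ** b0 - b0 ** \<omega> v \<in> V0"
proof -
  let ?T = "{-\<epsilon><..<\<epsilon>}" and ?m = "\<lambda>t. end_mat \<Phi> (c t) (B t)"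
  have T: "open ?T" "0 \<in> ?T" using e by auto
  note B = End_curveD(1)[OF cB T(1)] and c = End_curveD(2)[OF cB T(1)]
  have c0: "c 0 \<in> fst \<kappa>" "c 0 \<in> W" using 0 \<kappa> W by auto
  obtain M where M: "open M" "0 \<in> M" "M \<subseteq> ?T" "c ` M \<subseteq> W"
    by (rule smooth_curve_eventually[OF c T(2) open_triv[OF W(1)] c0(2)])
  have "smooth_on M ?m" by (rule End_curveD(3)[OF cB T(1) W(1) M(1,3,4)])
  from smooth_on_differentiable[OF this M(2)]
  obtain Y where Y: "(?m has_vector_derivative Y) (at 0)"
    by (auto simp: differentiable_iff_scaleR has_vector_derivative_def)
  define v where "v = velocity A c 0 \<kappa>"
  have vel: "velocity (End_atlas A E) (\<lambda>t. (c t, B t)) 0 = End_lift \<nu> (x, K) (v, Y)"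
    using End_velocity_eq_lift[OF cB T \<kappa>(1) W(1) c0 Y] by (simp add: 0 v_def)
  have str: "?m t \<in> stratum (end_mat \<Phi> (c t) (J (c t))) pl mi d1 d2" if "t \<in> M" for t
  proof -
    have "c t \<in> W" "t \<in> ?T" using that M by auto
    then show ?thesis using twistor_stratum_iff[of W \<Phi> "c t" J, OF W(1) _ J_End] inS by blast
  qed
  have "Y + \<omega> v ** ?m 0 - ?m 0 ** \<omega> v \<in> stratum_tangent (end_mat \<Phi> (c 0) (J (c 0))) (?m 0) pl mi"
  proof (rule stratum_curve_velocity[OF Y])
    show "((\<lambda>t. end_mat \<Phi> (c t) (J (c t))) has_vector_derivative
        end_mat \<Phi> (c 0) (J (c 0)) ** \<omega> v - \<omega> v ** end_mat \<Phi> (c 0) (J (c 0))) (at 0)"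
      using J_along_curve(1)[OF c T(2) 0(1) v_def] by (simp add: 0 j0_def)
    show "end_mat \<Phi> (c 0) (J (c 0)) ** end_mat \<Phi> (c 0) (J (c 0)) = - mat 1" by (rule j_squared[OF c0(2)])
    show "?m 0 \<in> stratum (end_mat \<Phi> (c 0) (J (c 0))) pl mi d1 d2" by (rule str[OF M(2)])
    show "\<forall>\<^sub>F t in at 0. ?m t \<in> stratum (end_mat \<Phi> (c t) (J (c t))) pl mi d1 d2"
      by (rule eventually_mono[OF eventually_at_in_open'[OF M(1,2)] str])
  qed
  then have "Y + \<omega> v ** b0 - b0 ** \<omega> v \<in> V0" by (simp add: 0 b0_def j0_def)
  with vel v_def show ?thesis by (rule that)
qed

text \<open>\<open>stratum_curve_exists\<close> applied to the matrices of \<open>J\<close> along a straight line in the base.\<close>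

lemma stratum_curve_with_tangent:
  assumes X: "X \<in> V0"
  obtains \<epsilon> and c :: "real \<Rightarrow> 'm" and B where "\<epsilon> > 0"
    "smooth_map_on std_atlas (End_atlas A E) {-\<epsilon><..<\<epsilon>} (\<lambda>t. (c t, B t))" "c 0 = x" "B 0 = K"
    "\<And>t. t \<in> {-\<epsilon><..<\<epsilon>} \<Longrightarrow> (c t, B t) \<in> Strat"
    "velocity (End_atlas A E) (\<lambda>t. (c t, B t)) 0 = End_lift \<nu> (x, K) (v, X + b0 ** \<omega> v - \<omega> v ** b0)"
    "v = 0 \<longrightarrow> (\<forall>t. c t = x)"
proof -
  obtain r c where r: "r > 0" "smooth_map_on std_atlas A {-r<..<r} c" "c 0 = x"
    "\<And>t. t \<in> {-r<..<r} \<Longrightarrow> c t \<in> fst \<kappa> \<inter> W"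
    "\<And>t. t \<in> {-r<..<r} \<Longrightarrow> velocity A c t = lift \<kappa> (c t) v" "v = 0 \<longrightarrow> (\<forall>t. c t = x)"
    by (rule line_in_domain[OF \<kappa> W, of v]) (rule that)
  let ?R = "{-r<..<r}" and ?j = "\<lambda>t. end_mat \<Phi> (c t) (J (c t))"
  have R: "open ?R" "0 \<in> ?R" using r(1) by auto
  have v: "v = velocity A c 0 \<kappa>" using r(5)[OF R(2)] r(3) by (simp add: lift_same_chart[OF \<kappa>])
  have cW: "c t \<in> W" if "t \<in> ?R" for t using r(4)[OF that] by blast
  have j0: "?j 0 = j0" by (simp add: r(3) j0_def)
  have sj: "smooth_on ?R ?j"
    by (rule smooth_fun_curve[OF r(2) R(1) open_triv[OF W(1)] smooth_twistor_sectionD(2)[OF J W(1)]]) (use cW in blast)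
  have dj: "(?j has_vector_derivative (?j 0 ** \<omega> v - \<omega> v ** ?j 0)) (at 0)"
    unfolding j0 by (rule J_along_curve(1)[OF r(2) R(2) r(3) v])
  obtain \<delta> b where b: "\<delta> > 0" "\<delta> \<le> r" "smooth_on {-\<delta><..<\<delta>} b" "b 0 = b0"
    "\<And>t. t \<in> {-\<delta><..<\<delta>} \<Longrightarrow> b t \<in> stratum (?j t) pl mi d1 d2"
    "(b has_vector_derivative (X + b0 ** \<omega> v - \<omega> v ** b0)) (at 0)"
  proof (rule stratum_curve_exists[OF r(1) sj _ dj])
    show "?j t ** ?j t = - mat 1" if "t \<in> ?R" for t by (rule j_squared[OF cW[OF that]])
    show "b0 \<in> stratum (?j 0) pl mi d1 d2" "X \<in> stratum_tangent (?j 0) b0 pl mi"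
      using b0_stratum X by (simp_all add: j0)
  qed (use that in blast)
  let ?D = "{-\<delta><..<\<delta>}"
  have D: "open ?D" "0 \<in> ?D" "?D \<subseteq> ?R" using b(1,2) by auto
  define B where "B t = mat_end \<Phi> (c t) (b t)" for t
  have cWD: "c t \<in> W" if "t \<in> ?D" for t using cW that D(3) by blast
  have mB: "end_mat \<Phi> (c t) (B t) = b t" if "t \<in> ?D" for t
    unfolding B_def by (rule end_mat_mat_end[OF W(1) cWD[OF that]])
  have B_End: "B t \<in> End_fibre E (c t)" if "t \<in> ?D" for t
    unfolding B_def by (rule mat_end_in_End_fibre[OF W(1) cWD[OF that]])
  have cB: "smooth_map_on std_atlas (End_atlas A E) ?D (\<lambda>t. (c t, B t))"
  proof (rule End_curveI[OF smooth_curve_subset[OF r(2) D(1,3)] D(1) W(1) _ B_End])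
    show "c ` ?D \<subseteq> W" using cWD by blast
    show "smooth_on ?D (\<lambda>t. end_mat \<Phi> (c t) (B t))"
      by (rule smooth_on_cong[OF b(3) D(1)]) (simp add: mB)
  qed
  have B0: "B 0 = K"
    using mat_end_end_mat[OF W K_End] by (simp add: B_def r(3) b(4) b0_def)
  have dB: "((\<lambda>t. end_mat \<Phi> (c t) (B t)) has_vector_derivative (X + b0 ** \<omega> v - \<omega> v ** b0)) (at 0)"
    by (rule has_vector_derivative_transform_within_open[OF b(6) D(1,2)]) (simp add: mB)
  have "velocity (End_atlas A E) (\<lambda>t. (c t, B t)) 0 = End_lift \<nu> (x, K) (v, X + b0 ** \<omega> v - \<omega> v ** b0)"
    using End_velocity_eq_lift[OF cB D(1,2) \<kappa>(1) W(1) _ _ dB] \<kappa>(2) W(2) by (simp add: r(3) B0 v[symmetric])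
  moreover have "(c t, B t) \<in> Strat" if "t \<in> ?D" for t
    using twistor_stratum_iff[of W \<Phi> "c t" J, OF W(1) cWD[OF that] J_End] B_End[OF that] b(5)[OF that] mB[OF that] by simp
  ultimately show ?thesis using that[OF b(1) cB r(3) B0] r(6) by blast
qed

lemma tangent_to_stratum:
  "tangent_to (End_atlas A E) Strat (x, K) =
    End_lift \<nu> (x, K) ` {(v, X + b0 ** \<omega> v - \<omega> v ** b0) |v X. X \<in> V0}" (is "_ = ?R")
proof (intro set_eqI iffI)
  fix u assume "u \<in> tangent_to (End_atlas A E) Strat (x, K)"
  then obtain \<gamma> \<epsilon> where g: "u = velocity (End_atlas A E) \<gamma> 0" "\<epsilon> > 0"
    "smooth_map_on std_atlas (End_atlas A E) {-\<epsilon><..<\<epsilon>} \<gamma>" "\<gamma> 0 = (x, K)" "\<gamma> ` {-\<epsilon><..<\<epsilon>} \<subseteq> Strat"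
    unfolding tangent_to_def by blast
  have \<gamma>: "\<gamma> = (\<lambda>t. (fst (\<gamma> t), snd (\<gamma> t)))" by simp
  obtain v Y where "u = End_lift \<nu> (x, K) (v, Y)" "Y + \<omega> v ** b0 - b0 ** \<omega> v \<in> V0"
  proof (rule stratum_curve_tangent[OF g(2), of "\<lambda>t. fst (\<gamma> t)" "\<lambda>t. snd (\<gamma> t)"])
    show "smooth_map_on std_atlas (End_atlas A E) {-\<epsilon><..<\<epsilon>} (\<lambda>t. (fst (\<gamma> t), snd (\<gamma> t)))" using g(3) by simp
    show "(fst (\<gamma> t), snd (\<gamma> t)) \<in> Strat" if "t \<in> {-\<epsilon><..<\<epsilon>}" for t using g(5) that by auto
  qed (use g that in auto)
  moreover have "(v, Y) = (v, (Y + \<omega> v ** b0 - b0 ** \<omega> v) + b0 ** \<omega> v - \<omega> v ** b0)" by simp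
  ultimately show "u \<in> ?R" by blast
next
  fix u assume "u \<in> ?R"
  then obtain v X where u: "u = End_lift \<nu> (x, K) (v, X + b0 ** \<omega> v - \<omega> v ** b0)" "X \<in> V0" by auto
  obtain \<epsilon> c B where c: "\<epsilon> > 0"
    "smooth_map_on std_atlas (End_atlas A E) {-\<epsilon><..<\<epsilon>} (\<lambda>t. (c t, B t))" "c 0 = x" "B 0 = K"
    "\<And>t. t \<in> {-\<epsilon><..<\<epsilon>} \<Longrightarrow> (c t, B t) \<in> Strat"
    "velocity (End_atlas A E) (\<lambda>t. (c t, B t)) 0 = End_lift \<nu> (x, K) (v, X + b0 ** \<omega> v - \<omega> v ** b0)"
    by (rule stratum_curve_with_tangent[OF u(2), of v]) (rule that)
  then show "u \<in> tangent_to (End_atlas A E) Strat (x, K)"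
    unfolding tangent_to_def u(1) mem_Collect_eq
    by (intro exI[of _ "\<lambda>t. (c t, B t)"] conjI exI[of _ \<epsilon>]) auto
qed

lemma vertical_space_stratum:
  "vertical_space A E Strat (x, K) = End_lift \<nu> (x, K) ` {(0, X) |X. X \<in> V0}" (is "_ = ?R")
proof (intro set_eqI iffI)
  fix u assume "u \<in> vertical_space A E Strat (x, K)"
  then obtain \<gamma> \<epsilon> where g: "u = velocity (End_atlas A E) \<gamma> 0" "\<epsilon> > 0"
    "smooth_map_on std_atlas (End_atlas A E) {-\<epsilon><..<\<epsilon>} \<gamma>" "\<gamma> 0 = (x, K)"
    "\<gamma> ` {-\<epsilon><..<\<epsilon>} \<subseteq> {q \<in> Strat. fst q = fst (x, K)}"
    unfolding vertical_space_def tangent_to_def by blast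
  have gS: "\<gamma> t \<in> Strat" "fst (\<gamma> t) = x" if "t \<in> {-\<epsilon><..<\<epsilon>}" for t
    using subsetD[OF g(5) imageI[OF that]] by simp_all
  obtain v Y where vY: "u = End_lift \<nu> (x, K) (v, Y)" "v = velocity A (\<lambda>t. fst (\<gamma> t)) 0 \<kappa>" "Y + \<omega> v ** b0 - b0 ** \<omega> v \<in> V0"
  proof (rule stratum_curve_tangent[OF g(2), of "\<lambda>t. fst (\<gamma> t)" "\<lambda>t. snd (\<gamma> t)"])
    show "smooth_map_on std_atlas (End_atlas A E) {-\<epsilon><..<\<epsilon>} (\<lambda>t. (fst (\<gamma> t), snd (\<gamma> t)))" using g(3) by simp
    show "(fst (\<gamma> t), snd (\<gamma> t)) \<in> Strat" if "t \<in> {-\<epsilon><..<\<epsilon>}" for t using gS(1)[OF that] by simp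
  qed (use g that in auto)
  have "((\<lambda>t. snd \<kappa> (fst (\<gamma> t))) has_vector_derivative 0) (at 0)"
    by (rule has_vector_derivative_transform_within_open[OF has_vector_derivative_const[of "snd \<kappa> x"], of "{-\<epsilon><..<\<epsilon>}"])
      (use g(2) gS in auto)
  then have "v = 0"
    using vY(2) by (simp add: velocity_def o_def vector_derivative_at)
  with vY(1,3) show "u \<in> ?R" by (auto simp: linear_0[OF linear_\<omega>])
next
  fix u assume "u \<in> ?R"
  then obtain X where u: "u = End_lift \<nu> (x, K) (0, X)" "X \<in> V0" by auto
  obtain \<epsilon> c B where c: "\<epsilon> > 0"
    "smooth_map_on std_atlas (End_atlas A E) {-\<epsilon><..<\<epsilon>} (\<lambda>t. (c t, B t))" "c 0 = x" "B 0 = K"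
    "\<And>t. t \<in> {-\<epsilon><..<\<epsilon>} \<Longrightarrow> (c t, B t) \<in> Strat"
    "velocity (End_atlas A E) (\<lambda>t. (c t, B t)) 0 = End_lift \<nu> (x, K) (0, X + b0 ** \<omega> 0 - \<omega> 0 ** b0)"
    "(0 :: complex^'d) = 0 \<longrightarrow> (\<forall>t. c t = x)"
    by (rule stratum_curve_with_tangent[OF u(2), of 0]) (rule that)
  then show "u \<in> vertical_space A E Strat (x, K)"
    unfolding vertical_space_def tangent_to_def u(1) mem_Collect_eq
    by (intro exI[of _ "\<lambda>t. (c t, B t)"] conjI exI[of _ \<epsilon>]) (auto simp: linear_0[OF linear_\<omega>] c(7)[simplified])
qed

lemma horizontal_space_eq:
  "horizontal_space A E nab (x, K) = End_lift \<nu> (x, K) ` {(v, b0 ** \<omega> v - \<omega> v ** b0) |v. True}" (is "_ = ?R")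
proof (intro set_eqI iffI)
  fix u assume "u \<in> horizontal_space A E nab (x, K)"
  then obtain c B \<epsilon> where c: "u = velocity (End_atlas A E) (\<lambda>t. (c t, B t)) 0" "\<epsilon> > 0"
    "smooth_map_on std_atlas A {-\<epsilon><..<\<epsilon>} c" "c 0 = x" "B 0 = K" "parallel_along A E nab {-\<epsilon><..<\<epsilon>} c B"
    unfolding horizontal_space_def by blast
  have T: "open {-\<epsilon><..<\<epsilon>}" "0 \<in> {-\<epsilon><..<\<epsilon>}" using c(2) by auto
  have cB: "smooth_map_on std_atlas (End_atlas A E) {-\<epsilon><..<\<epsilon>} (\<lambda>t. (c t, B t))"
    using c(6) by (simp add: parallel_along_def)
  define v where "v = velocity A c 0 \<kappa>"
  have c0: "c 0 \<in> fst \<kappa>" "c 0 \<in> W" using c(4) \<kappa> W by auto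
  note vel = J_along_curve(2)[OF c(3) T(2) c(4) v_def]
  have "u = End_lift \<nu> (x, K) (v, b0 ** \<omega> v - \<omega> v ** b0)"
    using End_velocity_eq_lift[OF cB T \<kappa>(1) W(1) c0 parallel_along_deriv[OF c(6,2) W(1) c0(2)]]
    unfolding v_def[symmetric] c(1) by (simp add: c(4,5) vel b0_def \<omega>_def)
  then show "u \<in> ?R" by blast
next
  fix u assume "u \<in> ?R"
  then obtain v where u: "u = End_lift \<nu> (x, K) (v, b0 ** \<omega> v - \<omega> v ** b0)" by auto
  obtain \<epsilon> c B where c: "\<epsilon> > 0" "smooth_map_on std_atlas A {-\<epsilon><..<\<epsilon>} c" "c 0 = x" "B 0 = K"
    "velocity A c 0 = lift \<kappa> x v" "parallel_along A E nab {-\<epsilon><..<\<epsilon>} c B"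
    by (rule parallel_along_exists[OF \<kappa> W K_End, of v]) (rule that)
  have T: "open {-\<epsilon><..<\<epsilon>}" "0 \<in> {-\<epsilon><..<\<epsilon>}" using c(1) by auto
  have cB: "smooth_map_on std_atlas (End_atlas A E) {-\<epsilon><..<\<epsilon>} (\<lambda>t. (c t, B t))"
    using c(6) by (simp add: parallel_along_def)
  have c0: "c 0 \<in> fst \<kappa>" "c 0 \<in> W" using c(3) \<kappa> W by auto
  have "velocity (End_atlas A E) (\<lambda>t. (c t, B t)) 0 = u"
    using End_velocity_eq_lift[OF cB T \<kappa>(1) W(1) c0 parallel_along_deriv[OF c(6,1) W(1) c0(2)]]
    unfolding u by (simp add: c(3,4,5) b0_def \<omega>_def lift_same_chart[OF \<kappa>])
  then show "u \<in> horizontal_space A E nab (x, K)"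
    unfolding horizontal_space_def mem_Collect_eq using c
    by (intro exI[of _ c] exI[of _ B] conjI exI[of _ \<epsilon>]) auto
qed

text \<open>In coordinates the vertical space is \<open>0 \<times> V0\<close> and the horizontal space is the graph of a linear map \<open>h\<close> of the base directions.\<close>

lemma stratum_direct_sum:
  "is_direct_sum (tangent_to (End_atlas A E) Strat (x, K)) (vertical_space A E Strat (x, K)) (horizontal_space A E nab (x, K))"
proof -
  let ?L = "End_lift \<nu> (x, K)"
  have p: "(x, K) \<in> fst \<nu>" using \<kappa>(2) W(2) K_End by (simp add: End_chart_def)
  have L: "linear ?L" by (rule linear_End_lift[OF End_atlasI[OF \<kappa>(1) W(1)] p])
  have inj: "?L u = ?L w \<Longrightarrow> u = w" for u w
    using End_lift_same_chart[OF \<kappa>(1) W(1) p] by metis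
  define h where "h v = (v, b0 ** \<omega> v - \<omega> v ** b0)" for v
  have h: "linear h"
    unfolding h_def
    by (intro linearI) (simp_all add: linear_add[OF linear_\<omega>] linear_cmul[OF linear_\<omega>] matrix_add_ldistrib
        bounded_bilinear.add_left[OF bounded_bilinear_matrix_mult] matrix_scalar_ac scalar_matrix_assoc[symmetric] scaleR_diff_right)
  note sub = subspace_stratum_tangent[of j0 b0 pl mi]
  have V: "subspace {(0 :: complex^'d, X) |X. X \<in> V0}"
    using subspace_0[OF sub] subspace_add[OF sub] subspace_scale[OF sub] by (auto simp: subspace_def zero_prod_def)
  have H: "{(v, b0 ** \<omega> v - \<omega> v ** b0) |v. True} = range h" by (auto simp: h_def)
  show ?thesis
    unfolding is_direct_sum_def tangent_to_stratum vertical_space_stratum horizontal_space_eq H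
  proof (intro conjI)
    show "subspace (?L ` {(0, X) |X. X \<in> V0})" by (rule linear_subspace_image[OF L V])
    show "subspace (?L ` range h)" by (intro linear_subspace_image[OF L] linear_subspace_image[OF h] subspace_UNIV)
    show "?L ` {(0, X) |X. X \<in> V0} \<inter> ?L ` range h = {0}"
    proof (intro equalityI subsetI)
      fix u assume "u \<in> ?L ` {(0, X) |X. X \<in> V0} \<inter> ?L ` range h"
      then obtain X v where u: "u = ?L (0, X)" "u = ?L (h v)" by blast
      then have "(0, X) = h v" using inj by metis
      then have "h v = 0" using linear_0[OF h] by (auto simp: h_def)
      then show "u \<in> {0}" using u(2) linear_0[OF L] by simp
    next
      fix u :: "('m \<times> ('e \<Rightarrow> 'e), (complex^'d) \<times> (real^'k^'k)) tvec"
      assume "u \<in> {0}"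
      then have "u = ?L (0, 0)" "u = ?L (h 0)" using linear_0[OF L] linear_0[OF h] by (simp_all add: zero_prod_def)
      then show "u \<in> ?L ` {(0, X) |X. X \<in> V0} \<inter> ?L ` range h" using subspace_0[OF sub] by blast
    qed
    show "?L ` {(v, X + b0 ** \<omega> v - \<omega> v ** b0) |v X. X \<in> V0} =
        {u + w |u w. u \<in> ?L ` {(0, X) |X. X \<in> V0} \<and> w \<in> ?L ` range h}"
    proof (intro equalityI subsetI)
      fix u assume "u \<in> ?L ` {(v, X + b0 ** \<omega> v - \<omega> v ** b0) |v X. X \<in> V0}"
      then obtain v X where u: "u = ?L (v, X + b0 ** \<omega> v - \<omega> v ** b0)" "X \<in> V0" by auto
      have "(v, X + b0 ** \<omega> v - \<omega> v ** b0) = (0, X) + h v" by (simp add: h_def)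
      then have "u = ?L (0, X) + ?L (h v)" using u(1) linear_add[OF L] by simp
      then show "u \<in> {u + w |u w. u \<in> ?L ` {(0, X) |X. X \<in> V0} \<and> w \<in> ?L ` range h}" using u(2) by blast
    next
      fix u assume "u \<in> {u + w |u w. u \<in> ?L ` {(0, X) |X. X \<in> V0} \<and> w \<in> ?L ` range h}"
      then obtain X v where u: "u = ?L (0, X) + ?L (h v)" "X \<in> V0" by auto
      have "(v, X + b0 ** \<omega> v - \<omega> v ** b0) = (0, X) + h v" by (simp add: h_def)
      then have "u = ?L (v, X + b0 ** \<omega> v - \<omega> v ** b0)" using u(1) linear_add[OF L] by simp
      then show "u \<in> ?L ` {(v, X + b0 ** \<omega> v - \<omega> v ** b0) |v X. X \<in> V0}" using u(2) by blast
    qed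
  qed
qed

end

theorem proposition6p30:
  fixes A :: "('m::{t2_space, second_countable_topology}, complex^'d) chart set"
    and E :: "('m, 'e, 'k::finite) vbundle"
    and nab :: "('m, 'd, 'e) conn"
    and J :: "'m \<Rightarrow> 'e \<Rightarrow> 'e"
    and n m1 m2 :: nat
    and S :: "('m \<times> ('e \<Rightarrow> 'e)) set"
    and K :: "'m \<times> ('e \<Rightarrow> 'e)"
  assumes "complex_manifold A"
    and "vector_bundle A E"
    and "CARD('k) = 2 * n"
    and "connection A E nab"
    and "curvature_1_1 A E nab"
    and "smooth_twistor_section A E J"
    and "parallel_section A E nab J"
    and "S = C_plus E J m1 \<or> S = C_minus E J m2 \<or> S = C_both E J m1 m2"
    and "K \<in> S"
  shows "is_direct_sum (tangent_to (End_atlas A E) S K)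
           (vertical_space A E S K) (horizontal_space A E nab K)"
proof -
  interpret bundle_connection A E nab
    by unfold_locales (use assms in auto)
  obtain pl mi where S: "S = twistor_stratum J pl mi (2 * m1) (2 * m2)"
  proof -
    have "S = twistor_stratum J True False (2 * m1) (2 * m2) \<or> S = twistor_stratum J False True (2 * m1) (2 * m2) \<or>
        S = twistor_stratum J True True (2 * m1) (2 * m2)"
      using assms(8) by (auto simp: C_both_def C_plus_def C_minus_def twistor_stratum_def)
    then show ?thesis using that by blast
  qed
  obtain x L where KxL: "K = (x, L)" by (cases K)
  obtain \<kappa> where \<kappa>: "\<kappa> \<in> A" "x \<in> fst \<kappa>" by (rule chart_at)
  obtain W \<Phi> where W: "(W, \<Phi>) \<in> trivs E" "x \<in> W" by (rule triv_at)
  interpret stratum_at A E nab J pl mi "2 * m1" "2 * m2" x L \<kappa> W \<Phi>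
    by unfold_locales (use assms(6,7,9) S KxL \<kappa> W in auto)
  show ?thesis unfolding S KxL by (rule stratum_direct_sum)
qed

end
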